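(* For any amalgam $(A,B;C)$ of countable periodic groups $A$ and $B$ with finite intersection $C$, there exists a periodic group containing $A$ and $B$ as subgroups such that $A\cap B=C$.
   Context: An amalgam $(A,B;C)$ of groups $A$ and $B$ with intersection $C$ is a pair of groups $A$ and $B$ such that $C=A\cap B$ is a subgroup of both $A$ and $B$ and the multiplications on $C$ inherited from $A$ and from $B$ coincide. A group is periodic if all its elements have finite order. *)

theory Defs
  imports "HOL-Algebra.Algebra" "HOL-Library.Countable_Set"
begin

definition periodic_group :: "('a, 'm) monoid_scheme \<Rightarrow> bool" where
  "periodic_group G \<longleftrightarrow>
     group G \<and> (\<forall>x \<in> carrier G. \<exists>n::nat. 0 < n \<and> x [^]\<^bsub>G\<^esub> n = \<one>\<^bsub>G\<^esub>)"

definition amalgam :: "('a, 'm) monoid_scheme \<Rightarrow> ('a, 'n) monoid_scheme \<Rightarrow> 'a set \<Rightarrow> bool" where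
  "amalgam A B C \<longleftrightarrow>
     group A \<and> group B \<and> C = carrier A \<inter> carrier B \<and> subgroup C A \<and> subgroup C B \<and>
     (\<forall>x \<in> C. \<forall>y \<in> C. x \<otimes>\<^bsub>A\<^esub> y = x \<otimes>\<^bsub>B\<^esub> y)"

(* G contains the amalgam (A, B; C): the groups A and B are identified with subgroups of G by
   monomorphisms f and g that agree on C, and the copies of A and B meet exactly in the copy
   of C.  The maps are needed because G will in general live in a larger type than A and B. *)
definition contains_amalgam ::
    "('c, 'k) monoid_scheme \<Rightarrow> ('a, 'm) monoid_scheme \<Rightarrow> ('a, 'n) monoid_scheme \<Rightarrow> 'a set \<Rightarrow> bool" where
  "contains_amalgam G A B C \<longleftrightarrow>
     (\<exists>f g. f \<in> mon A G \<and> g \<in> mon B G \<and> (\<forall>c \<in> C. f c = g c) \<and>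
            f ` carrier A \<inter> g ` carrier B = f ` C)"

end

theory Submission
  imports Defs
begin

text \<open>
  The amalgamated product \<open>A *\<^sub>C B\<close> with its syllable length is hyperbolic (it acts on a tree), every
  element is torsion or loxodromic, and loxodromic elements are weakly properly discontinuous
  because \<open>C\<close> is finite.  We show that these properties survive when a large power \<open>w ^ N\<close> of a
  loxodromic element is killed, and that elements of length at most two stay nontrivial.  Killing
  a power of each of the countably many elements in turn gives a periodic group; if \<open>a \<in> A\<close> and
  \<open>b \<in> B\<close> become equal in it, then \<open>a b\<^sup>-\<^sup>1\<close> has length at most two, and \<open>a = b\<close> already in the
  amalgam.

  Instead of small cancellation diagrams the step uses the projections of the Cayley graph to the
  translates of the axis of \<open>w\<close>.  They satisfy Behrstock's inequality, and a windmill argument in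
  the spirit of Dahmani--Guirardel--Osin yields an analogue of Greendlinger's lemma.  Geodesic
  polygons of the quotient are lifted and closed up by repeatedly rotating one part of the polygon
  about a line given by this lemma.
\<close>

section \<open>Groups with a geodesic length function\<close>

text \<open>Hyperbolicity, projection and overlap constants of a quotient cannot be controlled by
  those of the group before it, so no constant is passed on. Only a qualitative property
  (\<open>admissible\<close>) is, and lengths never increase, so elements of length at most two are
  protected at every stage; the limit need not be hyperbolic. The factors may be infinite, hence
  balls are infinite and the action is not proper. Weak proper discontinuity is the substitute: it
  forces two translates of an axis to overlap boundedly unless they are equivalent. Three scales
  order the estimates: the length \<open>a\<close> of \<open>w\<close>, a power chosen so that its
  orbit is almost straight; the overlap bound \<open>\<theta>\<close>, counted in periods of
  \<open>w\<close>; and the exponent \<open>N\<close>, thousands of times larger. Hyperbolicity of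
  the quotient rests on one comparison: a shortest lift crosses a line by about half of
  \<open>N\<close> at most, since a longer crossing is shortened by a rotation, while a nontrivial
  kernel element needs almost \<open>N\<close>.\<close>

class mgroup = monoid_mult + inverse +
  assumes mg_left_inv [simp]: "inverse x * x = 1"
begin

lemma mg_right_inv [simp]: "x * inverse x = 1"
proof -
  have "x * inverse x = (inverse (inverse x) * inverse x) * (x * inverse x)"
    by simp
  also have "\<dots> = inverse (inverse x) * (inverse x * x) * inverse x"
    by (simp only: mult_assoc)
  finally show ?thesis by simp
qed

lemma mg_cancel1 [simp]: "inverse x * (x * y) = y"
  by (simp flip: mult_assoc)

lemma mg_cancel2 [simp]: "x * (inverse x * y) = y"
  by (simp flip: mult_assoc)

lemma mg_inv_unique: "x * y = 1 \<Longrightarrow> inverse x = y"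
  by (metis mg_cancel1 mult_1_right)

lemma mg_inv_inv [simp]: "inverse (inverse x) = x"
  by (rule mg_inv_unique) simp

lemma mg_inv_one [simp]: "inverse 1 = 1"
  by (rule mg_inv_unique) simp

lemma mg_inv_mult: "inverse (x * y) = inverse y * inverse x"
  by (rule mg_inv_unique) (simp add: mult_assoc)

lemma mg_left_cancel [simp]: "x * y = x * z \<longleftrightarrow> y = z"
  by (metis mg_cancel1)

lemma mg_right_cancel [simp]: "y * x = z * x \<longleftrightarrow> y = z"
  by (metis mg_right_inv mult_assoc mult_1_right)

end

lemmas mgs = mult.assoc mg_inv_mult

section \<open>Integer powers and generated subgroups\<close>

definition zpow :: "'g::mgroup \<Rightarrow> int \<Rightarrow> 'g" where
  "zpow w i = (if 0 \<le> i then w ^ nat i else inverse w ^ nat (- i))"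

lemma zpow_0 [simp]: "zpow w 0 = 1"
  by (simp add: zpow_def)

lemma zpow_1 [simp]: "zpow w 1 = w"
  by (simp add: zpow_def)

lemma zpow_of_nat: "zpow w (int n) = w ^ n"
  by (simp add: zpow_def)

lemma zpow_succ: "zpow w (i + 1) = zpow w i * w"
proof (cases "0 \<le> i")
  case True
  then have "nat (i + 1) = Suc (nat i)" by simp
  then show ?thesis using True by (simp add: zpow_def power_Suc2 del: power_Suc)
next
  case False
  then have "nat (- i) = Suc (nat (- (i + 1)))" by simp
  then have *: "zpow w i = inverse w ^ nat (- (i + 1)) * inverse w"
    using False by (simp add: zpow_def power_Suc2 del: power_Suc)
  show ?thesis
  proof (cases "i = -1")
    case True
    then show ?thesis by (simp add: zpow_def)
  next
    case False
    then have "zpow w (i + 1) = inverse w ^ nat (- (i + 1))"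
      using \<open>\<not> 0 \<le> i\<close> by (simp add: zpow_def)
    then show ?thesis using * by (simp add: mgs)
  qed
qed

lemma zpow_pred: "zpow w (i - 1) = zpow w i * inverse w"
  using zpow_succ[of w "i - 1"] by (simp add: mgs)

lemma zpow_add: "zpow w (i + j) = zpow w i * zpow w j"
proof (induction j rule: int_induct[of _ 0])
  case (step1 j)
  have "zpow w (i + (j + 1)) = zpow w ((i + j) + 1)" by (simp add: add.assoc)
  also have "\<dots> = zpow w i * (zpow w j * w)"
    by (simp only: zpow_succ step1 mult.assoc)
  finally show ?case by (simp only: zpow_succ)
next
  case (step2 j)
  have "zpow w (i + (j - 1)) = zpow w ((i + j) - 1)" by (simp add: algebra_simps)
  also have "\<dots> = zpow w i * (zpow w j * inverse w)"
    by (simp only: zpow_pred step2 mult.assoc)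
  finally show ?case by (simp only: zpow_pred)
qed simp

lemma zpow_minus: "zpow w (- i) = inverse (zpow w i)"
  by (metis zpow_add zpow_0 add.right_inverse mg_inv_unique)

lemma zpow_diff: "zpow w (i - j) = zpow w i * inverse (zpow w j)"
  by (metis zpow_add zpow_minus diff_conv_add_uminus)

lemma zpow_commute: "zpow w i * zpow w j = zpow w j * zpow w i"
  by (metis zpow_add add.commute)

lemma zpow_mult: "zpow w (i * j) = zpow (zpow w i) j"
proof (induction j rule: int_induct[of _ 0])
  case (step1 j)
  then show ?case by (simp add: distrib_left zpow_add)
next
  case (step2 j)
  then show ?case by (simp add: right_diff_distrib zpow_diff)
qed simp

lemma zpow_conj: "zpow (g * w * inverse g) i = g * zpow w i * inverse g"
proof (induction i rule: int_induct[of _ 0])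
  case (step1 j)
  then show ?case by (simp add: zpow_add mgs)
next
  case (step2 j)
  then show ?case by (simp add: zpow_diff mgs)
qed simp

text \<open>Generators enter on the left only, so that induction prepends one letter at a time, as
  the chain normal forms of the windmills require.\<close>

inductive_set gen :: "'g::mgroup set \<Rightarrow> 'g set" for S where
  gen_one: "1 \<in> gen S"
| gen_mult: "s \<in> S \<Longrightarrow> x \<in> gen S \<Longrightarrow> s * x \<in> gen S"
| gen_inv: "s \<in> S \<Longrightarrow> x \<in> gen S \<Longrightarrow> inverse s * x \<in> gen S"

lemma gen_incl: "s \<in> S \<Longrightarrow> s \<in> gen S"
  using gen_mult[OF _ gen_one] by force

lemma gen_prod: "x \<in> gen S \<Longrightarrow> y \<in> gen S \<Longrightarrow> x * y \<in> gen S"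
  by (induction rule: gen.induct) (auto simp: mult.assoc intro: gen.intros)

lemma gen_inverse: "x \<in> gen S \<Longrightarrow> inverse x \<in> gen S"
proof (induction rule: gen.induct)
  case (gen_mult s x)
  then show ?case
    by (metis gen.gen_inv gen_one gen_prod mg_inv_mult mult_1_right)
next
  case (gen_inv s x)
  then show ?case
    by (metis gen_incl gen_prod mg_inv_inv mg_inv_mult)
qed (auto intro: gen.intros)

lemma gen_conj:
  assumes "\<And>s g. s \<in> S \<Longrightarrow> g * s * inverse g \<in> S" and "x \<in> gen S"
  shows "g * x * inverse g \<in> gen S"
  using assms(2)
proof (induction rule: gen.induct)
  case (gen_mult s x)
  have "g * (s * x) * inverse g = (g * s * inverse g) * (g * x * inverse g)"
    by (simp add: mgs)
  then show ?case using gen_mult assms(1) by (metis gen.gen_mult)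
next
  case (gen_inv s x)
  have "g * (inverse s * x) * inverse g = inverse (g * s * inverse g) * (g * x * inverse g)"
    by (simp add: mgs)
  then show ?case using gen_inv assms(1) by (metis gen.gen_inv)
qed (auto intro: gen.intros)

definition subgrp :: "'g::mgroup set \<Rightarrow> bool" where
  "subgrp H \<longleftrightarrow> 1 \<in> H \<and> (\<forall>x\<in>H. \<forall>y\<in>H. x * y \<in> H) \<and> (\<forall>x\<in>H. inverse x \<in> H)"

lemma subgrp_gen: "subgrp (gen S)"
  by (simp add: subgrp_def gen_one gen_prod gen_inverse)

lemma subgrp_zpow: "subgrp H \<Longrightarrow> x \<in> H \<Longrightarrow> zpow x i \<in> H"
proof (induction i rule: int_induct[of _ 0])
  case (step1 i)
  then show ?case by (simp add: zpow_add subgrp_def)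
next
  case (step2 i)
  then show ?case by (simp add: zpow_diff subgrp_def)
qed (simp add: subgrp_def)

lemma subgrp_mult: "subgrp H \<Longrightarrow> x \<in> H \<Longrightarrow> y \<in> H \<Longrightarrow> x * y \<in> H"
  and subgrp_inv: "subgrp H \<Longrightarrow> x \<in> H \<Longrightarrow> inverse x \<in> H"
  and subgrp_one: "subgrp H \<Longrightarrow> 1 \<in> H"
  by (auto simp: subgrp_def)

text \<open>A length whose kernel \<open>K\<close> is a normal subgroup stands for the quotient by \<open>K\<close>: passing
  to a further quotient only changes the length, so that a single type serves for all groups of
  the iteration.\<close>

locale gnorm =
  fixes \<nu> :: "'g::mgroup \<Rightarrow> nat"
  assumes nu_one [simp]: "\<nu> 1 = 0"
    and nu_inv [simp]: "\<nu> (inverse x) = \<nu> x"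
    and nu_mult: "\<nu> (x * y) \<le> \<nu> x + \<nu> y"
    and nu_normal: "\<nu> k = 0 \<Longrightarrow> \<nu> (g * k * inverse g) = 0"
    and nu_geod: "m \<le> \<nu> x \<Longrightarrow> \<exists>y. \<nu> y = m \<and> \<nu> (inverse y * x) = \<nu> x - m"
begin

definition d :: "'g \<Rightarrow> 'g \<Rightarrow> real" where "d x y = real (\<nu> (inverse x * y))"

definition K :: "'g set" where "K = {k. \<nu> k = 0}"

lemma subgrp_K: "subgrp K"
  unfolding subgrp_def K_def using nu_mult by (auto) (metis add_0 le_zero_eq)

lemma K_conj: "k \<in> K \<Longrightarrow> g * k * inverse g \<in> K"
  by (simp add: K_def nu_normal)

lemma K_conj': "k \<in> K \<Longrightarrow> inverse g * k * g \<in> K"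
  using K_conj[of k "inverse g"] by simp

lemma d_refl [simp]: "d x x = 0"
  by (simp add: d_def)

lemma d_nonneg [simp]: "0 \<le> d x y"
  by (simp add: d_def)

lemma d_sym: "d x y = d y x"
  unfolding d_def by (metis mg_inv_inv mg_inv_mult nu_inv)

lemma d_tri: "d x z \<le> d x y + d y z"
proof -
  have "inverse x * z = (inverse x * y) * (inverse y * z)" by (simp add: mgs)
  then show ?thesis unfolding d_def by (metis nu_mult of_nat_add of_nat_le_iff)
qed

lemma d_left [simp]: "d (g * x) (g * y) = d x y"
  by (simp add: d_def mgs)

lemma d_one: "d 1 x = real (\<nu> x)" "d x 1 = real (\<nu> x)"
  by (simp_all add: d_def)

lemma d_mult_left: "d (g * x) y = d x (inverse g * y)" "d x (g * y) = d (inverse g * x) y"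
  by (simp_all add: d_def mgs)

lemma d_right_mult: "d x (x * y) = real (\<nu> y)"
  by (simp add: d_def)

lemma d_K0 [simp]: "d x y = 0 \<longleftrightarrow> inverse x * y \<in> K"
  by (simp add: d_def K_def)

text \<open>By normality, left multiplication by \<open>k\<close> is right multiplication by a
  conjugate in \<open>K\<close>, which costs distance zero.\<close>

lemma d_K_left: "k \<in> K \<Longrightarrow> d (k * x) y = d x y"
proof -
  assume "k \<in> K"
  then have "d x (k * x) = 0" using K_conj'[of k x] by (simp add: mgs)
  then show ?thesis using d_tri[of "k * x" y x] d_tri[of x y "k * x"] d_sym[of x "k*x"] by linarith
qed

lemma d_K_right: "k \<in> K \<Longrightarrow> d x (k * y) = d x y"
  using d_K_left d_sym by metis

lemma d_eq0_cong: "d x y = 0 \<Longrightarrow> d x z = d y z"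
  using d_tri[of x z y] d_tri[of y z x] d_sym[of x y] by linarith

lemma d_Ints: "\<exists>n::nat. d x y = real n"
  by (auto simp: d_def)

lemma nu_power: "\<nu> (x ^ n) \<le> n * \<nu> x"
proof (induction n)
  case (Suc n)
  then show ?case using nu_mult[of x "x ^ n"] by simp
qed simp


text \<open>The union of all discrete geodesics; using the whole interval keeps later notions
  equivariant without choosing geodesics.\<close>

definition I :: "'g \<Rightarrow> 'g \<Rightarrow> 'g set" where
  "I x y = {q. d x q + d q y = d x y}"

lemma I_iff: "q \<in> I x y \<longleftrightarrow> d x q + d q y = d x y"
  by (simp add: I_def)

lemma I_le: "d x q + d q y \<le> d x y \<Longrightarrow> q \<in> I x y"
  using d_tri[of x y q] by (simp add: I_def)

lemma I_ends [simp]: "x \<in> I x y" "y \<in> I x y"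
  by (auto simp: I_def)

lemma I_left: "q \<in> I x y \<Longrightarrow> g * q \<in> I (g * x) (g * y)"
  by (simp add: I_def)

lemma I_left_iff: "g * q \<in> I (g * x) (g * y) \<longleftrightarrow> q \<in> I x y"
  by (simp add: I_def)

lemma I_sym: "I x y = I y x"
  using d_sym by (auto simp: I_def algebra_simps)

lemma I_sub:
  assumes "p \<in> I x y" "q \<in> I x p"
  shows "q \<in> I x y" "p \<in> I q y"
proof -
  show "q \<in> I x y"
    by (rule I_le) (use assms d_tri[of q y p] in \<open>simp add: I_def\<close>)
  show "p \<in> I q y"
    by (rule I_le) (use assms d_tri[of x y q] in \<open>simp add: I_def\<close>)
qed

lemma I_sub2:
  assumes "p \<in> I x y" "q \<in> I p y"
  shows "q \<in> I x y" "p \<in> I x q"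
  using I_sub[of p y x q] assms I_sym by auto

lemma geod_point:
  assumes "0 \<le> t" "t \<le> d x y" "t \<in> \<nat>"
  shows "\<exists>q. q \<in> I x y \<and> d x q = t"
proof -
  obtain m where m: "t = real m" using assms(3) by (auto elim: Nats_cases)
  have "m \<le> \<nu> (inverse x * y)" using assms(2) m by (simp add: d_def)
  from nu_geod[OF this] obtain z where
    z: "\<nu> z = m" "\<nu> (inverse z * (inverse x * y)) = \<nu> (inverse x * y) - m" by blast
  have "d x (x * z) = t" by (simp add: d_right_mult z m)
  moreover have "d (x * z) y = d x y - t"
    using z \<open>m \<le> _\<close> m by (simp add: d_def mgs of_nat_diff)
  ultimately show ?thesis unfolding I_def by (intro exI[of _ "x*z"]) auto
qed

lemma d_Nats [simp]: "d x y \<in> \<nat>"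
  by (simp add: d_def)

lemma geod_path:
  assumes "d x y = real n"
  shows "\<exists>p::nat \<Rightarrow> 'g. p 0 = x \<and> (\<forall>t \<le> n. p t \<in> I x y \<and> d x (p t) = real t) \<and>
     (\<forall>t < n. d (p t) (p (Suc t)) = 1)"
  using assms
proof (induction n arbitrary: x)
  case 0
  show ?case by (intro exI[of _ "\<lambda>_. x"]) auto
next
  case (Suc n)
  obtain q where q: "q \<in> I x y" "d x q = 1"
    using geod_point[of 1 x y] Suc.prems by auto
  then have "d q y = real n" using Suc.prems by (simp add: I_def)
  from Suc.IH[OF this] obtain p where p: "p 0 = q"
    "\<And>t. t \<le> n \<Longrightarrow> p t \<in> I q y \<and> d q (p t) = real t"
    "\<And>t. t < n \<Longrightarrow> d (p t) (p (Suc t)) = 1" by blast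
  define r where "r t = (case t of 0 \<Rightarrow> x | Suc s \<Rightarrow> p s)" for t
  have r: "r t \<in> I x y \<and> d x (r t) = real t" if "t \<le> Suc n" for t
  proof (cases t)
    case (Suc s)
    then have s: "p s \<in> I q y" "d q (p s) = real s" using p(2)[of s] that by auto
    have "p s \<in> I x y" "q \<in> I x (p s)" using I_sub2[OF q(1) s(1)] by auto
    then show ?thesis using s q(2) Suc by (simp add: r_def I_def)
  qed (simp add: r_def)
  have "d (r t) (r (Suc t)) = 1" if "t < Suc n" for t
    using that p(1,3) q(2) by (cases t) (auto simp: r_def)
  then show ?case using r by (intro exI[of _ r]) (auto simp: r_def)
qed

lemma geod_path':
  obtains n p where "d x y = real n" "p 0 = x" "d (p n) y = 0"
    "\<And>t. t \<le> n \<Longrightarrow> p t \<in> I x y \<and> d x (p t) = real t"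
    "\<And>t. t < n \<Longrightarrow> d (p t) (p (Suc t)) = 1"
proof -
  obtain n where n: "d x y = real n" using d_Ints by blast
  obtain p where p: "p 0 = x" "\<forall>t \<le> n. p t \<in> I x y \<and> d x (p t) = real t"
     "\<forall>t < n. d (p t) (p (Suc t)) = 1" using geod_path[OF n] by blast
  have "d x (p n) = real n" "p n \<in> I x y" using p(2) by auto
  then have "d (p n) y = 0" using n unfolding I_iff by linarith
  then show ?thesis using that[of n p] n p by blast
qed

end

locale hyp = gnorm +
  fixes \<delta> :: real
  assumes delta0: "0 \<le> \<delta>"
    and hyp4: "d x z + d y t \<le> d x y + d z t + \<delta> \<or> d x z + d y t \<le> d x t + d y z + \<delta>"
begin

text \<open>The four-point condition compares \<open>p\<close>, on a geodesic up to the defect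
  \<open>r\<close>, with the true geodesic point at nearly the same distance from
  \<open>a\<close>.\<close>

lemma near_I:
  assumes "d a p + d p b \<le> d a b + r" "t \<in> \<nat>" "0 \<le> t" "t \<le> d a b" "\<bar>t - d a p\<bar> \<le> s"
  and "q \<in> I a b" "d a q = t"
  shows "d p q \<le> r + s + \<delta>"
proof -
  have q: "d q b = d a b - t" using assms(6,7) by (simp add: I_def)
  from hyp4[of p q a b] show ?thesis
    using assms q d_sym[of p a] d_sym[of q a] d_tri[of a b p] unfolding abs_le_iff by linarith
qed

end

section \<open>Projection to a quasi-axis\<close>

text \<open>The bound \<open>\<kappa>\<close> on the failure of additivity makes the powers of
  \<open>w\<close> a quasi-geodesic. As it is at most a hundredth of the length of \<open>w\<close>,
  later errors can be rounded to whole multiples of that length.\<close>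

locale axis = hyp +
  fixes w :: "'a" and \<kappa> :: real
  assumes quasi: "real (\<nu> (w ^ m)) + real (\<nu> (w ^ n)) \<le> real (\<nu> (w ^ (m + n))) + \<kappa>"
    and delta_kappa: "\<delta> \<le> \<kappa>"
    and kappa_w: "100 * \<kappa> \<le> real (\<nu> w)"
    and nu_w: "0 < \<nu> w"
begin

section \<open>Displacements of the powers of \<open>w\<close>\<close>

definition A :: "int \<Rightarrow> real" where "A i = real (\<nu> (zpow w i))"

abbreviation W :: "int \<Rightarrow> 'a" where "W i \<equiv> zpow w i"

definition a :: real where "a = real (\<nu> w)"

lemma a1: "1 \<le> a" and kappa_a: "100 * \<kappa> \<le> a" and kappa0: "0 \<le> \<kappa>" and delta_a: "100 * \<delta> \<le> a"
  using nu_w kappa_w delta_kappa delta0 by (auto simp: a_def)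

lemma A_0 [simp]: "A 0 = 0"
  by (simp add: A_def)

lemma A_1 [simp]: "A 1 = a"
  by (simp add: A_def a_def)

lemma A_nonneg [simp]: "0 \<le> A i"
  by (simp add: A_def)

lemma A_minus [simp]: "A (- i) = A i"
  by (simp add: A_def zpow_minus)

lemma A_abs [simp]: "A \<bar>i\<bar> = A i"
  by (simp add: abs_if)

lemma A_commute: "A (i - j) = A (j - i)"
  by (metis A_minus minus_diff_eq)

lemma inv_W_mult: "inverse (W i) * W j = W (j - i)"
  by (metis zpow_add zpow_minus uminus_add_conv_diff)

lemma d_W [simp]: "d (W i) (W j) = A (j - i)"
  by (simp add: d_def A_def inv_W_mult)

lemma A_tri: "A (i + j) \<le> A i + A j"
  unfolding A_def zpow_add using nu_mult by (metis of_nat_add of_nat_le_iff)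

lemma A_super: "0 \<le> i \<Longrightarrow> 0 \<le> j \<Longrightarrow> A i + A j \<le> A (i + j) + \<kappa>"
  using quasi[of "nat i" "nat j"] by (simp add: A_def zpow_def nat_add_distrib)

lemma A_upper: "A i \<le> real_of_int \<bar>i\<bar> * a"
proof -
  have "A (int n) \<le> real n * a" for n
  proof (induction n)
    case (Suc n)
    then show ?case using A_tri[of "int n" 1] by (simp add: algebra_simps)
  qed simp
  from this[of "nat \<bar>i\<bar>"] show ?thesis by simp
qed

lemma A_lower: "real_of_int \<bar>i\<bar> * (99 / 100 * a) \<le> A i"
proof -
  have "real n * (99 / 100 * a) \<le> A (int n)" for n
  proof (induction n)
    case (Suc n)
    then show ?case using A_super[of "int n" 1] kappa_a by (simp add: algebra_simps)
  qed simp
  from this[of "nat \<bar>i\<bar>"] show ?thesis by simp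
qed

lemma A_ge: assumes "c \<le> \<bar>i\<bar>" shows "real_of_int c * 99 * a \<le> 100 * A i"
proof -
  have "real_of_int c * (99 / 100 * a) \<le> real_of_int \<bar>i\<bar> * (99 / 100 * a)"
    by (rule mult_right_mono) (use assms a1 in \<open>simp_all del: of_int_abs\<close>)
  then show ?thesis using A_lower[of i] by simp
qed

text \<open>Turns lengths back into exponents; the integer versions below carry 99 and 100 because
  of the factor 99/100 in \<open>A_lower\<close>.\<close>

lemma A_index: assumes "A i \<le> c * a" shows "99 * real_of_int \<bar>i\<bar> \<le> 100 * c"
proof -
  have "a * (real_of_int \<bar>i\<bar> * 99) \<le> a * (c * 100)"
    using A_lower[of i] assms by (simp add: algebra_simps)
  then have "real_of_int \<bar>i\<bar> * 99 \<le> c * 100"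
    using a1 by (subst (asm) mult_le_cancel_left_pos) auto
  then show ?thesis by simp
qed

lemma A_indexi: assumes "A i \<le> real_of_int c * a" shows "99 * \<bar>i\<bar> \<le> 100 * c"
proof -
  have "real_of_int (99 * \<bar>i\<bar>) \<le> real_of_int (100 * c)"
    using A_index[OF assms] by simp
  then show ?thesis by (simp only: of_int_le_iff)
qed

lemma A_diff: assumes "\<bar>j\<bar> \<le> \<bar>i\<bar>" shows "A (\<bar>i\<bar> - \<bar>j\<bar>) \<le> A i - A j + \<kappa>"
  using A_super[of "\<bar>j\<bar>" "\<bar>i\<bar> - \<bar>j\<bar>"] assms by simp

lemma A_compare: assumes "A i \<le> A j + c * a" "0 \<le> c"
  shows "99 * real_of_int \<bar>i\<bar> \<le> 99 * real_of_int \<bar>j\<bar> + 100 * c + 1"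
proof (cases "\<bar>j\<bar> \<le> \<bar>i\<bar>")
  case True
  have "A (\<bar>i\<bar> - \<bar>j\<bar>) \<le> (c + 1/100) * a"
    using A_diff[OF True] assms kappa_a by (simp add: algebra_simps)
  from A_index[OF this] True show ?thesis by (simp add: algebra_simps)
next
  case False
  then have "real_of_int \<bar>i\<bar> \<le> real_of_int \<bar>j\<bar>" by linarith
  then show ?thesis using assms by linarith
qed

lemma A_comparei: assumes "A i \<le> A j + real_of_int c * a" "0 \<le> c"
  shows "99 * \<bar>i\<bar> \<le> 99 * \<bar>j\<bar> + 100 * c + 1"
proof -
  have "real_of_int (99 * \<bar>i\<bar>) \<le> real_of_int (99 * \<bar>j\<bar> + 100 * c + 1)"
    using A_compare[OF assms(1)] assms(2) by simp
  then show ?thesis by (simp only: of_int_le_iff)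
qed

text \<open>\<open>A i\<close> is the displacement of the \<open>i\<close>-th power; \<open>b x\<close> below is the exponent of a power nearest
  to \<open>x\<close>, made canonical (hence equivariant) by taking the least one.\<close>

definition argmin :: "'a \<Rightarrow> int set" where
  "argmin x = {i. \<forall>j. d x (W i) \<le> d x (W j)}"

lemma argmin_finite: "finite (argmin x)"
proof -
  have "i \<in> {- \<lceil>2 * d x 1 * 2\<rceil>..\<lceil>2 * d x 1 * 2\<rceil>}" if "i \<in> argmin x" for i
  proof -
    have "d x (W i) \<le> d x 1" using that by (auto simp: argmin_def) (metis zpow_0)
    then have "A i \<le> 2 * d x 1" using d_tri[of 1 "W i" x] d_sym[of 1 x] d_W[of 0 i] by simp
    then have "real_of_int \<bar>i\<bar> * (99 / 100) \<le> 2 * d x 1"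
      using A_lower[of i] a1 mult_left_mono[of 1 a "real_of_int \<bar>i\<bar> * (99/100)"]
      by (simp add: algebra_simps)
    then have "real_of_int \<bar>i\<bar> \<le> 2 * d x 1 * 2" by (simp add: field_simps)
    then show ?thesis by (simp add: abs_le_iff le_ceiling_iff) linarith
  qed
  then show ?thesis by (meson finite_atLeastAtMost_int rev_finite_subset subsetI)
qed

lemma argmin_nonempty: "argmin x \<noteq> {}"
proof -
  obtain i where "\<forall>j. \<nu> (inverse x * W i) \<le> \<nu> (inverse x * W j)"
    using ex_has_least_nat[of "\<lambda>_. True" 0 "\<lambda>i. \<nu> (inverse x * W i)"] by auto
  then show ?thesis by (auto simp: argmin_def d_def)
qed

definition b :: "'a \<Rightarrow> int" where "b x = Min (argmin x)"

lemma b_min: "d x (W (b x)) \<le> d x (W j)"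
proof -
  have "b x \<in> argmin x" unfolding b_def by (rule Min_in[OF argmin_finite argmin_nonempty])
  then show ?thesis by (simp add: argmin_def)
qed

lemma b_shift: "b (W i * x) = b x + i"
proof -
  have *: "d (W i * x) (W j) = d x (W (j - i))" for j
    by (simp add: d_mult_left(1) inv_W_mult)
  have "argmin (W i * x) = (\<lambda>j. j + i) ` argmin x"
  proof (rule Set.set_eqI)
    fix j
    have "j \<in> argmin (W i * x) \<longleftrightarrow> (\<forall>l. d x (W (j - i)) \<le> d x (W (l - i)))"
      by (simp add: argmin_def *)
    also have "\<dots> \<longleftrightarrow> (\<forall>l. d x (W (j - i)) \<le> d x (W l))"
      by (metis add_diff_cancel)
    also have "\<dots> \<longleftrightarrow> j - i \<in> argmin x" by (simp add: argmin_def)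
    also have "\<dots> \<longleftrightarrow> j \<in> (\<lambda>j. j + i) ` argmin x"
      by (auto intro: image_eqI[of _ _ "j - i"])
    finally show "j \<in> argmin (W i * x) \<longleftrightarrow> j \<in> (\<lambda>j. j + i) ` argmin x" .
  qed
  then show ?thesis
    using mono_Min_commute[of "\<lambda>j. j + i" "argmin x"] argmin_finite argmin_nonempty
    by (simp add: b_def mono_def)
qed

lemma b_cong: "d x y = 0 \<Longrightarrow> b x = b y"
proof -
  assume "d x y = 0"
  then have "d x z = d y z" for z by (rule d_eq0_cong)
  then show ?thesis by (simp add: b_def argmin_def)
qed

definition D :: "'a \<Rightarrow> real" where "D x = d x (W (b x))"

lemma D_nonneg [simp]: "0 \<le> D x"
  by (simp add: D_def)

lemma D_le: "D x \<le> d x (W j)"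
  by (simp add: D_def b_min)

text \<open>A step from the nearest power \<open>W (b x)\<close> towards \<open>W j\<close> does not
  come closer to \<open>x\<close>. This excludes one alternative of the four-point condition; the
  other says that the route to \<open>W j\<close> via \<open>W (b x)\<close> is almost
  shortest.\<close>

lemma proj_lower: "D x + A (j - b x) \<le> d x (W j) + 2 * a"
proof -
  have gen: "D x + A (j - b x) \<le> d x (W j) + 2 * a" if e: "e = 1 \<or> e = -1" "j = b x + e * n" "1 \<le> n" for e n
  proof -
    have An: "A (e * n) = A n" "A (e * (n - 1)) = A (n - 1)" "A e = a"
      using e A_commute[of 1 n] by auto
    have eq: "j - b x = e * n" "j - (b x + e) = e * (n - 1)" using e by (auto simp: algebra_simps)
    have "A n \<ge> A (n - 1) + a - \<kappa>" using A_super[of "n - 1" 1] e by simp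
    then show ?thesis
      using hyp4[of x "W (b x + e)" "W (b x)" "W j"] D_le[of x "b x + e"] a1 kappa_a delta_kappa
        delta_a An eq
      by (auto simp: D_def[symmetric] algebra_simps A_commute[of "b x" j] A_commute[of "b x + e" j])
  qed
  consider "j = b x" | "j > b x" | "j < b x" by linarith
  then show ?thesis
  proof cases
    case 1
    then show ?thesis using a1 by (simp add: D_def)
  next
    case 2
    then show ?thesis using gen[of 1 "j - b x"] by simp
  next
    case 3
    then show ?thesis using gen[of "-1" "b x - j"] by simp
  qed
qed

text \<open>The alternative of the four-point condition that ignores the axis would give
  \<open>2 * A (b x - b y) \<le> 4 * a + \<delta>\<close>, which fails as soon as the exponents
  differ by three.\<close>

lemma proj_proj_lower:
  assumes "3 \<le> \<bar>b x - b y\<bar>"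
  shows "D x + A (b x - b y) + D y \<le> d x y + 5 * a"
proof -
  have "A (b x - b y) \<ge> 297/100 * a" using A_ge[of 3 "b x - b y"] assms by simp
  then show ?thesis
    using hyp4[of x "W (b y)" "W (b x)" y] proj_lower[of x "b y"] proj_lower[of y "b x"] delta_a a1
      A_commute[of "b x" "b y"] d_sym[of "W (b y)" y] d_sym[of "W (b x)" y]
    by (auto simp: D_def)
qed

lemma d_upper: "d x y \<le> D x + A (b x - b y) + D y"
  using d_tri[of x y "W (b x)"] d_tri[of "W (b x)" y "W (b y)"] d_sym[of y "W (b y)"] A_commute[of "b x" "b y"]
  by (simp add: D_def)

lemma A_b_le: "A (b x - b y) \<le> d x y + 5 * a"
proof (cases "3 \<le> \<bar>b x - b y\<bar>")
  case True
  from proj_proj_lower[OF this] show ?thesis using D_nonneg[of x] D_nonneg[of y] by linarith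
next
  case False
  then have "real_of_int \<bar>b x - b y\<bar> * a \<le> 5 * a" using a1 by (intro mult_right_mono) auto
  then show ?thesis using A_upper[of "b x - b y"] d_nonneg[of x y] by linarith
qed

lemma b_Lipi: assumes "d x y \<le> real_of_int c * a" shows "99 * \<bar>b x - b y\<bar> \<le> 100 * (c + 5)"
  using A_b_le[of x y] assms by (intro A_indexi) (simp add: algebra_simps)

lemma b_Lip1: assumes "d x y \<le> 1" shows "\<bar>b x - b y\<bar> \<le> 6"
  using b_Lipi[of x y 1] assms a1 by simp

text \<open>A geodesic whose point \<open>q\<close> projects beyond both ends would run along the
  axis and back, at twice the cost of the overshoot; the errors absorb an overshoot of at most
  six.\<close>

lemma b_mono_aux:
  assumes q: "q \<in> I x y" and far: "7 \<le> \<bar>b q - b y\<bar>" "\<bar>b q - b y\<bar> \<le> \<bar>b q - b x\<bar>"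
    and same: "b q < b x \<longleftrightarrow> b q < b y"
  shows False
proof -
  have 1: "D x + A (b x - b q) + D q \<le> d x q + 5 * a" by (rule proj_proj_lower) (use far in linarith)
  have 2: "D q + A (b q - b y) + D y \<le> d q y + 5 * a" by (rule proj_proj_lower) (use far in linarith)
  have 3: "d x y \<le> D x + A (b x - b y) + D y" by (rule d_upper)
  have abs: "\<bar>b q - b x\<bar> - \<bar>b q - b y\<bar> = \<bar>b x - b y\<bar>" using far same by linarith
  have "A (\<bar>b x - b y\<bar>) \<le> A (b q - b x) - A (b q - b y) + \<kappa>"
    using A_diff[of "b q - b y" "b q - b x"] far unfolding abs by simp
  then have "2 * A (b q - b y) \<le> 10 * a + \<kappa>"
    using 1 2 3 q D_nonneg[of q] A_commute[of "b x" "b q"] unfolding I_iff A_abs by linarith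
  then have "A (b q - b y) \<le> real_of_int 6 * a" using kappa_a a1 by simp
  then have "99 * \<bar>b q - b y\<bar> \<le> 600" using A_indexi[of "b q - b y" 6] by simp
  then show False using far(1) by simp
qed

lemma b_mono:
  assumes q: "q \<in> I x y"
  shows "min (b x) (b y) - 6 \<le> b q" "b q \<le> max (b x) (b y) + 6"
proof -
  have q': "q \<in> I y x" using q I_sym by blast
  have "(7 \<le> \<bar>b q - b y\<bar> \<and> \<bar>b q - b y\<bar> \<le> \<bar>b q - b x\<bar> \<and> (b q < b x \<longleftrightarrow> b q < b y))
     \<or> (7 \<le> \<bar>b q - b x\<bar> \<and> \<bar>b q - b x\<bar> \<le> \<bar>b q - b y\<bar> \<and> (b q < b y \<longleftrightarrow> b q < b x))"
    if "\<not> (min (b x) (b y) - 6 \<le> b q \<and> b q \<le> max (b x) (b y) + 6)"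
    using that by linarith
  then show "min (b x) (b y) - 6 \<le> b q" "b q \<le> max (b x) (b y) + 6"
    using b_mono_aux[OF q] b_mono_aux[OF q'] by blast+
qed

text \<open>The foot \<open>W (b x)\<close> lies on a geodesic up to \<open>5 * a\<close>, so
  \<open>near_I\<close> applies with \<open>s = 0\<close>.\<close>

lemma near_W:
  assumes far: "3 \<le> \<bar>b x - b y\<bar>" and z: "z \<in> I x y" "d x z = D x"
  shows "d z (W (b x)) \<le> 6 * a"
proof -
  have "d (W (b x)) y \<le> A (b x - b y) + D y"
    using d_tri[of "W (b x)" y "W (b y)"] d_sym[of y "W (b y)"] A_commute[of "b x" "b y"]
    by (simp add: D_def)
  then have 1: "d x (W (b x)) + d (W (b x)) y \<le> d x y + 5 * a"
    using proj_proj_lower[OF far] by (simp add: D_def)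
  have le: "D x \<le> d x y" using z unfolding I_iff using d_nonneg[of z y] by linarith
  have "d (W (b x)) z \<le> 5 * a + 0 + \<delta>"
    using 1 le z by (intro near_I[of x _ y _ "D x"]) (auto simp: D_def)
  then show ?thesis using d_sym[of z "W (b x)"] delta_a a1 by linarith
qed

lemma D_le_d: assumes far: "6 \<le> \<bar>b x - b y\<bar>" shows "D x \<le> d x y"
proof -
  have "A (b x - b y) \<ge> 5 * a" using A_ge[of 6 "b x - b y"] assms a1 by simp
  then show ?thesis using proj_proj_lower[of x y] far D_nonneg[of y] by linarith
qed

end

section \<open>Translates of the axis\<close>

context gnorm
begin

section \<open>Calculus modulo the kernel; torsion, loxodromic and WPD elements\<close>

definition eqK :: "'g \<Rightarrow> 'g \<Rightarrow> bool" where "eqK x y \<longleftrightarrow> inverse x * y \<in> K"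

lemma eqK_d: "eqK x y \<longleftrightarrow> d x y = 0"
  by (simp add: eqK_def)

lemma eqK_refl [simp]: "eqK x x"
  by (simp add: eqK_d)

lemma eqK_sym: "eqK x y \<Longrightarrow> eqK y x"
  using d_sym[of x y] unfolding eqK_d by linarith

lemma eqK_trans: "eqK x y \<Longrightarrow> eqK y z \<Longrightarrow> eqK x z"
  unfolding eqK_d using d_tri[of x z y] d_nonneg[of x z] by linarith

lemma eqK_left: "eqK x y \<Longrightarrow> eqK (g * x) (g * y)"
  unfolding eqK_d by simp

lemma eqK_right: "eqK x y \<Longrightarrow> eqK (x * g) (y * g)"
  unfolding eqK_def using K_conj'[of "inverse x * y" g] by (simp add: mgs)

lemma eqK_mult: "eqK x y \<Longrightarrow> eqK u v \<Longrightarrow> eqK (x * u) (y * v)"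
  by (meson eqK_left eqK_right eqK_trans)

lemma eqK_inv: assumes "eqK x y" shows "eqK (inverse x) (inverse y)"
  using eqK_sym[OF eqK_right[OF eqK_left[OF assms, of "inverse x"], of "inverse y"]] by (simp add: mgs)

lemma eqK_power: "eqK x y \<Longrightarrow> eqK (x ^ n) (y ^ n)"
  by (induction n) (auto intro: eqK_mult)

lemma eqK_zpow: "eqK x y \<Longrightarrow> eqK (zpow x i) (zpow y i)"
  by (simp add: zpow_def eqK_power eqK_inv)

lemma eqK_one: "eqK 1 x \<longleftrightarrow> x \<in> K"
  by (simp add: eqK_def)

lemma eqK_nu: "eqK x y \<Longrightarrow> \<nu> x = \<nu> y"
  unfolding eqK_d using d_eq0_cong[of x y 1] by (simp add: d_one)

lemma eqK_cancel_left: "eqK (g * x) (g * y) \<longleftrightarrow> eqK x y"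
  unfolding eqK_d by simp

lemma eqK_cancel_right: "eqK (x * g) (y * g) \<longleftrightarrow> eqK x y"
  using eqK_right[of "x * g" "y * g" "inverse g"] eqK_right[of x y g] by (auto simp: mgs)

definition finK :: "'g set \<Rightarrow> bool" where
  "finK S \<longleftrightarrow> (\<exists>F. finite F \<and> (\<forall>f\<in>S. \<exists>e\<in>F. eqK e f))"

lemma finK_subset: "finK S \<Longrightarrow> T \<subseteq> S \<Longrightarrow> finK T"
  unfolding finK_def by (meson subsetD)

definition lox :: "'g \<Rightarrow> bool" where
  "lox h \<longleftrightarrow> (\<exists>c>0. \<forall>n. c * real n \<le> real (\<nu> (h ^ n)))"

text \<open>The condition on \<open>f\<close> says that it moves both \<open>1\<close> and
  \<open>h ^ M\<close> by at most \<open>R\<close>. Finiteness is modulo \<open>K\<close>, and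
  \<open>M\<close> can be taken arbitrarily large.\<close>

definition wpd :: "'g \<Rightarrow> bool" where
  "wpd h \<longleftrightarrow> (\<forall>R M0. \<exists>M\<ge>M0. finK {f. \<nu> f \<le> R \<and> \<nu> (inverse (h ^ M) * f * h ^ M) \<le> R})"

definition torsion :: "'g \<Rightarrow> bool" where
  "torsion h \<longleftrightarrow> (\<exists>n>0. h ^ n \<in> K)"

end

locale waxis = axis +
  assumes wpd_w: "wpd w"
begin

text \<open>The power \<open>W m\<close> lies almost on a shortest path between two points of the
  line \<open>g\<close>; comparing that path with the detour through the foot of \<open>W m\<close>
  on the line leaves a distance of at most \<open>5 * a\<close>.\<close>

lemma overlap_near:
  assumes far: "3 \<le> \<bar>b (g * W i) - b (g * W j)\<bar>"
    and m: "min (b (g * W i)) (b (g * W j)) \<le> m" "m \<le> max (b (g * W i)) (b (g * W j))"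
  shows "D (inverse g * W m) \<le> 5 * a"
proof -
  define P where "P = b (g * W i)"
  define Q where "Q = b (g * W j)"
  define \<beta> where "\<beta> = b (inverse g * W m)"
  have mm: "A (m - P) + A (Q - m) \<le> A (P - Q) + \<kappa>"
  proof (cases "P \<le> Q")
    case True
    then show ?thesis using m A_super[of "m - P" "Q - m"] A_commute[of P Q] unfolding P_def Q_def by simp
  next
    case False
    then show ?thesis using m A_super[of "m - Q" "P - m"] A_commute[of m P] A_commute[of m Q] A_commute[of P Q]
      unfolding P_def Q_def by (simp add: add.commute)
  qed
  have 1: "D (g * W i) + A (P - Q) + D (g * W j) \<le> A (j - i) + 5 * a"
    using proj_proj_lower[of "g * W i" "g * W j"] far unfolding P_def Q_def by simp
  have 2: "d (g * W i) (W m) \<le> D (g * W i) + A (m - P)"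
    using d_tri[of "g * W i" "W m" "W P"] by (simp add: D_def P_def)
  have 3: "d (W m) (g * W j) \<le> D (g * W j) + A (Q - m)"
    using d_tri[of "W m" "g * W j" "W Q"] d_sym[of "W Q" "g * W j"] by (simp add: D_def Q_def)
  have 4: "D (inverse g * W m) + A (i - \<beta>) \<le> d (g * W i) (W m) + 2 * a"
    using proj_lower[of "inverse g * W m" i] d_sym[of "inverse g * W m" "W i"]
    unfolding \<beta>_def d_mult_left(1) by linarith
  have 5: "D (inverse g * W m) + A (j - \<beta>) \<le> d (W m) (g * W j) + 2 * a"
    using proj_lower[of "inverse g * W m" j] unfolding \<beta>_def d_mult_left(2) by linarith
  have 6: "A (j - i) \<le> A (i - \<beta>) + A (j - \<beta>)"
    using A_tri[of "\<beta> - i" "j - \<beta>"] A_commute[of i \<beta>] by simp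
  show ?thesis using 1 2 3 4 5 6 mm kappa_a a1 by linarith
qed

text \<open>For suitable \<open>n\<close> this is the stabiliser of the endpoints of the axis (the elementary closure
  of \<open>w\<close>).\<close>

definition ES :: "int \<Rightarrow> 'a set" where
  "ES n = {g. \<exists>e. (e = 1 \<or> e = -1) \<and> eqK (W n) (g * W (e * n) * inverse g)}"

lemma abs_aux:
  fixes x y p q :: int
  assumes "\<bar>\<bar>x\<bar> - p\<bar> \<le> 10" "\<bar>\<bar>y\<bar> - q\<bar> \<le> 10" "\<bar>\<bar>x + y\<bar> - (p + q)\<bar> \<le> 10" "0 \<le> p" "0 \<le> q"
  shows "0 \<le> x + y \<Longrightarrow> \<bar>x - p\<bar> \<le> 50" "x + y \<le> 0 \<Longrightarrow> \<bar>x + p\<bar> \<le> 50"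
  using assms by linarith+

text \<open>If a translate of the axis stays near the axis for long, then many conjugates of powers of
  \<open>w\<close> have short translation at two far points; two of them agree by weak proper
  discontinuity, and the exponent is made uniform with a factorial.\<close>

lemma overlap:
  "\<exists>n>0. \<exists>\<theta>\<ge>0. \<forall>g i j. \<theta> < \<bar>b (g * W i) - b (g * W j)\<bar> \<longrightarrow> g \<in> ES n"
proof -
  \<comment> \<open>Twice the distance 55 in \<open>near'\<close> between a power and its affine
    approximation on the line \<open>g\<close>.\<close>
  define R where "R = nat \<lceil>110 * a\<rceil>"
  have R: "x \<le> 110 * a \<Longrightarrow> x \<le> real R" for x unfolding R_def using a1 by linarith
  obtain M F where F: "finite F" and
    MF: "\<And>f. \<nu> f \<le> R \<Longrightarrow> \<nu> (inverse (w ^ M) * f * w ^ M) \<le> R \<Longrightarrow> \<exists>e\<in>F. eqK e f"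
  proof -
    obtain M where "finK {f. \<nu> f \<le> R \<and> \<nu> (inverse (w ^ M) * f * w ^ M) \<le> R}"
      using wpd_w unfolding wpd_def by metis
    then show ?thesis using that unfolding finK_def by fast
  qed
  define c where "c = card F"
  \<comment> \<open>The threshold leaves room for the two test points \<open>lo\<close> and
    \<open>lo + M\<close> and for a further shift by any \<open>n \<le> c\<close>.\<close>
  have main: "g \<in> ES (fact c)" if far: "int M + int c + 3 < \<bar>b (g * W i) - b (g * W j)\<bar>" for g i j
  proof -
    define lo where "lo = min (b (g * W i)) (b (g * W j))"
    define hi where "hi = max (b (g * W i)) (b (g * W j))"
    have lohi: "lo + int M + int c + 3 < hi" using far unfolding lo_def hi_def by linarith
    define \<beta> where "\<beta> m = b (inverse g * W m)" for m
    have near: "d (inverse g * W m) (W (\<beta> m)) \<le> 5 * a" if "lo \<le> m" "m \<le> hi" for m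
      using overlap_near[of g i j m] that far unfolding lo_def hi_def \<beta>_def by (simp add: D_def)
    have cmp: "\<bar>\<bar>\<beta> m - \<beta> m'\<bar> - \<bar>m - m'\<bar>\<bar> \<le> 10" if "lo \<le> m" "m \<le> hi" "lo \<le> m'" "m' \<le> hi" for m m'
    proof -
      have e: "d (inverse g * W m) (inverse g * W m') = A (m - m')" by (simp add: A_commute)
      have n1: "d (W (\<beta> m)) (inverse g * W m) \<le> 5 * a" and n2: "d (inverse g * W m') (W (\<beta> m')) \<le> 5 * a"
        using near[of m] near[of m'] that d_sym by auto
      have "A (\<beta> m - \<beta> m') \<le> A (m - m') + 10 * a"
        using d_tri[of "W (\<beta> m)" "W (\<beta> m')" "inverse g * W m"]
         d_tri[of "inverse g * W m" "W (\<beta> m')" "inverse g * W m'"] n1 n2 e A_commute[of "\<beta> m" "\<beta> m'"]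
        by simp
      moreover have "A (m - m') \<le> A (\<beta> m - \<beta> m') + 10 * a"
        using d_tri[of "inverse g * W m" "inverse g * W m'" "W (\<beta> m)"]
         d_tri[of "W (\<beta> m)" "inverse g * W m'" "W (\<beta> m')"] n1 n2 e A_commute[of "\<beta> m" "\<beta> m'"]
          d_sym[of "W (\<beta> m)" "inverse g * W m"] d_sym[of "W (\<beta> m')" "inverse g * W m'"]
        by simp
      ultimately have "99 * \<bar>\<beta> m - \<beta> m'\<bar> \<le> 1001 + 99 * \<bar>m - m'\<bar>" "99 * \<bar>m - m'\<bar> \<le> 1001 + 99 * \<bar>\<beta> m - \<beta> m'\<bar>"
        using A_comparei[of "\<beta> m - \<beta> m'" "m - m'" 10] A_comparei[of "m - m'" "\<beta> m - \<beta> m'" 10] by simp_all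
      moreover have "99 * u \<le> 1001 + 99 * v \<Longrightarrow> 99 * v \<le> 1001 + 99 * u \<Longrightarrow> \<bar>u - v\<bar> \<le> 10" for u v :: int
        by linarith
      ultimately show ?thesis by blast
    qed
    \<comment> \<open>By \<open>cmp\<close> the map \<open>\<beta>\<close> preserves distances of
      exponents up to 10, hence it is affine with slope \<open>e\<close> up to 50.\<close>
    define e :: int where "e = (if \<beta> lo \<le> \<beta> hi then 1 else -1)"
    have lin: "\<bar>\<beta> m - (\<beta> lo + e * (m - lo))\<bar> \<le> 50" if "lo \<le> m" "m \<le> hi" for m
    proof -
      have e: "\<bar>m - lo\<bar> = m - lo" "\<bar>hi - m\<bar> = hi - m" "\<bar>hi - lo\<bar> = (m - lo) + (hi - m)"
        "\<beta> hi - \<beta> lo = (\<beta> m - \<beta> lo) + (\<beta> hi - \<beta> m)"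
        using that lohi by simp_all
      have r: "lo \<le> lo" "lo \<le> hi" "hi \<le> hi" using lohi by simp_all
      have "\<bar>\<bar>\<beta> m - \<beta> lo\<bar> - (m - lo)\<bar> \<le> 10" "\<bar>\<bar>\<beta> hi - \<beta> m\<bar> - (hi - m)\<bar> \<le> 10"
        "\<bar>\<bar>(\<beta> m - \<beta> lo) + (\<beta> hi - \<beta> m)\<bar> - ((m - lo) + (hi - m))\<bar> \<le> 10"
        using cmp[of m lo] cmp[of hi m] cmp[of hi lo] that r unfolding e by blast+
      note ax = abs_aux[OF this]
      show ?thesis
      proof (cases "\<beta> lo \<le> \<beta> hi")
        case True
        then have "\<bar>\<beta> m - \<beta> lo - (m - lo)\<bar> \<le> 50" by (intro ax(1)) (use that in linarith)+
        moreover have "e * (m - lo) = m - lo" using True by (simp add: e_def)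
        ultimately show ?thesis by linarith
      next
        case False
        then have "\<bar>\<beta> m - \<beta> lo + (m - lo)\<bar> \<le> 50" by (intro ax(2)) (use that in linarith)+
        moreover have "e * (m - lo) = - (m - lo)" using False by (simp add: e_def)
        ultimately show ?thesis by linarith
      qed
    qed
    have near': "d (inverse g * W m) (W (\<beta> lo + e * (m - lo))) \<le> 55 * a" if "lo \<le> m" "m \<le> hi" for m
    proof -
      have A50: "A p \<le> 50 * a" if "\<bar>p\<bar> \<le> 50" for p
      proof -
        have "real_of_int \<bar>p\<bar> \<le> real_of_int 50" using that by (simp only: of_int_le_iff)
        then show ?thesis using A_upper[of p] mult_right_mono[of "real_of_int \<bar>p\<bar>" 50 a] a1 by linarith
      qed
      have "A (\<beta> lo + e * (m - lo) - \<beta> m) \<le> 50 * a"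
        by (rule A50) (use lin[OF that] in linarith)
      then show ?thesis using near[OF that] d_tri[of "inverse g * W m" "W (\<beta> lo + e * (m - lo))" "W (\<beta> m)"]
        by simp
    qed
    \<comment> \<open>Translation by \<open>n\<close> along the axis and by \<open>e * n\<close>
      along the line \<open>g\<close> almost agree on the window, so \<open>h n\<close> moves the
      powers there little.\<close>
    define h where "h n = W (- int n) * (g * W (e * int n) * inverse g)" for n
    have hd: "d (W m) (h n * W m) \<le> 110 * a" if "lo \<le> m" "m + int n \<le> hi" for n m
    proof -
      have "d (h n * W m) (W m) = d (g * W (e * int n) * (inverse g * W m)) (W (m + int n))"
      proof -
        have "h n * W m = W (- int n) * (g * W (e * int n) * (inverse g * W m))" by (simp add: h_def mgs)
        moreover have "W (- int n) * W (m + int n) = W m" by (metis zpow_add add.commute add_diff_cancel_right' uminus_add_conv_diff)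
        ultimately show ?thesis by (metis d_left)
      qed
      also have "\<dots> \<le> d (g * W (e * int n) * (inverse g * W m)) (g * W (e * int n) * W (\<beta> lo + e * (m - lo)))
         + d (g * W (e * int n) * W (\<beta> lo + e * (m - lo))) (W (m + int n))"
        by (rule d_tri)
      also have "g * W (e * int n) * W (\<beta> lo + e * (m - lo)) = g * W (\<beta> lo + e * (m + int n - lo))"
        by (simp add: mult.assoc algebra_simps flip: zpow_add)
      also have "d (g * W (\<beta> lo + e * (m + int n - lo))) (W (m + int n)) =
        d (inverse g * W (m + int n)) (W (\<beta> lo + e * (m + int n - lo)))"
        by (simp add: d_mult_left(1) d_sym)
      also have "\<dots> \<le> 55 * a" using near'[of "m + int n"] that by simp
      also have "d (g * W (e * int n) * (inverse g * W m)) (g * W (\<beta> lo + e * (m + int n - lo))) =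
         d (inverse g * W m) (W (\<beta> lo + e * (m - lo)))"
      proof -
        have "g * W (\<beta> lo + e * (m + int n - lo)) = g * W (e * int n) * W (\<beta> lo + e * (m - lo))"
          by (simp add: mult.assoc algebra_simps flip: zpow_add)
        then show ?thesis by (simp only: d_left)
      qed
      also have "\<dots> \<le> 55 * a" using near'[of m] that by simp
      finally show ?thesis using d_sym[of "W m" "h n * W m"] by linarith
    qed
    define f where "f n = inverse (W lo) * h n * W lo" for n
    have "\<exists>q\<in>F. eqK q (f n)" if "n \<le> c" for n
    proof (rule MF)
      have "real (\<nu> (f n)) = d (W lo) (h n * W lo)" by (simp add: d_def f_def mgs)
      then show "\<nu> (f n) \<le> R" using hd[of lo n] lohi that R by fastforce
      have "inverse (w ^ M) * f n * w ^ M = inverse (W (lo + int M)) * (h n * W (lo + int M))"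
        by (simp add: f_def zpow_add zpow_of_nat mgs)
      then have "real (\<nu> (inverse (w ^ M) * f n * w ^ M)) = d (W (lo + int M)) (h n * W (lo + int M))"
        by (simp add: d_def)
      then show "\<nu> (inverse (w ^ M) * f n * w ^ M) \<le> R" using hd[of "lo + int M" n] lohi that R by fastforce
    qed
    then obtain q where q: "\<And>n. n \<le> c \<Longrightarrow> q n \<in> F \<and> eqK (q n) (f n)" by metis
    \<comment> \<open>There are \<open>c + 1\<close> exponents but only \<open>c\<close>
      classes.\<close>
    have "\<not> inj_on q {..c}"
    proof
      assume "inj_on q {..c}"
      then have "card {..c} \<le> card F" using q F by (intro card_inj_on_le[of q]) auto
      then show False by (simp add: c_def)
    qed
    then obtain n1 n2 where n: "n1 < n2" "n2 \<le> c" "q n1 = q n2"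
      unfolding inj_on_def by (metis atMost_iff linorder_neq_iff)
    then have "eqK (f n1) (f n2)" using q[of n1] q[of n2] eqK_sym eqK_trans by (metis less_imp_le_nat less_le_trans)
    then have "eqK (h n1) (h n2)"
      by (simp add: f_def eqK_cancel_left eqK_cancel_right)
    then have "eqK (W (int n2) * h n1 * inverse (g * W (e * int n1) * inverse g)) (W (int n2) * h n2 * inverse (g * W (e * int n1) * inverse g))"
      by (simp add: eqK_cancel_left eqK_cancel_right)
    moreover have "W (int n2) * h n1 * inverse (g * W (e * int n1) * inverse g) = W (int n2 - int n1)"
      by (simp add: h_def mgs zpow_minus zpow_diff)
    moreover have "W (int n2) * h n2 * inverse (g * W (e * int n1) * inverse g) = g * W (e * (int n2 - int n1)) * inverse g"
      by (simp add: h_def mgs zpow_minus zpow_diff right_diff_distrib)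
    ultimately have *: "eqK (W (int n2 - int n1)) (g * W (e * (int n2 - int n1)) * inverse g)" by simp
    define r where "r = n2 - n1"
    \<comment> \<open>The exponent \<open>r\<close> depends on \<open>g\<close>; being at most
      \<open>c\<close>, it divides \<open>fact c\<close>, which does not.\<close>
    have "r dvd fact c" using n by (intro dvd_fact) (auto simp: r_def)
    then obtain s where s: "fact c = r * s" by (elim dvdE)
    then have s': "(fact c :: int) = int r * int s" by (metis of_nat_fact of_nat_mult)
    have "eqK (zpow (W (int r)) (int s)) (zpow (g * W (e * int r) * inverse g) (int s))"
      using * n by (intro eqK_zpow) (simp add: r_def of_nat_diff)
    then have "eqK (W (fact c)) (g * W (e * fact c) * inverse g)"
      unfolding zpow_conj s' by (simp only: zpow_mult flip: mult.assoc)
    moreover have "e = 1 \<or> e = -1" by (simp add: e_def)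
    ultimately show ?thesis unfolding ES_def by blast
  qed
  show ?thesis
    by (rule exI[of _ "fact c"], simp, rule exI[of _ "int M + int c + 3"]) (use main in auto)
qed

end

section \<open>The elementary closure \<open>E\<close> and projections to translates of the
  axis\<close>

locale lines = waxis +
  fixes N0 \<theta> :: int
  assumes N0: "0 < N0" and theta0: "0 \<le> \<theta>"
    and overlap_E: "\<theta> < \<bar>b (g * W i) - b (g * W j)\<bar> \<Longrightarrow> g \<in> ES N0"
begin

abbreviation "E \<equiv> ES N0"

lemma E_zpow:
  assumes "eqK (W N0) (g * W (e * N0) * inverse g)"
  shows "eqK (W (N0 * i)) (g * W (e * N0 * i) * inverse g)"
  using eqK_zpow[OF assms, of i] by (simp add: zpow_conj zpow_mult)

lemma E_one: "1 \<in> E"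
  unfolding ES_def by (auto intro!: exI[of _ 1])

lemma E_mult: assumes "g \<in> E" "h \<in> E" shows "g * h \<in> E"
proof -
  obtain e f where e: "e = 1 \<or> e = -1" "eqK (W N0) (g * W (e * N0) * inverse g)"
    and f: "f = 1 \<or> f = -1" "eqK (W N0) (h * W (f * N0) * inverse h)"
    using assms by (auto simp: ES_def)
  have "eqK (W (N0 * e)) (h * W (f * N0 * e) * inverse h)" by (rule E_zpow[OF f(2)])
  moreover have ee: "N0 * e = e * N0" "f * N0 * e = f * e * N0" by simp_all
  ultimately have "eqK (W (e * N0)) (h * W (f * e * N0) * inverse h)" by (simp only: ee)
  then have "eqK (g * W (e * N0) * inverse g) (g * (h * W (f * e * N0) * inverse h) * inverse g)"
    by (simp add: eqK_cancel_left eqK_cancel_right)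
  from eqK_trans[OF e(2) this] have "eqK (W N0) ((g * h) * W ((f * e) * N0) * inverse (g * h))"
    by (simp add: mgs)
  moreover have "f * e = 1 \<or> f * e = -1" using e f by auto
  ultimately show ?thesis unfolding ES_def by blast
qed

lemma E_inv: assumes "g \<in> E" shows "inverse g \<in> E"
proof -
  obtain e where e: "e = 1 \<or> e = -1" "eqK (W N0) (g * W (e * N0) * inverse g)"
    using assms by (auto simp: ES_def)
  have "eqK (W (N0 * e)) (g * W (e * N0 * e) * inverse g)" by (rule E_zpow[OF e(2)])
  moreover have "e * N0 * e = N0" "N0 * e = e * N0" using e(1) by auto
  ultimately have "eqK (W (e * N0)) (g * W N0 * inverse g)" by simp
  from eqK_right[OF eqK_left[OF this, of "inverse g"], of g]
  have "eqK (inverse g * W (e * N0) * g) (W N0)" by (simp add: mgs)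
  then have "eqK (W N0) (inverse g * W (e * N0) * inverse (inverse g))" using eqK_sym by simp
  with e(1) show ?thesis unfolding ES_def by blast
qed

lemma E_W: "W i \<in> E"
proof -
  have "W i * W (1 * N0) * inverse (W i) = W N0"
    by (metis zpow_commute mg_right_inv mult.assoc mult_1_right mult_1)
  then have "eqK (W N0) (W i * W (1 * N0) * inverse (W i))" by simp
  then show ?thesis unfolding ES_def by blast
qed

text \<open>Equivalence of the lines \<open>g * W i\<close> and \<open>h * W i\<close>; equivalent
  lines stay within \<open>5 * a\<close> of each other (\<open>sim_near\<close>).\<close>

definition sim :: "'a \<Rightarrow> 'a \<Rightarrow> bool" where "sim g h \<longleftrightarrow> inverse g * h \<in> E"

lemma sim_sym: "sim g h \<Longrightarrow> sim h g"
  unfolding sim_def using E_inv[of "inverse g * h"] by (simp add: mgs)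

lemma sim_left [simp]: "sim (f * g) (f * h) \<longleftrightarrow> sim g h"
  by (simp add: sim_def mgs)

definition B :: "'a \<Rightarrow> 'a \<Rightarrow> int" where "B g x = b (inverse g * x)"

lemma B_left [simp]: "B (f * g) (f * x) = B g x"
  by (simp add: B_def mgs)

lemma B_mult_left: "B g (f * x) = B (inverse f * g) x"
  by (simp add: B_def mgs)

lemma B_shift: "B g (g * W i * inverse g * x) = B g x + i"
  by (simp add: B_def mgs b_shift)

lemma B_cong: "d x y = 0 \<Longrightarrow> B g x = B g y"
  by (simp add: B_def b_cong del: d_K0)

lemma B_line: "B g (g * W i) = b 1 + i"
  using b_shift[of i 1] by (simp add: B_def)

text \<open>An element of \<open>E\<close> carries a power of \<open>w\<close> to a power of
  \<open>w\<close> by conjugation, so its line has arbitrarily distant projections to the axis, and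
  every exponent \<open>m\<close> lies between two of them.\<close>

lemma E_near: assumes "g \<in> E" shows "D (inverse g * W m) \<le> 5 * a"
proof -
  obtain e where e: "e = 1 \<or> e = -1" "eqK (W N0) (g * W (e * N0) * inverse g)"
    using assms by (auto simp: ES_def)
  have *: "b (g * W (e * N0 * i)) = b g + N0 * i" for i
  proof -
    have "eqK (W (N0 * i) * g) (g * W (e * N0 * i))"
      using eqK_right[OF E_zpow[OF e(2), of i], of g] by (simp add: mgs)
    then have "b (W (N0 * i) * g) = b (g * W (e * N0 * i))" by (intro b_cong) (simp add: eqK_d)
    then show ?thesis by (simp add: b_shift)
  qed
  define n where "n = \<bar>m\<bar> + \<bar>b g\<bar> + 3"
  have n: "N0 * n \<ge> n" using N0 mult_right_mono[of 1 N0 n] by (simp add: n_def)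
  define p where "p = N0 * n"
  have b1: "b (g * W (e * N0 * n)) = b g + p" "b (g * W (e * N0 * (- n))) = b g - p"
    using *[of n] *[of "- n"] by (simp_all add: p_def)
  have p: "\<bar>m\<bar> + \<bar>b g\<bar> + 3 \<le> p" using n by (simp add: p_def n_def)
  show ?thesis
    by (rule overlap_near[of g "e * N0 * n" "e * N0 * (- n)"]) (use p in \<open>unfold b1, linarith+\<close>)
qed

lemma proj_bounded: "\<not> sim g h \<Longrightarrow> \<bar>B g (h * W i) - B g (h * W j)\<bar> \<le> \<theta>"
  using overlap_E[of "inverse g * h" i j] by (metis B_def sim_def mult.assoc not_le)

lemma proj_bounded0: "\<not> sim g h \<Longrightarrow> \<bar>B g (h * W i) - B g h\<bar> \<le> \<theta>"
  using proj_bounded[of g h i 0] by simp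

definition near :: "'a \<Rightarrow> 'a \<Rightarrow> 'a" where "near g x = g * W (B g x)"

definition dist :: "'a \<Rightarrow> 'a \<Rightarrow> real" where "dist g x = d x (near g x)"

lemma dist_D: "dist g x = D (inverse g * x)"
  by (simp add: dist_def D_def near_def B_def d_mult_left(1))

lemma dist_le: "dist g x \<le> d x (g * W i)"
  unfolding dist_D using D_le[of "inverse g * x" i] by (simp add: d_mult_left(1))

lemma dist_nonneg [simp]: "0 \<le> dist g x" by (simp add: dist_def)

lemma line_lower: "3 \<le> \<bar>B g x - B g y\<bar> \<Longrightarrow> dist g x + A (B g x - B g y) + dist g y \<le> d x y + 5 * a"
  using proj_proj_lower[of "inverse g * x" "inverse g * y"] unfolding dist_D B_def d_left .

lemma line_upper: "d x y \<le> dist g x + A (B g x - B g y) + dist g y"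
  using d_upper[of "inverse g * x" "inverse g * y"] unfolding dist_D B_def d_left .

lemma B_Lip1: "d x y \<le> 1 \<Longrightarrow> \<bar>B g x - B g y\<bar> \<le> 6"
  using b_Lip1[of "inverse g * x" "inverse g * y"] unfolding B_def d_left .

lemma B_Lipi: "d x y \<le> real_of_int c * a \<Longrightarrow> 99 * \<bar>B g x - B g y\<bar> \<le> 100 * (c + 5)"
  using b_Lipi[of "inverse g * x" "inverse g * y"] unfolding B_def d_left .

lemma B_mono:
  assumes "q \<in> I x y"
  shows "min (B g x) (B g y) - 6 \<le> B g q" "B g q \<le> max (B g x) (B g y) + 6"
  using b_mono[OF I_left[OF assms, of "inverse g"]] by (simp_all add: B_def)

lemma near_line: "3 \<le> \<bar>B g x - B g y\<bar> \<Longrightarrow> z \<in> I x y \<Longrightarrow> d x z = dist g x \<Longrightarrow> d z (near g x) \<le> 6 * a"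
  using near_W[of "inverse g * x" "inverse g * y" "inverse g * z"] I_left[of z x y "inverse g"]
  unfolding dist_D B_def near_def d_left d_mult_left(1) mg_inv_inv mg_cancel2 by blast

lemma dist_le_d: "6 \<le> \<bar>B g x - B g y\<bar> \<Longrightarrow> dist g x \<le> d x y"
  using D_le_d[of "inverse g * x" "inverse g * y"] unfolding dist_D B_def d_left .

text \<open>If both projections of \<open>x\<close> were far from those of the other line, the path
  from \<open>x\<close> to its foot on \<open>h\<close> would pass its foot on \<open>g\<close> and
  conversely, so that each of the two distances would exceed the other.\<close>

lemma behrstock:
  assumes "\<not> sim g h"
  shows "\<bar>B g x - B g h\<bar> \<le> \<theta> + 9 \<or> \<bar>B h x - B h g\<bar> \<le> \<theta> + 9"
proof (rule ccontr)
  assume c: "\<not> ?thesis"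
  define y where "y = near h x"
  define q where "q = near g x"
  have ns: "\<not> sim h g" using assms sim_sym by blast
  have "\<bar>B g y - B g h\<bar> \<le> \<theta>" unfolding y_def near_def by (rule proj_bounded0[OF assms])
  then have 1: "10 \<le> \<bar>B g x - B g y\<bar>" using c by linarith
  have "\<bar>B h q - B h g\<bar> \<le> \<theta>" unfolding q_def near_def by (rule proj_bounded0[OF ns])
  then have 2: "10 \<le> \<bar>B h x - B h q\<bar>" using c by linarith
  have "dist g x + A (B g x - B g y) + dist g y \<le> dist h x + 5 * a"
    using line_lower[of g x y] 1 by (simp add: y_def dist_def)
  moreover have "dist h x + A (B h x - B h q) + dist h q \<le> dist g x + 5 * a"
    using line_lower[of h x q] 2 by (simp add: q_def dist_def)
  moreover have "real_of_int 10 * 99 * a \<le> 100 * A (B g x - B g y)" "real_of_int 10 * 99 * a \<le> 100 * A (B h x - B h q)"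
    using A_ge 1 2 by blast+
  ultimately show False using dist_nonneg[of g y] dist_nonneg[of h q] a1 by simp
qed

lemma sim_near: "sim g h \<Longrightarrow> dist h (g * W m) \<le> 5 * a"
  unfolding dist_D using E_near[of "inverse g * h" m] by (simp add: sim_def mgs)

lemma sim_proj:
  assumes "sim g h"
  shows "\<bar>B h p - B h (near g p)\<bar> \<le> 10"
proof (rule ccontr)
  assume c: "\<not> ?thesis"
  have "dist h p + A (B h p - B h (near g p)) + dist h (near g p) \<le> dist g p + 5 * a"
    using line_lower[of h p "near g p"] c by (simp add: dist_def)
  moreover have "dist g p \<le> dist h p + 5 * a"
  proof -
    have "dist g p \<le> d p (near g (near h p))" unfolding near_def[of g] by (rule dist_le)
    also have "\<dots> \<le> dist h p + dist g (near h p)" using d_tri[of p _ "near h p"] by (simp add: dist_def)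
    finally show ?thesis using sim_near[OF sim_sym[OF assms], of "B h p"] by (simp add: near_def)
  qed
  moreover have "real_of_int 11 * 99 * a \<le> 100 * A (B h p - B h (near g p))"
    by (rule A_ge) (use c in linarith)
  ultimately show False using dist_nonneg[of h "near g p"] a1 by simp
qed

text \<open>Projecting to \<open>g\<close> first changes the exponents on \<open>h\<close> by at
  most 10 at either end, and between the feet the two lines differ by at most 5.\<close>

lemma sim_compare:
  assumes "sim g h"
  shows "\<bar>B h p - B h q\<bar> \<le> \<bar>B g p - B g q\<bar> + 26"
proof -
  have "A (B h (near g p) - B h (near g q)) \<le> A (B g p - B g q) + real_of_int 5 * a"
    using A_b_le[of "inverse h * near g p" "inverse h * near g q"] A_commute[of "B g p" "B g q"]
    by (simp add: B_def[symmetric] near_def)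
  from A_comparei[OF this]
  have "99 * \<bar>B h (near g p) - B h (near g q)\<bar> \<le> 99 * \<bar>B g p - B g q\<bar> + 501" by simp
  moreover have "99 * u \<le> 99 * v + 501 \<Longrightarrow> u \<le> v + 5" for u v :: int by linarith
  ultimately have "\<bar>B h (near g p) - B h (near g q)\<bar> \<le> \<bar>B g p - B g q\<bar> + 5" by blast
  then show ?thesis using sim_proj[OF assms, of p] sim_proj[OF assms, of q] by linarith
qed

text \<open>For an element of \<open>E1\<close>, which commutes with \<open>w ^ N0\<close> modulo
  \<open>K\<close>, conjugation by \<open>w ^ M\<close> reduces to conjugation by a remainder modulo
  \<open>N0\<close>; a bound at \<open>1\<close> thus gives one at \<open>w ^ M\<close>, and weak
  proper discontinuity applies. The other elements of \<open>E\<close> invert \<open>w ^ N0\<close>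
  and form at most one further coset of \<open>E1\<close>.\<close>

lemma E_ball: "finK {f \<in> E. \<nu> f \<le> R}"
proof -
  define E1 where "E1 = {f. eqK (W N0) (f * W N0 * inverse f)}"
  have fin1: "finK {f \<in> E1. \<nu> f \<le> R}" for R
  proof -
    define R' where "R' = R + 2 * (nat N0 * \<nu> w)"
    obtain M where M: "finK {f. \<nu> f \<le> R' \<and> \<nu> (inverse (w ^ M) * f * w ^ M) \<le> R'}"
      using wpd_w unfolding wpd_def by metis
    define q r where "q = int M div N0" and "r = int M mod N0"
    have r: "0 \<le> r" "r < N0" using N0 by (auto simp: r_def)
    have M': "w ^ M = W (N0 * q) * W r"
      by (simp add: q_def r_def zpow_of_nat flip: zpow_add)
    have "\<nu> (inverse (w ^ M) * f * w ^ M) \<le> R'" if f: "f \<in> E1" "\<nu> f \<le> R" for f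
    proof -
      have "eqK (W (N0 * q)) (f * W (N0 * q) * inverse f)"
        using E_zpow[of f 1 q] f by (simp add: E1_def)
      then have "eqK (inverse (W r) * inverse (W (N0 * q)) * W (N0 * q) * f * W r)
         (inverse (W r) * inverse (W (N0 * q)) * (f * W (N0 * q) * inverse f) * f * W r)"
        by (simp only: eqK_cancel_left eqK_cancel_right mult.assoc)
          (simp only: eqK_cancel_left eqK_cancel_right flip: mult.assoc)
      then have "eqK (inverse (W r) * f * W r) (inverse (w ^ M) * f * w ^ M)"
        by (simp add: M' mgs)
      then have "\<nu> (inverse (w ^ M) * f * w ^ M) = \<nu> (inverse (W r) * f * W r)"
        using eqK_nu by metis
      also have "\<dots> \<le> \<nu> (W r) + \<nu> f + \<nu> (W r)"
        using nu_mult[of "inverse (W r) * f" "W r"] nu_mult[of "inverse (W r)" f] by simp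
      also have "\<nu> (W r) \<le> nat N0 * \<nu> w"
      proof -
        have "\<nu> (W r) \<le> nat r * \<nu> w" using nu_power[of w "nat r"] r by (simp add: zpow_def)
        also have "\<dots> \<le> nat N0 * \<nu> w" by (rule mult_right_mono) (use r in auto)
        finally show ?thesis .
      qed
      finally show ?thesis using f by (simp add: R'_def)
    qed
    then show ?thesis by (intro finK_subset[OF M]) (auto simp: R'_def)
  qed
  have E1: "inverse f * g \<in> E1" if fg: "f \<in> E - E1" "g \<in> E - E1" for f g
  proof -
    have "eqK (W N0) (f * W (- N0) * inverse f)" "eqK (W N0) (g * W (- N0) * inverse g)"
      using fg by (auto simp: ES_def E1_def)
    then have "eqK (f * W (- N0) * inverse f) (g * W (- N0) * inverse g)"
      using eqK_sym eqK_trans by blast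
    from eqK_inv[OF this] have "eqK (f * W N0 * inverse f) (g * W N0 * inverse g)"
      by (simp add: mgs zpow_minus)
    then have "eqK (inverse f * (f * W N0 * inverse f) * f) (inverse f * (g * W N0 * inverse g) * f)"
      by (simp only: eqK_cancel_left eqK_cancel_right)
    then show ?thesis by (simp add: E1_def mgs)
  qed
  obtain F1 where F1: "finite F1" "\<And>f. f \<in> E1 \<Longrightarrow> \<nu> f \<le> 2 * R \<Longrightarrow> \<exists>e\<in>F1. eqK e f"
    using fin1[of "2 * R"] unfolding finK_def by auto
  have "\<exists>f0. \<forall>f\<in>E. \<nu> f \<le> R \<longrightarrow> f \<in> E1 \<or> (inverse f0 * f \<in> E1 \<and> \<nu> (inverse f0 * f) \<le> 2 * R)"
  proof (cases "\<exists>f0. f0 \<in> E - E1 \<and> \<nu> f0 \<le> R")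
    case True
    then obtain f0 where f0: "f0 \<in> E - E1" "\<nu> f0 \<le> R" by blast
    have "\<nu> (inverse f0 * f) \<le> 2 * R" if "\<nu> f \<le> R" for f using nu_mult[of "inverse f0" f] f0 that by simp
    then show ?thesis using E1 f0 by (intro exI[of _ f0]) blast
  qed blast
  then obtain f0 where f0: "\<And>f. f \<in> E \<Longrightarrow> \<nu> f \<le> R \<Longrightarrow> f \<in> E1 \<or> (inverse f0 * f \<in> E1 \<and> \<nu> (inverse f0 * f) \<le> 2 * R)"
    by blast
  show ?thesis unfolding finK_def
  proof (rule exI[of _ "F1 \<union> (*) f0 ` F1"], intro conjI ballI)
    fix f assume "f \<in> {f \<in> E. \<nu> f \<le> R}"
    then have f: "f \<in> E" "\<nu> f \<le> R" by auto
    from f0[OF this] show "\<exists>e\<in>F1 \<union> (*) f0 ` F1. eqK e f"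
    proof
      assume "f \<in> E1"
      then show ?thesis using F1(2)[of f] f by auto
    next
      assume "inverse f0 * f \<in> E1 \<and> \<nu> (inverse f0 * f) \<le> 2 * R"
      then obtain e where e: "e \<in> F1" "eqK e (inverse f0 * f)" using F1(2) by blast
      have "eqK (f0 * e) f" using eqK_left[OF e(2), of f0] by simp
      then show ?thesis using e(1) by blast
    qed
  qed (use F1(1) in auto)
qed

text \<open>Multiplication by a power of \<open>w ^ n\<close> brings the foot of \<open>f\<close> to
  an exponent below \<open>n\<close>, hence \<open>f\<close> into a ball, and \<open>E_ball\<close>
  applies.\<close>

lemma E_cosets:
  assumes "0 < n"
  shows "\<exists>F. finite F \<and> (\<forall>f\<in>E. \<exists>i. \<exists>e\<in>F. eqK f (W (n * i) * e))"
proof -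
  define R where "R = nat \<lceil>5 * a + real_of_int n * a\<rceil>"
  obtain F where F: "finite F" "\<And>f. f \<in> E \<Longrightarrow> \<nu> f \<le> R \<Longrightarrow> \<exists>e\<in>F. eqK e f"
    using E_ball[of R] unfolding finK_def by auto
  have "\<exists>i. \<exists>e\<in>F. eqK f (W (n * i) * e)" if f: "f \<in> E" for f
  proof -
    have "D f \<le> 5 * a" using E_near[OF E_inv[OF f], of 0] by simp
    define i r where "i = b f div n" and "r = b f mod n"
    have bf: "b f = n * i + r" and r: "0 \<le> r" "r < n" using assms by (simp_all add: i_def r_def)
    define g where "g = W (n * (- i)) * f"
    have g: "g \<in> E" unfolding g_def using E_mult E_W f by blast
    have "real (\<nu> g) = d (W (n * i)) f" by (simp add: d_def g_def zpow_minus)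
    also have "\<dots> \<le> D f + A r"
      using d_tri[of "W (n*i)" f "W (b f)"] d_sym[of f "W (b f)"] by (simp add: D_def bf)
    also have "A r \<le> real_of_int n * a"
    proof -
      have "real_of_int \<bar>r\<bar> \<le> real_of_int n" using r by linarith
      then show ?thesis using A_upper[of r] mult_right_mono[of "real_of_int \<bar>r\<bar>" "real_of_int n" a] a1 by linarith
    qed
    finally have "real (\<nu> g) \<le> 5 * a + real_of_int n * a" using \<open>D f \<le> 5 * a\<close> by simp
    then have "\<nu> g \<le> R" unfolding R_def by linarith
    then obtain e where e: "e \<in> F" "eqK e g" using F(2) g by blast
    have "eqK (W (n * i) * e) f" using eqK_left[OF e(2), of "W (n * i)"] by (simp add: g_def zpow_minus)
    then show ?thesis using e(1) eqK_sym by blast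
  qed
  then show ?thesis using F(1) by blast
qed

end

section \<open>Windmills\<close>

text \<open>Divisibility by \<open>N0\<close> makes the rotation depend only on the equivalence
  class of the line, up to inversion (\<open>u_sim\<close>); the factor 3000 lets \<open>N\<close>
  dominate all accumulated errors.\<close>

locale wind = lines +
  fixes N :: int
  assumes N0_dvd: "N0 dvd N" and N_large: "3000 * (\<theta> + 10) \<le> N"
begin

text \<open>The extra 10 absorbs the 9 of \<open>behrstock\<close> and lets small numbers be bounded
  by multiples of \<open>\<theta>1\<close>.\<close>

definition \<theta>1 :: int where "\<theta>1 = \<theta> + 10"

lemma theta1: "10 \<le> \<theta>1" and N_theta1: "3000 * \<theta>1 \<le> N"
  using theta0 N_large by (auto simp: \<theta>1_def)

lemma behrstock_theta1: "\<not> sim g h \<Longrightarrow> \<bar>B g x - B g h\<bar> \<le> \<theta>1 \<or> \<bar>B h x - B h g\<bar> \<le> \<theta>1"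
  using behrstock[of g h x] unfolding \<theta>1_def by linarith

definition u :: "'a \<Rightarrow> 'a" where "u g = g * W N * inverse g"

lemma zpow_u: "zpow (u g) n = g * W (N * n) * inverse g"
  by (simp add: u_def zpow_conj zpow_mult)

lemma u_shift: "B g (zpow (u g) n * x) = B g x + N * n"
  by (simp add: zpow_u B_shift)

lemma u_conj: "u (h * g) = h * u g * inverse h"
  by (simp add: u_def mgs)

lemma u_conj_zpow: "zpow (u (h * g)) n = h * zpow (u g) n * inverse h"
  by (simp add: u_conj zpow_conj)

lemma u_sim: assumes "sim g h" shows "\<exists>e. (e = 1 \<or> e = -1) \<and> eqK (u g) (zpow (u h) e)"
proof -
  define f where "f = inverse g * h"
  have f: "f \<in> E" using assms by (simp add: f_def sim_def)
  obtain e where e: "e = 1 \<or> e = -1" "eqK (W N0) (f * W (e * N0) * inverse f)"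
    using f by (auto simp: ES_def)
  obtain m where m: "N = N0 * m" using N0_dvd by (elim dvdE)
  have "eqK (W N) (f * W (N * e) * inverse f)" using E_zpow[OF e(2), of m] by (simp add: m mult.commute mult.left_commute)
  then have "eqK (g * W N * inverse g) (g * (f * W (N * e) * inverse f) * inverse g)"
    by (simp only: eqK_cancel_left eqK_cancel_right)
  also have "g * (f * W (N * e) * inverse f) * inverse g = zpow (u h) e"
    by (simp add: zpow_u f_def mgs)
  finally show ?thesis using e(1) by (auto simp: u_def)
qed

lemma eqK_subgrp: "eqK x y \<Longrightarrow> subgrp H \<Longrightarrow> K \<subseteq> H \<Longrightarrow> y \<in> H \<Longrightarrow> x \<in> H"
proof -
  assume *: "eqK x y" "subgrp H" "K \<subseteq> H" "y \<in> H"
  have "x = y * inverse (inverse x * y)" by (simp add: mgs)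
  then show ?thesis using * unfolding eqK_def by (metis subgrp_inv subgrp_mult subset_iff)
qed

lemma u_sim_mem: "sim g h \<Longrightarrow> subgrp H \<Longrightarrow> K \<subseteq> H \<Longrightarrow> u h \<in> H \<Longrightarrow> u g \<in> H"
  using u_sim[of g h] eqK_subgrp subgrp_zpow by blast

definition dia :: "'a \<Rightarrow> 'a set \<Rightarrow> int \<Rightarrow> bool" where
  "dia g S c \<longleftrightarrow> (\<forall>x\<in>S. \<forall>y\<in>S. \<bar>B g x - B g y\<bar> \<le> c)"

end

text \<open>The slack between 8 here and 6 in \<open>dia_S'\<close> pays for replacing
  \<open>S\<close> by its unit neighbourhood before each step.\<close>

locale windmill = wind +
  fixes H S :: "'a set"
  assumes H: "subgrp H" and KH: "K \<subseteq> H" and HS: "h \<in> H \<Longrightarrow> p \<in> S \<Longrightarrow> h * p \<in> S"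
    and diaS: "u g \<notin> H \<Longrightarrow> dia g S (8 * \<theta>1)"
begin

text \<open>The lines in \<open>AA\<close> are those seen too long from \<open>S\<close>; their rotations are added to \<open>H\<close>.  Every
  new element is, up to \<open>H\<close>, a product of rotations along lines of which consecutive ones are
  inequivalent; \<open>CH g e\<close> says that \<open>e\<close> has such a form starting with a rotation along \<open>g\<close>.\<close>

definition AA where "AA = {g. u g \<notin> H \<and> \<not> dia g S (2 * \<theta>1)}"
definition H' where "H' = gen (H \<union> u ` AA)"

lemma subgrp_H': "subgrp H'" by (simp add: H'_def subgrp_gen)
lemma HH': "H \<subseteq> H'" unfolding H'_def using gen_incl by blast
lemma u_AA: "g \<in> AA \<Longrightarrow> u g \<in> H'" unfolding H'_def by (rule gen_incl) blast

lemma AA_left: assumes "h \<in> H" "g \<in> AA" shows "h * g \<in> AA"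
proof -
  have "u g \<in> H" if "u (h * g) \<in> H"
  proof -
    have "u g = inverse h * u (h * g) * h" by (simp add: u_conj mgs)
    then show ?thesis using that assms(1) H by (metis subgrp_inv subgrp_mult)
  qed
  moreover have "dia g S (2 * \<theta>1)" if "dia (h * g) S (2 * \<theta>1)"
    unfolding dia_def
  proof (intro ballI)
    fix x y assume "x \<in> S" "y \<in> S"
    then have "\<bar>B (h * g) (h * x) - B (h * g) (h * y)\<bar> \<le> 2 * \<theta>1"
      using that HS[OF assms(1)] unfolding dia_def by blast
    then show "\<bar>B g x - B g y\<bar> \<le> 2 * \<theta>1" by simp
  qed
  ultimately show ?thesis using assms(2) by (auto simp: AA_def)
qed

inductive CH :: "'a \<Rightarrow> 'a \<Rightarrow> bool" where
  CH_base: "g \<in> AA \<Longrightarrow> n \<noteq> 0 \<Longrightarrow> h \<in> H \<Longrightarrow> CH g (zpow (u g) n * h)"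
| CH_step: "g \<in> AA \<Longrightarrow> n \<noteq> 0 \<Longrightarrow> CH g' e \<Longrightarrow> \<not> sim g g' \<Longrightarrow> CH g (zpow (u g) n * e)"

lemma CH_AA: "CH g e \<Longrightarrow> g \<in> AA"
  by (erule CH.cases) auto

lemma CH_left: "CH g e \<Longrightarrow> f \<in> H \<Longrightarrow> CH (f * g) (f * e)"
proof (induction rule: CH.induct)
  case (CH_base g n h)
  have "f * (zpow (u g) n * h) = zpow (u (f * g)) n * (f * h)"
    by (simp add: u_conj_zpow mgs)
  then show ?case using CH.CH_base[OF AA_left[OF CH_base(4,1)] CH_base(2), of "f * h"]
    CH_base H by (simp add: subgrp_mult)
next
  case (CH_step g n g' e)
  have "f * (zpow (u g) n * e) = zpow (u (f * g)) n * (f * e)"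
    by (simp add: u_conj_zpow mgs)
  then show ?case using CH.CH_step[OF AA_left[OF _ CH_step(1)] CH_step(2) CH_step.IH]
    CH_step by simp
qed

definition ok :: "'a \<Rightarrow> bool" where "ok e \<longleftrightarrow> e \<in> H \<or> (\<exists>g. CH g e)"

lemma ok_left: "f \<in> H \<Longrightarrow> ok e \<Longrightarrow> ok (f * e)"
  unfolding ok_def using CH_left subgrp_mult[OF H] by blast

text \<open>A prepended rotation either starts a new block or, if its line is equivalent to the
  leading one, merges with the leading block; if the merged block vanishes, the shorter chain
  remains.\<close>

lemma ok_u: assumes "g \<in> AA" "ok e" shows "ok (zpow (u g) n * e)"
proof (cases "n = 0")
  case False
  show ?thesis
  proof (cases "e \<in> H")
    case True
    then show ?thesis using CH_base[OF assms(1) False] by (auto simp: ok_def)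
  next
    case F: False
    then obtain g' where g': "CH g' e" using assms(2) by (auto simp: ok_def)
    show ?thesis
    proof (cases "sim g g'")
      case False': False
      then show ?thesis using CH_step[OF assms(1) False g'] by (auto simp: ok_def)
    next
      case True
      obtain m where m: "eqK (zpow (u g') m) (zpow (u g) n)"
      proof -
        obtain e where "eqK (u g) (zpow (u g') e)" using u_sim[OF True] by blast
        from eqK_zpow[OF this, of n] have "eqK (zpow (u g) n) (zpow (u g') (e * n))" by (simp add: zpow_mult)
        then show ?thesis using that eqK_sym by blast
      qed
      define k where "k = zpow (u g) n * inverse (zpow (u g') m)"
      have "eqK 1 k" using eqK_right[OF m, of "inverse (zpow (u g') m)"] by (simp add: k_def)
      then have k: "k \<in> H" using KH by (auto simp: eqK_one)
      have kk: "zpow (u g) n = k * zpow (u g') m" by (simp add: k_def mgs)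
      have "\<exists>e'. ok e' \<and> (\<exists>p. e = zpow (u g') p * e' \<and> (e' \<in> H \<or> (\<exists>g2. CH g2 e' \<and> \<not> sim g' g2))) \<and> g' \<in> AA"
        using g' by (cases rule: CH.cases) (auto simp: ok_def)
      then obtain e' p where e': "ok e'" "e = zpow (u g') p * e'" "e' \<in> H \<or> (\<exists>g2. CH g2 e' \<and> \<not> sim g' g2)" "g' \<in> AA"
        by blast
      have "ok (zpow (u g') (m + p) * e')"
      proof (cases "m + p = 0")
        case True
        then show ?thesis using e' by simp
      next
        case False
        then show ?thesis using e' CH_base CH_step unfolding ok_def by metis
      qed
      from ok_left[OF k this] show ?thesis by (simp add: kk e'(2) zpow_add mgs)
    qed
  qed
qed (use assms in auto)

lemma ok_H': "e \<in> H' \<Longrightarrow> ok e"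
  unfolding H'_def
proof (induction rule: gen.induct)
  case gen_one
  then show ?case using subgrp_one[OF H] by (simp add: ok_def)
next
  case (gen_mult s x)
  then show ?case using ok_left[of s x] ok_u[of _ x 1] by auto
next
  case (gen_inv s x)
  then show ?case using ok_left[of "inverse s" x] ok_u[of _ x "-1"] subgrp_inv[OF H] by (auto simp: zpow_minus)
qed

text \<open>Since \<open>S\<close> has diameter above \<open>2 * \<theta>1\<close> on
  \<open>g\<close>, one of its points projects far from \<open>h\<close>; seen from
  \<open>h\<close>, that point is near \<open>g\<close> by Behrstock's inequality.\<close>

lemma AA_seen: assumes "g \<in> AA" "\<not> sim h g" obtains z where "z \<in> S" "\<bar>B h z - B h g\<bar> \<le> \<theta>1"
proof -
  obtain x y where xy: "x \<in> S" "y \<in> S" "2 * \<theta>1 < \<bar>B g x - B g y\<bar>"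
    using assms(1) by (auto simp: AA_def dia_def not_le)
  have "\<theta>1 < \<bar>B g x - B g h\<bar> \<or> \<theta>1 < \<bar>B g y - B g h\<bar>" using xy(3) by linarith
  then show ?thesis using behrstock_theta1[OF assms(2), of x] behrstock_theta1[OF assms(2), of y] that xy by fastforce
qed

lemma AA_dia: "g \<in> AA \<Longrightarrow> x \<in> S \<Longrightarrow> y \<in> S \<Longrightarrow> \<bar>B g x - B g y\<bar> \<le> 8 * \<theta>1"
  using diaS[of g] by (auto simp: AA_def dia_def)

lemma N_step: "n \<noteq> 0 \<Longrightarrow> N \<le> \<bar>N * n\<bar>"
proof -
  assume "n \<noteq> 0"
  then have "N * 1 \<le> N * \<bar>n\<bar>" by (intro mult_left_mono) (use N_theta1 theta1 in linarith)+
  then show ?thesis using N_theta1 theta1 by (simp add: abs_mult)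
qed

text \<open>Ping-pong: the leading rotation carries the rest of the chain by at least
  \<open>N\<close> along its line, away from the projection of \<open>g1\<close>; Behrstock's
  inequality then confines the end as seen from \<open>g1\<close>.\<close>

lemma chain_proj:
  assumes "CH g2 e" "g1 \<in> AA" "\<not> sim g1 g2" "q \<in> S"
  shows "\<bar>B g1 (e * q) - B g1 g2\<bar> \<le> \<theta>1"
  using assms
proof (induction arbitrary: g1 rule: CH.induct)
  case (CH_base g n h)
  have ns: "\<not> sim g g1" using CH_base sim_sym by blast
  obtain z where z: "z \<in> S" "\<bar>B g z - B g g1\<bar> \<le> \<theta>1" by (rule AA_seen[OF CH_base(4) ns])
  have "\<bar>B g z - B g (h * q)\<bar> \<le> 8 * \<theta>1"
    using AA_dia[OF CH_base(1) z(1) HS[OF CH_base(3,6)]] .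
  moreover have "B g (zpow (u g) n * h * q) = B g (h * q) + N * n" by (simp add: mult.assoc u_shift)
  ultimately show ?case
    using behrstock_theta1[OF CH_base(5), of "zpow (u g) n * h * q"] z(2) N_step[OF CH_base(2)] N_theta1 theta1 by linarith
next
  case (CH_step g n g' e)
  have ns: "\<not> sim g g1" using CH_step sim_sym by blast
  obtain z where z: "z \<in> S" "\<bar>B g z - B g g1\<bar> \<le> \<theta>1" by (rule AA_seen[OF CH_step.prems(1) ns])
  obtain z' where z': "z' \<in> S" "\<bar>B g z' - B g g'\<bar> \<le> \<theta>1" by (rule AA_seen[OF CH_AA[OF CH_step.hyps(3)] CH_step.hyps(4)])
  have "\<bar>B g z - B g z'\<bar> \<le> 8 * \<theta>1" using AA_dia[OF CH_step(1) z(1) z'(1)] .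
  moreover have "\<bar>B g (e * q) - B g g'\<bar> \<le> \<theta>1" using CH_step.IH[OF CH_step(1,4) CH_step.prems(3)] .
  moreover have "B g (zpow (u g) n * e * q) = B g (e * q) + N * n" by (simp add: mult.assoc u_shift)
  ultimately show ?case
    using behrstock_theta1[OF CH_step.prems(2), of "zpow (u g) n * e * q"] z(2) z'(2) N_step[OF CH_step(2)] N_theta1 theta1 by linarith
qed

lemma chain_far:
  assumes "e \<in> H \<or> (\<exists>g'. CH g' e \<and> \<not> sim g g')" "g \<in> AA" "q \<in> S"
  obtains z where "z \<in> S" "\<bar>B g (e * q) - B g z\<bar> \<le> 2 * \<theta>1"
  using assms(1)
proof
  assume "e \<in> H"
  then show ?thesis using that[OF HS[OF _ assms(3)]] theta1 by simp
next
  assume "\<exists>g'. CH g' e \<and> \<not> sim g g'"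
  then obtain g' where g': "CH g' e" "\<not> sim g g'" by blast
  obtain z where z: "z \<in> S" "\<bar>B g z - B g g'\<bar> \<le> \<theta>1" by (rule AA_seen[OF CH_AA[OF g'(1)] g'(2)])
  have "\<bar>B g (e * q) - B g g'\<bar> \<le> \<theta>1" by (rule chain_proj[OF g'(1) assms(2) g'(2) assms(3)])
  then show ?thesis using that[of z] z by linarith
qed

lemma CH_cases':
  assumes "CH g e"
  obtains n e' where "g \<in> AA" "n \<noteq> 0" "e = zpow (u g) n * e'" "e' \<in> H \<or> (\<exists>g'. CH g' e' \<and> \<not> sim g g')"
  using assms by (cases rule: CH.cases) blast+

text \<open>The rest of the chain projects to \<open>g\<close> within \<open>2 * \<theta>1\<close>
  of a point of \<open>S\<close>, which is within \<open>8 * \<theta>1\<close> of \<open>x\<close>;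
  a rotation by a nonzero multiple of \<open>N\<close> survives these errors.\<close>

lemma chain_big:
  assumes "CH g e" "q \<in> S" "x \<in> S"
  shows "N - 10 * \<theta>1 \<le> \<bar>B g (e * q) - B g x\<bar>"
proof -
  obtain n e' where e: "g \<in> AA" "n \<noteq> 0" "e = zpow (u g) n * e'" "e' \<in> H \<or> (\<exists>g'. CH g' e' \<and> \<not> sim g g')"
    by (rule CH_cases'[OF assms(1)])
  obtain z where z: "z \<in> S" "\<bar>B g (e' * q) - B g z\<bar> \<le> 2 * \<theta>1" by (rule chain_far[OF e(4,1) assms(2)])
  have "\<bar>B g z - B g x\<bar> \<le> 8 * \<theta>1" by (rule AA_dia[OF e(1) z(1) assms(3)])
  moreover have "B g (e * q) = B g (e' * q) + N * n" by (simp add: e(3) mult.assoc u_shift)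
  ultimately show ?thesis using z(2) N_step[OF e(2)] by linarith
qed

lemma u_left_H': "f \<in> H' \<Longrightarrow> u (f * g) \<in> H' \<longleftrightarrow> u g \<in> H'"
proof -
  assume f: "f \<in> H'"
  have "u g = inverse f * u (f * g) * f" by (simp add: u_conj mgs)
  then show ?thesis using f subgrp_H' unfolding u_conj by (metis subgrp_inv subgrp_mult)
qed

text \<open>Either \<open>g\<close> projects on the line \<open>g2\<close> far from the end of the chain, and Behrstock's inequality
  puts this end near the projection of \<open>g2\<close> to \<open>g\<close>; or it projects near that end, and undoing the
  first rotation reduces to the shorter chain.  The point \<open>x\<close> is not assumed to lie in \<open>S\<close>
  because it is moved by this reduction.\<close>

lemma chain_step:
  assumes g2: "g2 \<in> AA" "n \<noteq> 0" "e' \<in> H \<or> (\<exists>g'. CH g' e' \<and> \<not> sim g2 g')" and q: "q \<in> S"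
    and g: "u g \<notin> H'"
    and x: "\<exists>z\<in>S. \<bar>B g x - B g z\<bar> \<le> 2 * \<theta>1" "\<exists>z\<in>S. \<bar>B g2 x - B g2 z\<bar> \<le> 2 * \<theta>1"
    and cont: "\<And>g x. u g \<notin> H' \<Longrightarrow> \<exists>z\<in>S. \<bar>B g x - B g z\<bar> \<le> 2 * \<theta>1 \<Longrightarrow>
      (\<And>g'. CH g' e' \<Longrightarrow> \<not> sim g2 g' \<Longrightarrow> \<exists>z\<in>S. \<bar>B g' x - B g' z\<bar> \<le> 2 * \<theta>1) \<Longrightarrow> \<bar>B g x - B g (e' * q)\<bar> \<le> 6 * \<theta>1"
  shows "\<bar>B g x - B g (zpow (u g2) n * e' * q)\<bar> \<le> 6 * \<theta>1"
proof -
  have un: "zpow (u g2) m \<in> H'" for m using subgrp_zpow[OF subgrp_H' u_AA[OF g2(1)]] .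
  have KH': "K \<subseteq> H'" using KH HH' by blast
  have ns': "\<not> sim g' g2" if "u g' \<notin> H'" for g' using u_sim_mem[OF _ subgrp_H' KH' u_AA[OF g2(1)]] that by blast
  note ns = ns'[OF g]
  have dia0: "dia g' S (2 * \<theta>1)" if "u g' \<notin> H'" for g'
    using that u_AA[of g'] HH' by (auto simp: AA_def)
  obtain z2 where z2: "z2 \<in> S" "\<bar>B g2 (e' * q) - B g2 z2\<bar> \<le> 2 * \<theta>1" by (rule chain_far[OF g2(3,1) q])
  obtain z1 where z1: "z1 \<in> S" "\<bar>B g2 x - B g2 z1\<bar> \<le> 2 * \<theta>1" using x(2) by blast
  have z12: "\<bar>B g2 z1 - B g2 z2\<bar> \<le> 8 * \<theta>1" by (rule AA_dia[OF g2(1) z1(1) z2(1)])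
  define y where "y = zpow (u g2) n * e' * q"
  have By: "B g2 y = B g2 (e' * q) + N * n" by (simp add: y_def mult.assoc u_shift)
  note Nn = N_step[OF g2(2)]
  show ?thesis
  proof (cases "\<theta>1 < \<bar>B g2 y - B g2 g\<bar>")
    case True
    then have 1: "\<bar>B g y - B g g2\<bar> \<le> \<theta>1" using behrstock_theta1[OF ns, of y] by linarith
    obtain z where z: "z \<in> S" "\<bar>B g z - B g g2\<bar> \<le> \<theta>1" by (rule AA_seen[OF g2(1) ns])
    obtain z3 where z3: "z3 \<in> S" "\<bar>B g x - B g z3\<bar> \<le> 2 * \<theta>1" using x(1) by blast
    have "\<bar>B g z - B g z3\<bar> \<le> 2 * \<theta>1" using dia0[OF g] z(1) z3(1) by (auto simp: dia_def)
    then show ?thesis using 1 z(2) z3(2) unfolding y_def by linarith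
  next
    case False
    define f where "f = zpow (u g2) (- n)"
    have Bf: "B g2 (f * p) = B g2 p - N * n" for p by (simp add: f_def u_shift)
    define x' g' where "x' = f * x" and "g' = f * g"
    have ug': "u g' \<notin> H'" using g u_left_H'[OF un] by (simp add: g'_def f_def)
    have fy: "f * y = e' * q" by (simp add: f_def y_def zpow_minus mgs)
    have far: "12 * \<theta>1 < \<bar>B g2 x' - B g2 z2\<bar>"
      using Bf[of x] z1 z12 Nn N_theta1 theta1 unfolding x'_def by linarith
    have g'z2: "\<bar>B g2 g' - B g2 z2\<bar> \<le> 3 * \<theta>1"
      using Bf[of g] By False z2 unfolding g'_def by linarith
    have ns2: "\<not> sim g' g2" by (rule ns'[OF ug'])
    have 1: "\<bar>B g' x' - B g' g2\<bar> \<le> \<theta>1" using behrstock_theta1[OF ns2, of x'] far g'z2 theta1 by linarith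
    obtain z where z: "z \<in> S" "\<bar>B g' z - B g' g2\<bar> \<le> \<theta>1" by (rule AA_seen[OF g2(1) ns2])
    have "\<bar>B g' x' - B g' (e' * q)\<bar> \<le> 6 * \<theta>1"
    proof (rule cont[OF ug'])
      show "\<exists>z\<in>S. \<bar>B g' x' - B g' z\<bar> \<le> 2 * \<theta>1" using 1 z by (intro bexI[of _ z]) linarith+
    next
      fix g3 assume g3: "CH g3 e'" "\<not> sim g2 g3"
      then have g3': "\<not> sim g3 g2" using sim_sym by blast
      have "\<bar>B g2 (e' * q) - B g2 g3\<bar> \<le> \<theta>1" by (rule chain_proj[OF g3(1) g2(1) g3(2) q])
      then have 2: "\<bar>B g3 x' - B g3 g2\<bar> \<le> \<theta>1" using behrstock_theta1[OF g3', of x'] far z2(2) theta1 by linarith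
      obtain z where z: "z \<in> S" "\<bar>B g3 z - B g3 g2\<bar> \<le> \<theta>1" by (rule AA_seen[OF g2(1) g3'])
      then show "\<exists>z\<in>S. \<bar>B g3 x' - B g3 z\<bar> \<le> 2 * \<theta>1" using 2 by (intro bexI[of _ z]) linarith+
    qed
    then have "\<bar>B (f * g) (f * x) - B (f * g) (f * y)\<bar> \<le> 6 * \<theta>1" by (simp only: fy x'_def g'_def)
    then show ?thesis by (simp add: y_def)
  qed
qed

lemma chain_dia:
  assumes "CH g2 e" "q \<in> S" "u g \<notin> H'"
    "\<exists>z\<in>S. \<bar>B g x - B g z\<bar> \<le> 2 * \<theta>1" "\<exists>z\<in>S. \<bar>B g2 x - B g2 z\<bar> \<le> 2 * \<theta>1"
  shows "\<bar>B g x - B g (e * q)\<bar> \<le> 6 * \<theta>1"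
  using assms
proof (induction arbitrary: g x rule: CH.induct)
  case (CH_base g2 n h)
  show ?case
  proof (rule chain_step)
    fix g x assume g: "u g \<notin> H'" "\<exists>z\<in>S. \<bar>B g x - B g z\<bar> \<le> 2 * \<theta>1"
    then have "dia g S (2 * \<theta>1)" using u_AA[of g] HH' by (auto simp: AA_def)
    then have "\<bar>B g z - B g (h * q)\<bar> \<le> 2 * \<theta>1" if "z \<in> S" for z
      using that HS[OF CH_base(3,4)] by (auto simp: dia_def)
    then show "\<bar>B g x - B g (h * q)\<bar> \<le> 6 * \<theta>1" using g(2) theta1 by fastforce
  qed (use CH_base in auto)
next
  case (CH_step g2 n g' e)
  show ?case
  proof (rule chain_step)
    fix g x assume "u g \<notin> H'" "\<exists>z\<in>S. \<bar>B g x - B g z\<bar> \<le> 2 * \<theta>1"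
      "\<And>g'. CH g' e \<Longrightarrow> \<not> sim g2 g' \<Longrightarrow> \<exists>z\<in>S. \<bar>B g' x - B g' z\<bar> \<le> 2 * \<theta>1"
    then show "\<bar>B g x - B g (e * q)\<bar> \<le> 6 * \<theta>1"
      using CH_step.IH[OF CH_step.prems(1)] CH_step.hyps(3,4) by blast
  qed (use CH_step in auto)
qed

definition S' where "S' = {e * q |e q. e \<in> H' \<and> q \<in> S}"

text \<open>Translation by an element of \<open>H'\<close> puts one of the two points into
  \<open>S\<close>, and the other is then the end of a chain.\<close>

lemma dia_S': assumes g: "u g \<notin> H'" shows "dia g S' (6 * \<theta>1)"
  unfolding dia_def
proof (intro ballI)
  fix x y assume "x \<in> S'" "y \<in> S'"
  then obtain e1 q1 e2 q2 where e: "x = e1 * q1" "y = e2 * q2" "e1 \<in> H'" "e2 \<in> H'" and q: "q1 \<in> S" "q2 \<in> S"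
    by (auto simp: S'_def)
  define e where "e = inverse e1 * e2"
  have eH: "e \<in> H'" unfolding e_def using e subgrp_H' by (simp add: subgrp_mult subgrp_inv)
  define h where "h = inverse e1 * g"
  have uh: "u h \<notin> H'" using g u_left_H'[of "inverse e1" g] e subgrp_H' by (simp add: h_def subgrp_inv)
  have "\<bar>B h q1 - B h (e * q2)\<bar> \<le> 6 * \<theta>1"
  proof (cases "e \<in> H")
    case True
    have "dia h S (2 * \<theta>1)" using uh u_AA[of h] HH' by (auto simp: AA_def)
    then have "\<bar>B h q1 - B h (e * q2)\<bar> \<le> 2 * \<theta>1" using q HS[OF True] by (auto simp: dia_def)
    then show ?thesis using theta1 by linarith
  next
    case False
    then obtain g2 where "CH g2 e" using ok_H'[OF eH] by (auto simp: ok_def)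
    from chain_dia[OF this q(2) uh, of q1] show ?thesis using q(1) theta1 by force
  qed
  moreover have "B h q1 = B g x" "B h (e * q2) = B g y"
    by (simp_all add: B_def h_def e_def e mgs)
  ultimately show "\<bar>B g x - B g y\<bar> \<le> 6 * \<theta>1" by simp
qed

lemma green_H':
  assumes "e \<in> H'" "q \<in> S" shows "e \<in> H \<or> (\<exists>g. N - 10 * \<theta>1 \<le> \<bar>B g (e * q) - B g q\<bar>)"
  using ok_H'[OF assms(1)] chain_big[OF _ assms(2,2)] unfolding ok_def by blast

end

section \<open>Exhaustion of the group by windmills, and the kernel\<close>

context wind
begin

text \<open>The invariant of the iteration; the last clause carries the displacement from
  \<open>green_H'\<close> along for one fixed point \<open>x0\<close>.\<close>

definition good :: "'a \<Rightarrow> 'a set \<Rightarrow> 'a set \<Rightarrow> bool" where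
  "good x0 H S \<longleftrightarrow> subgrp H \<and> K \<subseteq> H \<and> (\<forall>h\<in>H. \<forall>p\<in>S. h * p \<in> S) \<and> (\<forall>g. u g \<in> H \<or> dia g S (6 * \<theta>1)) \<and>
     x0 \<in> S \<and> (\<forall>h\<in>H. h \<in> K \<or> (\<exists>g. N - 10 * \<theta>1 \<le> \<bar>B g (h * x0) - B g x0\<bar>))"

lemma good_step:
  assumes "good x0 H S"
  shows "\<exists>H' S'. good x0 H' S' \<and> H \<subseteq> H' \<and> (\<forall>p q. q \<in> S \<longrightarrow> d p q \<le> 1 \<longrightarrow> p \<in> S')"
proof -
  define P where "P = {p. \<exists>q\<in>S. d p q \<le> 1}"
  have g: "subgrp H" "K \<subseteq> H" "\<And>h p. h\<in>H \<Longrightarrow> p\<in>S \<Longrightarrow> h * p \<in> S" "\<And>g. u g \<notin> H \<Longrightarrow> dia g S (6 * \<theta>1)"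
    "x0 \<in> S" "\<And>h. h \<in> H \<Longrightarrow> h \<in> K \<or> (\<exists>g. N - 10 * \<theta>1 \<le> \<bar>B g (h * x0) - B g x0\<bar>)"
    using assms unfolding good_def by blast+
  interpret m: windmill \<nu> \<delta> w \<kappa> N0 \<theta> N H P
  proof
    show "subgrp H" "K \<subseteq> H" by (fact g)+
    show "h * p \<in> P" if "h \<in> H" "p \<in> P" for h p
    proof -
      obtain q where q: "q \<in> S" "d p q \<le> 1" using \<open>p \<in> P\<close> by (auto simp: P_def)
      have "h * q \<in> S" "d (h * p) (h * q) \<le> 1" using g(3) that q by auto
      then show ?thesis unfolding P_def by blast
    qed
    show "dia g P (8 * \<theta>1)" if "u g \<notin> H" for g
      unfolding dia_def
    proof (intro ballI)
      fix x y assume "x \<in> P" "y \<in> P"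
      then obtain x' y' where xy: "x' \<in> S" "y' \<in> S" "d x x' \<le> 1" "d y y' \<le> 1" by (auto simp: P_def)
      then have "\<bar>B g x' - B g y'\<bar> \<le> 6 * \<theta>1" using g(4)[OF that] by (auto simp: dia_def)
      then show "\<bar>B g x - B g y\<bar> \<le> 8 * \<theta>1"
        using B_Lip1[OF xy(3), of g] B_Lip1[OF xy(4), of g] theta1 by linarith
    qed
  qed
  have PS: "P \<subseteq> m.S'" using subgrp_one[OF m.subgrp_H'] unfolding m.S'_def by force
  have x0: "x0 \<in> P" using g(5) unfolding P_def by force
  have "good x0 m.H' m.S'"
    unfolding good_def
  proof (intro conjI ballI allI)
    show "subgrp m.H'" by (rule m.subgrp_H')
    show "K \<subseteq> m.H'" using g(2) m.HH' by blast
    show "h * p \<in> m.S'" if hp: "h \<in> m.H'" "p \<in> m.S'" for h p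
    proof -
      obtain e q where e: "p = e * q" "e \<in> m.H'" "q \<in> P" using hp(2) unfolding m.S'_def by blast
      have "h * p = (h * e) * q" by (simp add: e mult.assoc)
      then show ?thesis unfolding m.S'_def using e hp(1) subgrp_mult[OF m.subgrp_H'] by blast
    qed
    show "u g \<in> m.H' \<or> dia g m.S' (6 * \<theta>1)" for g using m.dia_S' by blast
    show "x0 \<in> m.S'" using x0 PS by blast
    show "h \<in> K \<or> (\<exists>g. N - 10 * \<theta>1 \<le> \<bar>B g (h * x0) - B g x0\<bar>)" if "h \<in> m.H'" for h
      using m.green_H'[OF that x0] g(6) by blast
  qed
  moreover have "\<forall>p q. q \<in> S \<longrightarrow> d p q \<le> 1 \<longrightarrow> p \<in> m.S'" using PS by (auto simp: P_def)
  ultimately show ?thesis using m.HH' by blast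
qed

lemma good_ball: "\<exists>Hs Ss. \<forall>n. good x0 (Hs n) (Ss n) \<and> Hs n \<subseteq> Hs (Suc n) \<and> {p. d p x0 \<le> real n} \<subseteq> Ss n"
proof -
  define S0 where "S0 = {p. d p x0 = 0}"
  have B0: "B g x = B g y" if "x \<in> S0" "y \<in> S0" for g x y
    using that B_cong[of x x0 g] B_cong[of y x0 g] by (simp add: S0_def)
  have g0: "good x0 K S0"
    unfolding good_def
  proof (intro conjI ballI allI)
    show "subgrp K" by (rule subgrp_K)
    show "h * p \<in> S0" if "h \<in> K" "p \<in> S0" for h p
      using that d_K_left[of h p x0] by (simp add: S0_def del: d_K0)
    have "0 \<le> 6 * \<theta>1" using theta1 by linarith
    then have "dia g S0 (6 * \<theta>1)" for g using B0 unfolding dia_def by (metis abs_zero diff_self)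
    then show "u g \<in> K \<or> dia g S0 (6 * \<theta>1)" for g by blast
    show "x0 \<in> S0" unfolding S0_def by (simp only: mem_Collect_eq d_refl)
  qed auto
  define ex where "ex p p' \<longleftrightarrow> good x0 (fst p') (snd p') \<and> fst p \<subseteq> fst p' \<and> (\<forall>x y. y \<in> snd p \<longrightarrow> d x y \<le> 1 \<longrightarrow> x \<in> snd p')" for p p'
  obtain f where f: "f 0 = (K, S0)" "\<And>n. good x0 (fst (f n)) (snd (f n)) \<and> ex (f n) (f (Suc n))"
  proof -
    have "\<exists>f. \<forall>n. (good x0 (fst (f n)) (snd (f n)) \<and> (n = 0 \<longrightarrow> f n = (K,S0))) \<and> ex (f n) (f (Suc n))"
    proof (rule dependent_nat_choice)
      show "\<exists>x. good x0 (fst x) (snd x) \<and> (0 = 0 \<longrightarrow> x = (K, S0))" using g0 by auto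
    next
      fix x n assume "good x0 (fst x) (snd x) \<and> ((n::nat) = 0 \<longrightarrow> x = (K, S0))"
      then obtain H' S' where "good x0 H' S' \<and> fst x \<subseteq> H' \<and> (\<forall>p q. q \<in> snd x \<longrightarrow> d p q \<le> 1 \<longrightarrow> p \<in> S')"
        using good_step by blast
      then show "\<exists>y. (good x0 (fst y) (snd y) \<and> (Suc n = 0 \<longrightarrow> y = (K, S0))) \<and> ex x y"
        unfolding ex_def by (intro exI[of _ "(H', S')"]) simp
    qed
    then show ?thesis using that by blast
  qed
  have ball: "d p x0 \<le> real n \<Longrightarrow> p \<in> snd (f n)" for n p
  proof (induction n arbitrary: p)
    case 0
    then have "d p x0 = 0" using d_nonneg[of p x0] by linarith
    then show ?case by (simp add: f S0_def del: d_K0)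
  next
    case (Suc n)
    define t where "t = max 0 (d x0 p - 1)"
    obtain m where m: "d x0 p = real m" using d_Ints by blast
    have "t = real (m - 1)" by (cases m) (auto simp: t_def m)
    then have "t \<in> \<nat>" by simp
    moreover have "0 \<le> t" "t \<le> d x0 p" using d_nonneg[of x0 p] unfolding t_def by linarith+
    ultimately obtain q where q: "q \<in> I x0 p" "d x0 q = t" using geod_point by blast
    have "d q x0 \<le> real n" using q(2) Suc.prems d_sym[of p x0] d_sym[of q x0] unfolding t_def by simp
    then have "q \<in> snd (f n)" by (rule Suc.IH)
    moreover have "d p q \<le> 1" using q d_sym[of p q] unfolding I_iff t_def by linarith
    ultimately show ?case using f(2)[of n] unfolding ex_def by blast
  qed
  show ?thesis
    by (rule exI[of _ "fst \<circ> f"], rule exI[of _ "snd \<circ> f"]) (use f(2) ball in \<open>auto simp: ex_def\<close>)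
qed

definition K' :: "'a set" where "K' = gen (K \<union> range u)"

lemma subgrp_K': "subgrp K'" by (simp add: K'_def subgrp_gen)
lemma K_K': "K \<subseteq> K'" unfolding K'_def using gen_incl by blast
lemma u_K': "u g \<in> K'" unfolding K'_def by (rule gen_incl) blast

lemma K'_conj: "k \<in> K' \<Longrightarrow> g * k * inverse g \<in> K'"
  unfolding K'_def
proof (rule gen_conj)
  fix s g assume "s \<in> K \<union> range u"
  then show "g * s * inverse g \<in> K \<union> range u" using K_conj[of s g] by (auto simp flip: u_conj)
qed

text \<open>An analogue of Greendlinger's lemma: a nontrivial element of the kernel moves every point
  by almost a full rotation along some line.\<close>

theorem greendlinger:
  assumes "k \<in> K'" "k \<notin> K"
  obtains g where "N - 10 * \<theta>1 \<le> \<bar>B g (k * x0) - B g x0\<bar>"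
proof -
  obtain Hs Ss where hs: "\<And>n. good x0 (Hs n) (Ss n)" "\<And>n. Hs n \<subseteq> Hs (Suc n)" "\<And>n p. d p x0 \<le> real n \<Longrightarrow> p \<in> Ss n"
    using good_ball[of x0] by blast
  have mono: "m \<le> n \<Longrightarrow> Hs m \<subseteq> Hs n" for m n using hs(2) by (rule lift_Suc_mono_le)
  have sg: "subgrp (Hs n)" and Kn: "K \<subseteq> Hs n" for n using hs(1)[of n] by (auto simp: good_def)
  have un: "\<exists>n. u g \<in> Hs n" for g
  proof -
    \<comment> \<open>Eventually \<open>Ss n\<close> contains two points of the line
      \<open>g\<close> whose projections to it differ by more than \<open>6 * \<theta>1\<close>; the
      invariant then forces \<open>u g\<close> into \<open>Hs n\<close>.\<close>
    define L where "L = 6 * \<theta>1 + 1"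
    obtain n where n: "max (d g x0) (d (g * W L) x0) \<le> real n" using real_arch_simple by blast
    have "g \<in> Ss n" "g * W L \<in> Ss n" using hs(3) n by auto
    moreover have "B g g = b 1" using B_line[of g 0] by simp
    then have "\<bar>B g g - B g (g * W L)\<bar> = L" using theta1 by (simp add: B_line L_def)
    ultimately have "\<not> dia g (Ss n) (6 * \<theta>1)" unfolding dia_def L_def by fastforce
    then show ?thesis using hs(1)[of n] unfolding good_def by blast
  qed
  have in1: "\<exists>n. s \<in> Hs n" if "s \<in> K \<union> range u" for s using that un Kn by blast
  have "\<exists>n. k \<in> Hs n" using assms(1) unfolding K'_def
  proof (induction rule: gen.induct)
    case gen_one
    show ?case using subgrp_one[OF sg] by (intro exI[of _ 0])
  next
    case (gen_mult s x)
    then obtain m n where "s \<in> Hs m" "x \<in> Hs n" using in1 by blast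
    then have "s \<in> Hs (max m n)" "x \<in> Hs (max m n)" using mono[of m "max m n"] mono[of n "max m n"] by auto
    then show ?case using subgrp_mult[OF sg] by (intro exI[of _ "max m n"])
  next
    case (gen_inv s x)
    then obtain m n where "s \<in> Hs m" "x \<in> Hs n" using in1 by blast
    then have "s \<in> Hs (max m n)" "x \<in> Hs (max m n)" using mono[of m "max m n"] mono[of n "max m n"] by auto
    then show ?case using subgrp_mult[OF sg subgrp_inv[OF sg]] by (intro exI[of _ "max m n"])
  qed
  then show ?thesis using hs(1) assms(2) that unfolding good_def by blast
qed

end

section \<open>The quotient length and tame quadrilaterals\<close>

context wind
begin

definition \<nu>' :: "'a \<Rightarrow> nat" where "\<nu>' x = (LEAST n. \<exists>k\<in>K'. n = \<nu> (x * k))"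

lemma nu'_ex: "\<exists>k\<in>K'. \<nu>' x = \<nu> (x * k)"
  unfolding \<nu>'_def by (rule LeastI_ex) (use subgrp_one[OF subgrp_K'] in blast)

lemma nu'_le: "k \<in> K' \<Longrightarrow> \<nu>' x \<le> \<nu> (x * k)"
  unfolding \<nu>'_def by (rule Least_le) blast

lemma nu'_le_nu: "\<nu>' x \<le> \<nu> x"
  using nu'_le[OF subgrp_one[OF subgrp_K'], of x] by simp

lemma nu'_zero: "\<nu>' x = 0 \<longleftrightarrow> x \<in> K'"
proof
  assume "\<nu>' x = 0"
  then obtain k where k: "k \<in> K'" "\<nu> (x * k) = 0" using nu'_ex[of x] by auto
  then have "x * k \<in> K'" using K_K' by (auto simp: K_def)
  then have "(x * k) * inverse k \<in> K'" using k(1) subgrp_K' by (simp add: subgrp_mult subgrp_inv)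
  then show "x \<in> K'" by (simp add: mgs)
next
  assume "x \<in> K'"
  then show "\<nu>' x = 0" using nu'_le[of "inverse x" x] subgrp_K' by (simp add: subgrp_inv)
qed

lemma K'_conj': "k \<in> K' \<Longrightarrow> inverse g * k * g \<in> K'"
  using K'_conj[of k "inverse g"] by simp

lemma nu'_mult_K': assumes "k \<in> K'" shows "\<nu>' (x * k) = \<nu>' x" "\<nu>' (k * x) = \<nu>' x"
proof -
  have le: "\<nu>' (x * k) \<le> \<nu>' x" if k: "k \<in> K'" for x k
  proof -
    obtain k1 where k1: "k1 \<in> K'" "\<nu>' x = \<nu> (x * k1)" using nu'_ex by blast
    have "inverse k * k1 \<in> K'" using k k1 subgrp_K' by (simp add: subgrp_inv subgrp_mult)
    from nu'_le[OF this, of "x * k"] show ?thesis by (simp add: k1 mgs)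
  qed
  show 1: "\<nu>' (x * k) = \<nu>' x" for x
    using le[of k x] le[of "inverse k" "x * k"] assms subgrp_K' by (simp add: subgrp_inv mgs)
  have ck: "inverse x * k * x \<in> K'" using K'_conj'[OF assms] .
  have "\<nu>' (x * (inverse x * k * x)) \<le> \<nu>' x" by (rule le[OF ck])
  moreover have "\<nu>' ((x * (inverse x * k * x)) * inverse (inverse x * k * x)) \<le> \<nu>' (x * (inverse x * k * x))"
    by (rule le) (rule subgrp_inv[OF subgrp_K' ck])
  ultimately show "\<nu>' (k * x) = \<nu>' x" by (simp add: mgs)
qed

lemma gnorm': "gnorm \<nu>'"
proof
  have inv: "\<nu>' (inverse x) \<le> \<nu>' x" for x
  proof -
    obtain k where k: "k \<in> K'" "\<nu>' x = \<nu> (x * k)" using nu'_ex by blast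
    have "\<nu>' (inverse x) = \<nu>' (inverse k * inverse x)" using nu'_mult_K'(2) k(1) subgrp_K' by (simp add: subgrp_inv)
    also have "\<dots> \<le> \<nu> (inverse (x * k))" using nu'_le_nu by (simp add: mg_inv_mult)
    finally show ?thesis by (simp add: k)
  qed
  show "\<nu>' (inverse x) = \<nu>' x" for x using inv[of x] inv[of "inverse x"] by simp
  show mult: "\<nu>' (x * y) \<le> \<nu>' x + \<nu>' y" for x y
  proof -
    obtain k l where k: "k \<in> K'" "\<nu>' x = \<nu> (x * k)" and l: "l \<in> K'" "\<nu>' y = \<nu> (y * l)" using nu'_ex by blast
    have "inverse y * k * y * l \<in> K'" using K'_conj'[OF k(1)] l subgrp_K' by (simp add: subgrp_mult)
    from nu'_le[OF this, of "x * y"] have "\<nu>' (x * y) \<le> \<nu> ((x * k) * (y * l))" by (simp add: mgs)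
    then show ?thesis using nu_mult[of "x * k" "y * l"] k l by linarith
  qed
  show "\<nu>' 1 = 0" by (simp add: nu'_zero subgrp_one[OF subgrp_K'])
  show "\<nu>' (g * k * inverse g) = 0" if "\<nu>' k = 0" for g k using that K'_conj by (simp add: nu'_zero)
  show "\<exists>y. \<nu>' y = m \<and> \<nu>' (inverse y * x) = \<nu>' x - m" if m: "m \<le> \<nu>' x" for m x
  proof -
    obtain k where k: "k \<in> K'" "\<nu>' x = \<nu> (x * k)" using nu'_ex by blast
    obtain y where y: "\<nu> y = m" "\<nu> (inverse y * (x * k)) = \<nu> (x * k) - m"
      using nu_geod[of m "x * k"] m k by auto
    have 1: "\<nu>' y \<le> m" using nu'_le_nu[of y] y by simp
    have 2: "\<nu>' (inverse y * x) \<le> \<nu>' x - m" using nu'_le[OF k(1), of "inverse y * x"] y k by (simp add: mgs)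
    have "\<nu>' x \<le> \<nu>' y + \<nu>' (inverse y * x)" using mult[of y "inverse y * x"] by simp
    then show ?thesis using 1 2 m by (intro exI[of _ y]) linarith
  qed
qed

text \<open>A kernel element outside \<open>K\<close> moves the projection of \<open>1\<close> to
  some line by nearly \<open>N\<close>, whereas length at most two allows a move of at most
  seven.\<close>

lemma ball2_inj:
  assumes "\<nu> x \<le> 2" "\<nu>' x = 0" shows "\<nu> x = 0"
proof (rule ccontr)
  assume "\<nu> x \<noteq> 0"
  then have "x \<notin> K" "x \<in> K'" using assms(2) by (auto simp: K_def nu'_zero)
  then obtain g where g: "N - 10 * \<theta>1 \<le> \<bar>B g (x * 1) - B g 1\<bar>" using greendlinger by metis
  have "d x 1 \<le> real_of_int 2 * a" using assms(1) a1 by (simp add: d_one)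
  from B_Lipi[OF this, of g] g show False using N_theta1 theta1 by simp
qed

interpretation q: gnorm \<nu>' by (rule gnorm')

abbreviation "d' \<equiv> q.d"

lemma d'_le: "k \<in> K' \<Longrightarrow> d' x y \<le> d x (k * y)" "d' x y \<le> d x y"
proof -
  show "d' x y \<le> d x y" for x y using nu'_le_nu by (simp add: q.d_def d_def)
  assume k: "k \<in> K'"
  have "inverse x * (k * y) = (inverse x * k * x) * (inverse x * y)" by (simp add: mgs)
  then show "d' x y \<le> d x (k * y)"
    using nu'_le_nu[of "inverse x * (k * y)"] nu'_mult_K'(2)[OF K'_conj'[OF k, of x], of "inverse x * y"]
    by (simp add: q.d_def d_def)
qed

lemma d'_ex: "\<exists>k\<in>K'. d' x y = d x (k * y)"
proof -
  obtain k where k: "k \<in> K'" "\<nu>' (inverse x * y) = \<nu> (inverse x * y * k)" using nu'_ex by blast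
  have "inverse x * y * k = inverse x * ((y * k * inverse y) * y)" by (simp add: mgs)
  then show ?thesis using K'_conj[OF k(1), of y] k(2) unfolding d_def q.d_def by metis
qed

lemma d'_K': "k \<in> K' \<Longrightarrow> d' (k * x) y = d' x y" "k \<in> K' \<Longrightarrow> d' x (k * y) = d' x y"
  using q.d_K_left q.d_K_right nu'_zero by (auto simp: q.K_def)

section \<open>Tame segments, crossings and cut corners\<close>

definition tame :: "'a \<Rightarrow> 'a \<Rightarrow> bool" where
  "tame x y \<longleftrightarrow> (\<forall>p\<in>I x y. \<forall>r\<in>I x y. \<forall>g. 2 * \<bar>B g p - B g r\<bar> \<le> N + 40 * \<theta>1)"

lemma tame_left: "tame x y \<Longrightarrow> tame (f * x) (f * y)"
  unfolding tame_def
proof (intro ballI allI)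
  fix p r g assume t: "\<forall>p\<in>I x y. \<forall>r\<in>I x y. \<forall>g. 2 * \<bar>B g p - B g r\<bar> \<le> N + 40 * \<theta>1"
    and pr: "p \<in> I (f * x) (f * y)" "r \<in> I (f * x) (f * y)"
  have "inverse f * p \<in> I x y" "inverse f * r \<in> I x y"
    using pr I_left_iff[of f "inverse f * p" x y] I_left_iff[of f "inverse f * r" x y] by simp_all
  then have "2 * \<bar>B (inverse f * g) (inverse f * p) - B (inverse f * g) (inverse f * r)\<bar> \<le> N + 40 * \<theta>1" using t by blast
  then show "2 * \<bar>B g p - B g r\<bar> \<le> N + 40 * \<theta>1" unfolding B_left .
qed

lemma tame_sym: "tame x y \<Longrightarrow> tame y x"
  unfolding tame_def using I_sym by blast

text \<open>The margin from 37 to 40 pays for the errors of \<open>B_mono\<close>; 37 is what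
  \<open>axis_step_bound\<close> delivers for powers.\<close>

lemma tame_ends:
  assumes "\<And>g. 2 * \<bar>B g x - B g y\<bar> \<le> N + 37 * \<theta>1"
  shows "tame x y"
  unfolding tame_def
proof (intro ballI allI)
  fix p r g assume "p \<in> I x y" "r \<in> I x y"
  from B_mono[OF this(1), of g] B_mono[OF this(2), of g]
  have "\<bar>B g p - B g r\<bar> \<le> \<bar>B g x - B g y\<bar> + 12" by linarith
  moreover have "2 * v \<le> N + 37 * \<theta>1 \<Longrightarrow> u \<le> v + 12 \<Longrightarrow> 2 * u \<le> N + 40 * \<theta>1" for u v using theta1 by linarith
  ultimately show "2 * \<bar>B g p - B g r\<bar> \<le> N + 40 * \<theta>1" using assms[of g] by blast
qed

lemma u_dist: "dist g (zpow (u g) n * x) = dist g x"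
proof -
  have "D (W i * y) = D y" for i y
    by (simp add: D_def b_shift add.commute[of "b y"] zpow_add)
  then show ?thesis by (simp add: dist_D zpow_u mgs)
qed

text \<open>If the crossing exceeded half of \<open>N\<close> by more, rotating \<open>y\<close>
  back by one turn would shorten the segment.\<close>

lemma short_tame:
  assumes "\<And>k. k \<in> K' \<Longrightarrow> d x y \<le> d x (k * y)"
  shows "2 * \<bar>B g x - B g y\<bar> \<le> N + 6"
proof (rule ccontr)
  assume c: "\<not> ?thesis"
  define e where "e = (if B g x \<le> B g y then 1 else - 1 :: int)"
  define y' where "y' = zpow (u g) (- e) * y"
  have "zpow (u g) (- e) \<in> K'" by (rule subgrp_zpow[OF subgrp_K' u_K'])
  then have le: "d x y \<le> d x y'" unfolding y'_def by (rule assms)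
  have By: "B g y' = B g y - N * e" by (simp add: y'_def u_shift)
  have 1: "dist g x + A (B g x - B g y) + dist g y \<le> d x y + 5 * a"
    by (rule line_lower) (use c N_theta1 theta1 in \<open>smt (verit)\<close>)
  have 2: "d x y' \<le> dist g x + A (B g x - B g y') + dist g y"
    using line_upper[of x y' g] by (simp add: y'_def u_dist)
  have 3: "6 \<le> \<bar>B g x - B g y\<bar> - \<bar>B g x - B g y'\<bar>"
  proof (cases "B g x \<le> B g y")
    case True
    then have "B g y' = B g y - N" by (simp add: By e_def)
    then show ?thesis using c N_theta1 theta1 True by (smt (verit))
  next
    case False
    then have "B g y' = B g y + N" by (simp add: By e_def)
    then show ?thesis using c N_theta1 theta1 False by (smt (verit))
  qed
  have "A (\<bar>B g x - B g y\<bar> - \<bar>B g x - B g y'\<bar>) \<le> A (B g x - B g y) - A (B g x - B g y') + \<kappa>"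
    by (rule A_diff) (use 3 in linarith)
  moreover have "real_of_int 6 * 99 * a \<le> 100 * A (\<bar>B g x - B g y\<bar> - \<bar>B g x - B g y'\<bar>)"
    by (rule A_ge) (use 3 in linarith)
  ultimately show False using le 1 2 kappa_a a1 by simp
qed

lemma short_tame': "d x y \<le> d' x y \<Longrightarrow> tame x y"
proof (rule tame_ends)
  fix g assume "d x y \<le> d' x y"
  then have "d x y \<le> d x (k * y)" if "k \<in> K'" for k using d'_le(1)[OF that, of x y] by linarith
  from short_tame[OF this, of g] show "2 * \<bar>B g x - B g y\<bar> \<le> N + 37 * \<theta>1" using theta1 by linarith
qed

text \<open>As any translate by \<open>K'\<close> is allowed, this is a relation between the images
  of the segment and the line in the quotient.\<close>

definition cross :: "int \<Rightarrow> 'a \<Rightarrow> 'a \<Rightarrow> 'a \<Rightarrow> bool" where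
  "cross c P Q g \<longleftrightarrow> (\<exists>\<eta>\<in>K'. c \<le> \<bar>B g (\<eta> * P) - B g (\<eta> * Q)\<bar>)"

lemma cross_left: assumes "v \<in> K'" "cross c P Q g" shows "cross c P Q (v * g)"
proof -
  obtain \<eta> where k: "\<eta> \<in> K'" "c \<le> \<bar>B g (\<eta> * P) - B g (\<eta> * Q)\<bar>" using assms(2) by (auto simp: cross_def)
  have "v * \<eta> \<in> K'" using assms(1) k(1) subgrp_K' by (simp add: subgrp_mult)
  moreover have "c \<le> \<bar>B (v * g) (v * \<eta> * P) - B (v * g) (v * \<eta> * Q)\<bar>" using k(2) by (simp add: mult.assoc)
  ultimately show ?thesis unfolding cross_def by blast
qed

lemma cross_sim: assumes "cross (10 * \<theta>1) P Q g" "sim g h" shows "cross (5 * \<theta>1) P Q h"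
proof -
  obtain \<eta> where k: "\<eta> \<in> K'" "10 * \<theta>1 \<le> \<bar>B g (\<eta> * P) - B g (\<eta> * Q)\<bar>" using assms(1) by (auto simp: cross_def)
  have "5 * \<theta>1 \<le> \<bar>B h (\<eta> * P) - B h (\<eta> * Q)\<bar>"
    using sim_compare[OF sim_sym[OF assms(2)], of "\<eta> * P" "\<eta> * Q"] k(2) theta1 by linarith
  then show ?thesis using k(1) by (auto simp: cross_def)
qed

lemma cross_mono: "cross c P Q g \<Longrightarrow> c' \<le> c \<Longrightarrow> cross c' P Q g"
  unfolding cross_def using order_trans by blast

text \<open>The element \<open>\<eta>\<close> records how rotations have displaced a piece, so that
  it can be carried back to its place in the original side.\<close>

definition sub :: "'a \<Rightarrow> 'a \<Rightarrow> 'a \<Rightarrow> 'a \<Rightarrow> 'a \<Rightarrow> bool" where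
  "sub P Q \<eta> z y \<longleftrightarrow> \<eta> \<in> K' \<and> \<eta> * z \<in> I P Q \<and> \<eta> * y \<in> I (\<eta> * z) Q"

lemma sub_sub:
  assumes "sub P Q \<eta> z y" "z' \<in> I z y" "y' \<in> I z' y"
  shows "sub P Q \<eta> z' y'" "d P (\<eta> * z') = d P (\<eta> * z) + d z z'" "d (\<eta> * y') Q = d (\<eta> * y) Q + d y' y"
proof -
  have s: "\<eta> \<in> K'" "\<eta> * z \<in> I P Q" "\<eta> * y \<in> I (\<eta> * z) Q" using assms by (auto simp: sub_def)
  have z': "\<eta> * z' \<in> I (\<eta> * z) (\<eta> * y)" using assms(2) by (rule I_left)
  have y': "\<eta> * y' \<in> I (\<eta> * z') (\<eta> * y)" using assms(3) by (rule I_left)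
  note 1 = I_sub[OF s(3) z'] and 2 = I_sub2[OF s(2) I_sub(1)[OF s(3) z']]
  note 3 = I_sub[OF 1(2) y']
  show "sub P Q \<eta> z' y'" using s 2(1) 3(1) by (simp add: sub_def)
  show "d P (\<eta> * z') = d P (\<eta> * z) + d z z'" using 2(2) by (simp add: I_iff)
  show "d (\<eta> * y') Q = d (\<eta> * y) Q + d y' y" using 3(2) by (simp add: I_iff)
qed

lemma sub_left:
  assumes "sub P Q \<eta> z y" "v \<in> K'" shows "sub P Q (\<eta> * inverse v) (v * z) (v * y)"
  using assms subgrp_K' unfolding sub_def by (simp add: mgs subgrp_mult subgrp_inv)

lemma sub_tame:
  assumes "sub P Q \<eta> z y" "tame P Q" shows "2 * \<bar>B g z - B g y\<bar> \<le> N + 40 * \<theta>1"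
proof -
  have "\<eta> * z \<in> I P Q" "\<eta> * y \<in> I P Q" using assms(1) I_sub2(1) by (auto simp: sub_def)
  then have "2 * \<bar>B (\<eta> * g) (\<eta> * z) - B (\<eta> * g) (\<eta> * y)\<bar> \<le> N + 40 * \<theta>1" using assms(2) unfolding tame_def by blast
  then show ?thesis unfolding B_left .
qed

lemma sub_cross:
  assumes "sub P Q \<eta> z y" "12 * \<theta>1 \<le> \<bar>B g z - B g y\<bar>" shows "cross (10 * \<theta>1) P Q g"
proof -
  have k: "\<eta> \<in> K'" "\<eta> * z \<in> I P Q" "\<eta> * y \<in> I P Q" using assms(1) I_sub2(1) by (auto simp: sub_def)
  have "12 * \<theta>1 \<le> \<bar>B (\<eta> * g) (\<eta> * z) - B (\<eta> * g) (\<eta> * y)\<bar>" using assms(2) by simp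
  then have "10 * \<theta>1 \<le> \<bar>B (\<eta> * g) P - B (\<eta> * g) Q\<bar>"
    using B_mono[OF k(2), of "\<eta> * g"] B_mono[OF k(3), of "\<eta> * g"] theta1 by linarith
  moreover have "B (\<eta> * g) P = B g (inverse \<eta> * P)" "B (\<eta> * g) Q = B g (inverse \<eta> * Q)"
    by (simp_all add: B_def mgs)
  ultimately show ?thesis unfolding cross_def using subgrp_inv[OF subgrp_K' k(1)] by metis
qed

text \<open>The offset \<open>43 * \<theta>1\<close> left by a rotation plus \<open>12 * a\<close>
  for the two cut points, with \<open>10 * a \<le> \<theta>1 * a\<close>.\<close>

definition \<gamma> :: real where "\<gamma> = 45 * real_of_int \<theta>1 * a"

text \<open>The bounds 30 say that neither piece at the corner runs along \<open>g\<close> any more.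
  If an equivalent line is met again, the crossing must come from the two other sides.\<close>

definition own :: "'a \<Rightarrow> 'a \<Rightarrow> 'a \<Rightarrow> 'a \<Rightarrow> 'a \<Rightarrow> bool" where
  "own g z y z' y' \<longleftrightarrow> dist g y \<le> 6 * a \<and> dist g z' \<le> 6 * a \<and> d y z' \<le> \<gamma> \<and>
     (\<forall>p\<in>I z y. \<forall>r\<in>I z y. \<bar>B g p - B g r\<bar> \<le> 30) \<and> (\<forall>p\<in>I z' y'. \<forall>r\<in>I z' y'. \<bar>B g p - B g r\<bar> \<le> 30)"

definition gap :: "'a \<Rightarrow> 'a \<Rightarrow> 'a \<Rightarrow> 'a \<Rightarrow> 'a \<Rightarrow> 'a \<Rightarrow> 'a \<Rightarrow> 'a \<Rightarrow> bool" where
  "gap P Q P' Q' z y z' y' \<longleftrightarrow> d y z' = 0 \<or>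
     (\<exists>g. own g z y z' y' \<and> cross (10 * \<theta>1) P Q g \<and> cross (10 * \<theta>1) P' Q' g)"

lemma gap_shrink:
  assumes "gap P Q P' Q' z y z' y'" "z1 \<in> I z y" "y1 \<in> I z' y'"
  shows "gap P Q P' Q' z1 y z' y1"
proof -
  have "I z1 y \<subseteq> I z y" using I_sub2(1)[OF assms(2)] by blast
  moreover have "I z' y1 \<subseteq> I z' y'" using I_sub(1)[OF assms(3)] by blast
  ultimately show ?thesis using assms(1) unfolding gap_def own_def by (meson subsetD)
qed

lemma dist_left [simp]: "dist (v * g) (v * x) = dist g x"
  by (simp add: dist_D mgs)

lemma own_left: assumes "own g z y z' y'" shows "own (v * g) (v * z) (v * y) (v * z') (v * y')"
proof -
  have *: "\<forall>p\<in>I (v * x) (v * x'). \<forall>r\<in>I (v * x) (v * x'). \<bar>B (v * g) p - B (v * g) r\<bar> \<le> 30"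
    if h: "\<forall>p\<in>I x x'. \<forall>r\<in>I x x'. \<bar>B g p - B g r\<bar> \<le> 30" for x x'
  proof (intro ballI)
    fix p r assume pr: "p \<in> I (v * x) (v * x')" "r \<in> I (v * x) (v * x')"
    have "inverse v * p \<in> I x x'" "inverse v * r \<in> I x x'"
      using pr I_left_iff[of v "inverse v * p" x x'] I_left_iff[of v "inverse v * r" x x'] by simp_all
    then have "\<bar>B g (inverse v * p) - B g (inverse v * r)\<bar> \<le> 30" using h by blast
    then have "\<bar>B (v * g) (v * (inverse v * p)) - B (v * g) (v * (inverse v * r))\<bar> \<le> 30" unfolding B_left .
    then show "\<bar>B (v * g) p - B (v * g) r\<bar> \<le> 30" by simp
  qed
  show ?thesis using assms *[of z y] *[of z' y'] unfolding own_def d_left dist_left by blast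
qed

lemma gap_left: "gap P Q P' Q' z y z' y' \<Longrightarrow> v \<in> K' \<Longrightarrow> gap P Q P' Q' (v * z) (v * y) (v * z') (v * y')"
  unfolding gap_def d_left using own_left cross_left by blast

lemma gap_d: "gap P Q P' Q' z y z' y' \<Longrightarrow> d y z' \<le> \<gamma>"
  unfolding gap_def own_def \<gamma>_def using a1 theta1 by (auto simp del: d_K0)

lemma gap_lip: assumes "gap P Q P' Q' z y z' y'" shows "\<bar>B g y - B g z'\<bar> \<le> 50 * \<theta>1"
proof -
  have "d y z' \<le> real_of_int (45 * \<theta>1) * a" using gap_d[OF assms] by (simp add: \<gamma>_def)
  note b = B_Lipi[OF this, of g]
  have "100 * (45 * \<theta>1 + 5) \<le> 99 * (50 * \<theta>1)" using theta1 by simp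
  from order_trans[OF b this] have "99 * \<bar>B g y - B g z'\<bar> \<le> 99 * (50 * \<theta>1)" .
  then show ?thesis by simp
qed

text \<open>Both ends of the gap are close to the line \<open>h\<close>, whose projection to an
  inequivalent line is bounded.\<close>

lemma gap_foreign:
  assumes "own h z y z' y'" "\<not> sim g h" shows "\<bar>B g y - B g z'\<bar> \<le> 3 * \<theta>1"
proof -
  have *: "\<bar>B g x - B g (near h x)\<bar> \<le> 11" if "dist h x \<le> 6 * a" for x
    using B_Lipi[of x "near h x" 6 g] that unfolding dist_def by simp
  have "\<bar>B g (near h y) - B g (near h z')\<bar> \<le> \<theta>" unfolding near_def by (rule proj_bounded[OF assms(2)])
  moreover have "\<bar>B g y - B g (near h y)\<bar> \<le> 11" "\<bar>B g z' - B g (near h z')\<bar> \<le> 11"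
    using * assms(1) unfolding own_def by blast+
  ultimately show ?thesis using theta0 \<theta>1_def by (smt (verit))
qed

text \<open>The cut is made where the geodesic from \<open>z\<close> meets the line; up to that
  point the projection to \<open>g\<close> hardly moves.\<close>

lemma cut_side:
  assumes "7 \<le> \<bar>B g z - B g y\<bar>"
  obtains p where "p \<in> I z y" "d z p = dist g z" "d p (near g z) \<le> 6 * a" "dist g p \<le> 6 * a"
    "\<forall>q\<in>I z p. \<forall>r\<in>I z p. \<bar>B g q - B g r\<bar> \<le> 30"
proof -
  have "dist g z \<in> \<nat>" "0 \<le> dist g z" by (simp_all add: dist_def)
  moreover have "dist g z \<le> d z y" by (rule dist_le_d) (use assms in linarith)
  ultimately obtain p where p: "p \<in> I z y" "d z p = dist g z" using geod_point by blast
  have n: "d p (near g z) \<le> 6 * a" by (rule near_line[OF _ p]) (use assms in linarith)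
  then have "dist g p \<le> 6 * a" using dist_le[of g p "B g z"] by (simp add: near_def)
  moreover have "\<forall>q\<in>I z p. \<forall>r\<in>I z p. \<bar>B g q - B g r\<bar> \<le> 30"
  proof (intro ballI)
    have "B g (near g z) = b 1 + B g z" unfolding near_def by (rule B_line)
    moreover have "\<bar>B g p - B g (near g z)\<bar> \<le> 11"
      using B_Lipi[of p "near g z" 6 g] n by simp
    moreover have "\<bar>b 1\<bar> \<le> 0"
    proof -
      have "d 1 (W (b 1)) \<le> 0" using b_min[of 1 0] by simp
      then have "A (b 1) \<le> real_of_int 0 * a" using d_W[of 0 "b 1"] by simp
      from A_indexi[OF this] show ?thesis by simp
    qed
    ultimately have pz: "\<bar>B g p - B g z\<bar> \<le> 11" by linarith
    fix q r assume "q \<in> I z p" "r \<in> I z p"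
    from B_mono[OF this(1), of g] B_mono[OF this(2), of g] pz
    show "\<bar>B g q - B g r\<bar> \<le> 30" by linarith
  qed
  ultimately show ?thesis using that p n by blast
qed

text \<open>A quadrilateral in the quotient, cut at its corners: side \<open>i\<close> is what remains, after translation
  by \<open>\<eta> i\<close>, of an original side from \<open>P i\<close> to \<open>Q i\<close>; it runs from \<open>z i\<close> to \<open>y i\<close>.  The polygon closes
  up to the element \<open>k\<close> of the kernel.  At a cut corner both adjacent remaining sides end near the
  line along which the corner was cut (\<open>own\<close>).\<close>

definition cfg :: "(nat \<Rightarrow> 'a) \<Rightarrow> (nat \<Rightarrow> 'a) \<Rightarrow> (nat \<Rightarrow> 'a) \<Rightarrow> (nat \<Rightarrow> 'a) \<Rightarrow> (nat \<Rightarrow> 'a) \<Rightarrow> 'a \<Rightarrow> bool" where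
  "cfg P Q \<eta> z y k \<longleftrightarrow> k \<in> K' \<and> d (y 3) (k * z 0) = 0 \<and> d (P 0) (\<eta> 0 * z 0) = 0 \<and>
     (\<forall>i<4. sub (P i) (Q i) (\<eta> i) (z i) (y i)) \<and>
     (\<forall>i<3. gap (P i) (Q i) (P (Suc i)) (Q (Suc i)) (z i) (y i) (z (Suc i)) (y (Suc i))) \<and>
     (\<forall>i<3. d (\<eta> i * y i) (Q i) \<le> 2 * d (P (Suc i)) (\<eta> (Suc i) * z (Suc i)))"

definition len :: "(nat \<Rightarrow> 'a) \<Rightarrow> (nat \<Rightarrow> 'a) \<Rightarrow> nat" where
  "len z y = (\<Sum>i<4. \<nu> (inverse (z i) * y i))"

text \<open>Both sides cross \<open>g\<close> by about half of \<open>N\<close>, so the pieces cut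
  off at the corner have comparable lengths. The factor two is what bounds old lengths by quotient
  lengths in \<open>bigon\<close>.\<close>

lemma cut_compare:
  assumes "N - 126 * \<theta>1 \<le> 2 * \<bar>B g z - B g y\<bar>" "2 * \<bar>B g z - B g y\<bar> \<le> N + 40 * \<theta>1"
    "N - 126 * \<theta>1 \<le> 2 * \<bar>B g z' - B g y'\<bar>"
    "d y z' \<le> \<gamma>"
  shows "d z y - dist g z \<le> 2 * (d z' y' - dist g y')"
proof -
  define i j where "i = \<bar>B g z - B g y\<bar>" and "j = \<bar>B g z' - B g y'\<bar>"
  have ij: "i \<le> j + 83 * \<theta>1" "1000 * \<theta>1 \<le> j" using assms(1-3) N_theta1 theta1 unfolding i_def j_def by (smt (verit))+
  have 1: "d z y \<le> dist g z + A i + dist g y" using line_upper[of z y g] by (simp add: i_def)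
  have 2: "dist g z' + A j + dist g y' \<le> d z' y' + 5 * a"
    using line_lower[of g z' y'] ij(2) theta1 unfolding j_def A_abs by linarith
  have 3: "dist g y \<le> \<gamma> + dist g z'"
    using dist_le[of g y "B g z'"] d_tri[of y "g * W (B g z')" z'] assms(4) by (simp add: dist_def near_def)
  have 4: "A i \<le> A j + 83 * real_of_int \<theta>1 * a"
  proof (cases "i \<le> j")
    case True
    have i0: "0 \<le> i" by (simp add: i_def)
    have "A i + A (j - i) \<le> A j + \<kappa>" using A_super[of i "j - i"] True i0 by simp
    moreover have "\<kappa> \<le> 83 * real_of_int \<theta>1 * a"
    proof -
      have "1 * a \<le> (83 * real_of_int \<theta>1) * a" by (rule mult_right_mono) (use theta1 a1 in auto)
      then show ?thesis using kappa_a a1 by linarith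
    qed
    ultimately show ?thesis using A_nonneg[of "j - i"] by linarith
  next
    case False
    have "A i \<le> A j + A (i - j)" using A_tri[of j "i - j"] by simp
    moreover have "A (i - j) \<le> real_of_int (83 * \<theta>1) * a"
    proof -
      have "real_of_int \<bar>i - j\<bar> \<le> real_of_int (83 * \<theta>1)" using ij(1) False by (simp only: of_int_le_iff)
      then show ?thesis using A_upper[of "i - j"] mult_right_mono[of "real_of_int \<bar>i - j\<bar>" "real_of_int (83 * \<theta>1)" a] a1 by linarith
    qed
    ultimately show ?thesis by simp
  qed
  have 5: "real_of_int (1000 * \<theta>1) * 99 * a \<le> 100 * A j"
    by (rule A_ge) (use ij(2) in linarith)
  have t: "10 * a \<le> real_of_int \<theta>1 * a"
    by (rule mult_right_mono) (use theta1 a1 in auto)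
  define T where "T = real_of_int \<theta>1 * a"
  have 6: "990 * T \<le> A j" using 5 by (simp add: T_def)
  have e: "\<gamma> = 45 * T" "83 * real_of_int \<theta>1 * a = 83 * T"
    by (simp_all add: T_def \<gamma>_def)
  have 7: "128 * T + 10 * a \<le> A j" using 6 t a1 unfolding T_def[symmetric] by linarith
  show ?thesis using 1 2 3 4 7 dist_nonneg[of g z'] unfolding e by argo
qed

text \<open>Everything after the corner \<open>j\<close> is rotated back by \<open>N * e\<close>.
  This brings the ends of the two shortened sides together near the line \<open>g\<close>, and the
  rotation is absorbed in the closing element.\<close>

lemma cut_corner:
  assumes c: "cfg P Q \<eta> z y k" and tm: "\<And>i. i < 4 \<Longrightarrow> tame (P i) (Q i)" and j: "j < 3"
    and big: "N - 126 * \<theta>1 \<le> 2 * \<bar>B g (z j) - B g (y j)\<bar>" "N - 126 * \<theta>1 \<le> 2 * \<bar>B g (z (Suc j)) - B g (y (Suc j))\<bar>"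
    and e: "\<bar>B g (y (Suc j)) - N * e - B g (z j)\<bar> \<le> 43 * \<theta>1"
  shows "\<exists>\<eta>' z' y' k'. cfg P Q \<eta>' z' y' k' \<and> len z' y' < len z y"
proof -
  have kK: "k \<in> K'" and cl: "d (y 3) (k * z 0) = 0" and P0: "d (P 0) (\<eta> 0 * z 0) = 0"
    and sb: "\<And>i. i < 4 \<Longrightarrow> sub (P i) (Q i) (\<eta> i) (z i) (y i)"
    and gp: "\<And>i. i < 3 \<Longrightarrow> gap (P i) (Q i) (P (Suc i)) (Q (Suc i)) (z i) (y i) (z (Suc i)) (y (Suc i))"
    and rm: "\<And>i. i < 3 \<Longrightarrow> d (\<eta> i * y i) (Q i) \<le> 2 * d (P (Suc i)) (\<eta> (Suc i) * z (Suc i))"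
    using c unfolding cfg_def by blast+
  define J where "J = Suc j"
  have j4: "j < 4" "J < 4" using j by (auto simp: J_def)
  have b1: "1000 * \<theta>1 \<le> \<bar>B g (z j) - B g (y j)\<bar>" "1000 * \<theta>1 \<le> \<bar>B g (z J) - B g (y J)\<bar>"
    using big N_theta1 theta1 unfolding J_def by (smt (verit))+
  have tt: "2 * \<bar>B g (z i) - B g (y i)\<bar> \<le> N + 40 * \<theta>1" if "i < 4" for i using sub_tame[OF sb[OF that] tm[OF that]] .
  have b7: "7 \<le> \<bar>B g (z j) - B g (y j)\<bar>" "7 \<le> \<bar>B g (y J) - B g (z J)\<bar>"
    using b1 theta1 by linarith+
  obtain p where p: "p \<in> I (z j) (y j)" "d (z j) p = dist g (z j)" "d p (near g (z j)) \<le> 6 * a" "dist g p \<le> 6 * a"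
    "\<forall>q\<in>I (z j) p. \<forall>r\<in>I (z j) p. \<bar>B g q - B g r\<bar> \<le> 30" by (rule cut_side[OF b7(1)])
  obtain p' where p': "p' \<in> I (y J) (z J)" "d (y J) p' = dist g (y J)" "d p' (near g (y J)) \<le> 6 * a" "dist g p' \<le> 6 * a"
    "\<forall>q\<in>I (y J) p'. \<forall>r\<in>I (y J) p'. \<bar>B g q - B g r\<bar> \<le> 30" by (rule cut_side[OF b7(2)])
  have p'I: "p' \<in> I (z J) (y J)" using p'(1) I_sym by blast
  define v where "v = zpow (u g) (- e)"
  have v: "v \<in> K'" unfolding v_def by (rule subgrp_zpow[OF subgrp_K' u_K'])
  have vB: "B g (v * x) = B g x - N * e" for x by (simp add: v_def u_shift)
  have vd: "dist g (v * x) = dist g x" for x by (simp add: v_def u_dist)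
  define \<eta>' where "\<eta>' i = (if j < i then \<eta> i * inverse v else \<eta> i)" for i
  define z' where "z' i = (if i = J then v * p' else if j < i then v * z i else z i)" for i
  define y' where "y' i = (if i = j then p else if j < i then v * y i else y i)" for i
  have ownp: "own g (z j) p (v * p') (v * y J)"
  proof -
    have "d p (v * p') \<le> d p (near g (z j)) + d (near g (z j)) (near g (v * y J)) + d (near g (v * y J)) (v * p')"
      using d_tri[of p "v * p'" "near g (z j)"] d_tri[of "near g (z j)" "v * p'" "near g (v * y J)"] by linarith
    also have "d (near g (v * y J)) (v * p') \<le> 6 * a"
    proof -
      have "near g (v * y J) = v * near g (y J)"
      proof -
        have "W (B g (y J) - N * e) = W (N * (- e)) * W (B g (y J))" by (simp add: algebra_simps flip: zpow_add)
        then show ?thesis unfolding near_def vB by (simp add: v_def zpow_u mgs)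
      qed
      then show ?thesis using p'(3) d_sym[of p' "near g (y J)"] by simp
    qed
    also have "d (near g (z j)) (near g (v * y J)) = A (B g (v * y J) - B g (z j))" by (simp add: near_def)
    also have "\<dots> \<le> real_of_int (43 * \<theta>1) * a"
    proof -
      have "\<bar>B g (v * y J) - B g (z j)\<bar> \<le> 43 * \<theta>1" using e by (simp add: vB J_def)
      then have "real_of_int \<bar>B g (v * y J) - B g (z j)\<bar> \<le> real_of_int (43 * \<theta>1)" by (simp only: of_int_le_iff)
      then show ?thesis using A_upper[of "B g (v * y J) - B g (z j)"] a1
        mult_right_mono[of "real_of_int \<bar>B g (v * y J) - B g (z j)\<bar>" "real_of_int (43 * \<theta>1)" a] by linarith
    qed
    finally have "d p (v * p') \<le> 12 * a + 43 * real_of_int \<theta>1 * a" using p(3) by simp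
    moreover have "10 * a \<le> real_of_int \<theta>1 * a" by (rule mult_right_mono) (use theta1 a1 in auto)
    ultimately have "d p (v * p') \<le> \<gamma>" unfolding \<gamma>_def using a1 by linarith
    moreover have "\<forall>q\<in>I (v * p') (v * y J). \<forall>r\<in>I (v * p') (v * y J). \<bar>B g q - B g r\<bar> \<le> 30"
    proof (intro ballI)
      fix q r assume qr: "q \<in> I (v * p') (v * y J)" "r \<in> I (v * p') (v * y J)"
      have "inverse v * q \<in> I (y J) p'" "inverse v * r \<in> I (y J) p'"
        using qr I_left_iff[of v "inverse v * q" p' "y J"] I_left_iff[of v "inverse v * r" p' "y J"] I_sym[of "y J"] by simp_all
      then have "\<bar>B g (inverse v * q) - B g (inverse v * r)\<bar> \<le> 30" using p'(5) by blast
      moreover have "B g q = B g (inverse v * q) - N * e" "B g r = B g (inverse v * r) - N * e"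
        using vB[of "inverse v * q"] vB[of "inverse v * r"] by simp_all
      ultimately show "\<bar>B g q - B g r\<bar> \<le> 30" by simp
    qed
    ultimately show ?thesis unfolding own_def using p(4,5) p'(4) vd by simp
  qed
  have sb': "sub (P i) (Q i) (\<eta>' i) (z' i) (y' i)" if i: "i < 4" for i
  proof -
    consider "i < j" | "i = j" | "i = J" | "J < i" by (auto simp: J_def) linarith
    then show ?thesis
    proof cases
      case 1 then show ?thesis using sb[OF i] by (simp add: \<eta>'_def z'_def y'_def J_def)
    next
      case 2 then show ?thesis using sub_sub(1)[OF sb[OF i], of "z j" p] p(1) by (simp add: \<eta>'_def z'_def y'_def J_def)
    next
      case 3 then show ?thesis using sub_left[OF sub_sub(1)[OF sb[OF i], of p' "y J"] v] p'I by (simp add: \<eta>'_def z'_def y'_def J_def)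
    next
      case 4 then show ?thesis using sub_left[OF sb[OF i] v] by (simp add: \<eta>'_def z'_def y'_def J_def)
    qed
  qed
  have gp': "gap (P i) (Q i) (P (Suc i)) (Q (Suc i)) (z' i) (y' i) (z' (Suc i)) (y' (Suc i))" if i: "i < 3" for i
  proof -
    consider "Suc i < j" | "Suc i = j" | "i = j" | "i = J" | "J < i" by (auto simp: J_def) linarith
    then show ?thesis
    proof cases
      case 1 then show ?thesis using gp[OF i] by (simp add: z'_def y'_def J_def)
    next
      case 2 then show ?thesis using gap_shrink[OF gp[OF i], of "z i" p] p(1) by (auto simp add: z'_def y'_def J_def)
    next
      case 3
      have "cross (10 * \<theta>1) (P j) (Q j) g" "cross (10 * \<theta>1) (P J) (Q J) g"
        using sub_cross[OF sb[OF j4(1)], of g] sub_cross[OF sb[OF j4(2)], of g] b1 theta1 by linarith+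
      then show ?thesis using ownp 3 unfolding gap_def by (auto simp add: z'_def y'_def J_def)
    next
      case 4
      have "gap (P i) (Q i) (P (Suc i)) (Q (Suc i)) p' (y i) (z (Suc i)) (y (Suc i))"
        using gap_shrink[OF gp[OF i], of p' "y (Suc i)"] p'I 4 by simp
      from gap_left[OF this v] show ?thesis using 4 by (simp add: z'_def y'_def J_def)
    next
      case 5 then show ?thesis using gap_left[OF gp[OF i] v] by (simp add: z'_def y'_def J_def)
    qed
  qed
  have py: "d p (y j) = d (z j) (y j) - dist g (z j)" using p(1,2) by (simp add: I_iff)
  have zp: "d (z J) p' = d (z J) (y J) - dist g (y J)" using p'I p'(2) d_sym[of "y J" p'] by (simp add: I_iff)
  have rm': "d (\<eta>' i * y' i) (Q i) \<le> 2 * d (P (Suc i)) (\<eta>' (Suc i) * z' (Suc i))" if i: "i < 3" for i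
  proof -
    consider "i < j" | "i = j" | "J \<le> i" by (auto simp: J_def) linarith
    then show ?thesis
    proof cases
      case 1 then show ?thesis using rm[OF i] by (auto simp: \<eta>'_def z'_def y'_def J_def)
    next
      case 2
      have "d (\<eta> j * p) (Q j) = d (\<eta> j * y j) (Q j) + d p (y j)"
        using sub_sub(3)[OF sb[OF j4(1)], of "z j" p] p(1) by simp
      moreover have "d (P J) (\<eta> J * p') = d (P J) (\<eta> J * z J) + d (z J) p'"
        using sub_sub(2)[OF sb[OF j4(2)], of p' "y J"] p'I by simp
      moreover have "d p (y j) \<le> 2 * d (z J) p'" unfolding py zp
        by (rule cut_compare) (use big tt[OF j4(1)] gap_d[OF gp[OF j]] in \<open>auto simp: J_def\<close>)
      ultimately show ?thesis using rm[OF j] 2 by (auto simp: \<eta>'_def z'_def y'_def J_def mgs)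
    next
      case 3 then show ?thesis using rm[OF i] by (auto simp: \<eta>'_def z'_def y'_def J_def mgs)
    qed
  qed
  have "cfg P Q \<eta>' z' y' (v * k)"
    unfolding cfg_def
  proof (intro conjI allI impI)
    show "v * k \<in> K'" using v kK subgrp_K' by (simp add: subgrp_mult)
    have "d (v * y 3) (v * k * z 0) = 0" using cl by (simp add: mult.assoc del: d_K0)
    then show "d (y' 3) (v * k * z' 0) = 0" using j by (simp add: z'_def y'_def J_def del: d_K0)
    show "d (P 0) (\<eta>' 0 * z' 0) = 0" using P0 by (simp add: \<eta>'_def z'_def J_def del: d_K0)
  qed (use sb' gp' rm' in blast)+
  moreover have "len z' y' < len z y"
    unfolding len_def
  proof (rule sum_strict_mono_ex1)
    have lt: "real (\<nu> (inverse (z' i) * y' i)) \<le> real (\<nu> (inverse (z i) * y i))" for i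
    proof -
      have "d (z' i) (y' i) \<le> d (z i) (y i)"
      proof -
        consider "i < j" | "i = j" | "i = J" | "J < i" by (auto simp: J_def) linarith
        then show ?thesis
        proof cases
          case 2
          have "d (z j) p \<le> d (z j) (y j)" using p(1) d_nonneg[of p "y j"] unfolding I_iff by linarith
          then show ?thesis using 2 by (simp add: z'_def y'_def J_def)
        next
          case 3
          have "d p' (y J) \<le> d (z J) (y J)" using p'I d_nonneg[of "z J" p'] unfolding I_iff by linarith
          then show ?thesis using 3 by (simp add: z'_def y'_def J_def)
        qed (simp_all add: z'_def y'_def J_def)
      qed
      then show ?thesis by (simp add: d_def)
    qed
    show "\<forall>x\<in>{..<4}. \<nu> (inverse (z' x) * y' x) \<le> \<nu> (inverse (z x) * y x)" using lt by simp
    have "d (z' j) (y' j) < d (z j) (y j)"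
    proof -
      have "dist g (z j) + A (B g (z j) - B g (y j)) + dist g (y j) \<le> d (z j) (y j) + 5 * a"
        by (rule line_lower) (use b7 in linarith)
      moreover have "real_of_int 7 * 99 * a \<le> 100 * A (B g (z j) - B g (y j))" by (rule A_ge) (use b7 in linarith)
      ultimately have "dist g (z j) < d (z j) (y j)" using dist_nonneg[of g "y j"] a1 by linarith
      then show ?thesis using p(2) by (simp add: z'_def y'_def J_def)
    qed
    then have "\<nu> (inverse (z' j) * y' j) < \<nu> (inverse (z j) * y j)" by (simp add: d_def)
    then show "\<exists>i\<in>{..<4}. \<nu> (inverse (z' i) * y' i) < \<nu> (inverse (z i) * y i)" using j4(1) by blast
  qed simp
  ultimately show ?thesis by blast
qed

end

section \<open>Hyperbolicity of the quotient\<close>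

context wind
begin

interpretation q: gnorm \<nu>' by (rule gnorm')

definition opp :: "(nat \<Rightarrow> 'a) \<Rightarrow> (nat \<Rightarrow> 'a) \<Rightarrow> bool" where
  "opp P Q \<longleftrightarrow> (\<exists>g. cross (5 * \<theta>1) (P 0) (Q 0) g \<and> cross (5 * \<theta>1) (P 2) (Q 2) g \<or>
     cross (5 * \<theta>1) (P 1) (Q 1) g \<and> cross (5 * \<theta>1) (P 3) (Q 3) g)"

text \<open>Closure in the old metric, up to four gaps. The last clause tells whether the base
  corner was left alone; if it was cut, the last side crosses a line, which a degenerate side cannot
  do.\<close>

definition closed :: "(nat \<Rightarrow> 'a) \<Rightarrow> (nat \<Rightarrow> 'a) \<Rightarrow> (nat \<Rightarrow> 'a) \<Rightarrow> (nat \<Rightarrow> 'a) \<Rightarrow> (nat \<Rightarrow> 'a) \<Rightarrow> bool" where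
  "closed P Q \<eta> z y \<longleftrightarrow> (\<forall>i<4. sub (P i) (Q i) (\<eta> i) (z i) (y i)) \<and>
     (\<forall>i<3. d (y i) (z (Suc i)) \<le> \<gamma> \<and> d (\<eta> i * y i) (Q i) \<le> 2 * d (P (Suc i)) (\<eta> (Suc i) * z (Suc i))) \<and>
     d (y 3) (z 0) \<le> \<gamma> \<and> (d (P 0) (\<eta> 0 * z 0) = 0 \<or> (\<exists>g. cross (10 * \<theta>1) (P 3) (Q 3) g))"

lemma gamma0: "0 \<le> \<gamma>"
  unfolding \<gamma>_def using a1 theta1 by simp

text \<open>If \<open>k\<close> is nontrivial, some line is crossed by nearly \<open>N\<close>, while each tame side crosses it by
  little more than \<open>N / 2\<close>.  So two sides cross it: if they are opposite, we are done; if they are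
  adjacent, rotating the rest of the polygon along this line shortens it.\<close>

lemma engine:
  assumes "cfg P Q \<eta> z y k" and tm: "\<And>i. i < 4 \<Longrightarrow> tame (P i) (Q i)"
  shows "opp P Q \<or> (\<exists>\<eta> z y. closed P Q \<eta> z y)"
  using assms(1)
proof (induction "len z y" arbitrary: \<eta> z y k rule: less_induct)
  case less
  note c = less.prems
  have kK: "k \<in> K'" and cl: "d (y 3) (k * z 0) = 0" and P0: "d (P 0) (\<eta> 0 * z 0) = 0"
    and sb: "\<And>i. i < 4 \<Longrightarrow> sub (P i) (Q i) (\<eta> i) (z i) (y i)"
    and gp: "\<And>i. i < 3 \<Longrightarrow> gap (P i) (Q i) (P (Suc i)) (Q (Suc i)) (z i) (y i) (z (Suc i)) (y (Suc i))"
    and rm: "\<And>i. i < 3 \<Longrightarrow> d (\<eta> i * y i) (Q i) \<le> 2 * d (P (Suc i)) (\<eta> (Suc i) * z (Suc i))"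
    using c unfolding cfg_def by blast+
  show ?case
  proof (cases "k \<in> K")
    case True
    have "d (y 3) (z 0) = 0" using cl d_K_right[OF True] by metis
    then have "closed P Q \<eta> z y"
      unfolding closed_def using sb gap_d[OF gp] rm gamma0 P0 by (simp del: d_K0)
    then show ?thesis by blast
  next
    case False
    obtain g where g: "N - 10 * \<theta>1 \<le> \<bar>B g (k * z 0) - B g (z 0)\<bar>" by (rule greendlinger[OF kK False])
    define zz yy where "zz i = B g (z i)" and "yy i = B g (y i)" for i
    define s where "s i = \<bar>zz i - yy i\<bar>" for i
    define e where "e i = \<bar>yy i - zz (Suc i)\<bar>" for i
    have "B g (k * z 0) = yy 3" using B_cong[OF cl] by (simp add: yy_def)
    then have far: "N - 10 * \<theta>1 \<le> \<bar>yy 3 - zz 0\<bar>" using g by (simp add: zz_def)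
    have tr1: "\<bar>yy (Suc i) - zz i\<bar> \<le> s i + e i + s (Suc i)" for i unfolding s_def e_def by linarith
    have t012: "\<bar>yy 3 - zz 0\<bar> \<le> \<bar>yy 2 - zz 0\<bar> + e 2 + s 3" "\<bar>yy 2 - zz 0\<bar> \<le> \<bar>yy 1 - zz 0\<bar> + e 1 + s 2"
       "\<bar>yy 3 - zz 1\<bar> \<le> \<bar>yy 2 - zz 1\<bar> + e 2 + s 3" "\<bar>yy 3 - zz 0\<bar> \<le> s 0 + e 0 + \<bar>yy 3 - zz 1\<bar>"
       "\<bar>yy 3 - zz 1\<bar> \<le> s 1 + e 1 + \<bar>yy 3 - zz 2\<bar>" "\<bar>yy 0 - zz 3\<bar> \<le> e 0 + s 1 + e 1 + s 2 + e 2"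
      unfolding s_def e_def by (simp_all add: eval_nat_numeral)
    have tr': "\<bar>yy 1 - zz 0\<bar> \<le> s 0 + e 0 + s 1" "\<bar>yy 2 - zz 1\<bar> \<le> s 1 + e 1 + s 2" "\<bar>yy 3 - zz 2\<bar> \<le> s 2 + e 2 + s 3"
      using tr1[of 0] tr1[of 1] tr1[of 2] by (simp_all add: eval_nat_numeral)
    have tot: "N - 10 * \<theta>1 \<le> s 0 + e 0 + s 1 + e 1 + s 2 + e 2 + s 3"
      using far t012(1,2) tr'(1) by linarith
    have tt: "2 * s i \<le> N + 40 * \<theta>1" if "i < 4" for i
      using sub_tame[OF sb[OF that] tm[OF that], of g] by (simp add: s_def zz_def yy_def)
    have tt4: "2 * s 0 \<le> N + 40 * \<theta>1" "2 * s 1 \<le> N + 40 * \<theta>1" "2 * s 2 \<le> N + 40 * \<theta>1" "2 * s 3 \<le> N + 40 * \<theta>1"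
      by (rule tt, simp)+
    have cr: "cross (10 * \<theta>1) (P i) (Q i) g" if "12 * \<theta>1 \<le> s i" "i < 4" for i
      using sub_cross[OF sb[OF that(2)], of g] that(1) by (simp add: s_def zz_def yy_def)
    have cr5: "cross (5 * \<theta>1) (P i) (Q i) g" if "12 * \<theta>1 \<le> s i" "i < 4" for i
      by (rule cross_mono[OF cr[OF that]]) (use theta1 in linarith)
    show ?thesis
    proof (cases "\<exists>j<3. \<exists>h. own h (z j) (y j) (z (Suc j)) (y (Suc j)) \<and> cross (10 * \<theta>1) (P j) (Q j) h \<and>
         cross (10 * \<theta>1) (P (Suc j)) (Q (Suc j)) h \<and> sim h g")
      \<comment> \<open>A corner was already cut along a line equivalent to \<open>g\<close>. The
        two sides there hardly cross \<open>g\<close> now, so the other two do, and one of these is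
        opposite to a side that crossed the line originally.\<close>
      case True
      then obtain j h where j: "j < 3" and h: "own h (z j) (y j) (z (Suc j)) (y (Suc j))"
         "cross (10 * \<theta>1) (P j) (Q j) h" "cross (10 * \<theta>1) (P (Suc j)) (Q (Suc j)) h" "sim h g" by blast
      have x: "cross (5 * \<theta>1) (P j) (Q j) g" "cross (5 * \<theta>1) (P (Suc j)) (Q (Suc j)) g"
        using cross_sim h by blast+
      have "\<bar>B h (z j) - B h (y j)\<bar> \<le> 30" "\<bar>B h (z (Suc j)) - B h (y (Suc j))\<bar> \<le> 30"
        using h(1) unfolding own_def using I_ends by blast+
      then have sm: "s j \<le> 56" "s (Suc j) \<le> 56"
        using sim_compare[OF h(4), of "z j" "y j"] sim_compare[OF h(4), of "z (Suc j)" "y (Suc j)"]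
        unfolding s_def zz_def yy_def by linarith+
      have e50: "e i \<le> 50 * \<theta>1" if "i < 3" for i using gap_lip[OF gp[OF that], of g] by (simp add: e_def zz_def yy_def)
      have e3: "e 0 \<le> 50 * \<theta>1" "e 1 \<le> 50 * \<theta>1" "e 2 \<le> 50 * \<theta>1" by (rule e50, simp)+
      consider "j = 0" | "j = 1" | "j = 2" using j by linarith
      then have "opp P Q"
      proof cases
        case 1
        then have "s 0 \<le> 56" "s 1 \<le> 56" using sm by simp_all
        then have "12 * \<theta>1 \<le> s 2" using tot tt4 e3 N_theta1 theta1 by (smt (verit))
        then show ?thesis using cr5[of 2] x 1 unfolding opp_def by auto
      next
        case 2
        then have "s 1 \<le> 56" "s 2 \<le> 56" using sm by (simp_all add: eval_nat_numeral)
        then have "12 * \<theta>1 \<le> s 3" using tot tt4 e3 N_theta1 theta1 by (smt (verit))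
        then show ?thesis using cr5[of 3] x 2 unfolding opp_def by auto
      next
        case 3
        then have "s 2 \<le> 56" "s 3 \<le> 56" using sm by (simp_all add: eval_nat_numeral)
        then have "12 * \<theta>1 \<le> s 0" using tot tt4 e3 N_theta1 theta1 by (smt (verit))
        then show ?thesis using cr5[of 0] x 3 unfolding opp_def by auto
      qed
      then show ?thesis by blast
    next
      case nosim: False
      have e3: "e i \<le> 3 * \<theta>1" if i: "i < 3" for i
      proof -
        have "d (y i) (z (Suc i)) = 0 \<or> (\<exists>h. own h (z i) (y i) (z (Suc i)) (y (Suc i)) \<and> \<not> sim g h)"
          using gp[OF i] nosim i sim_sym unfolding gap_def by blast
        then show ?thesis
        proof
          assume "d (y i) (z (Suc i)) = 0"
          from B_cong[OF this, of g] show ?thesis using theta1 by (simp add: e_def zz_def yy_def)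
        next
          assume "\<exists>h. own h (z i) (y i) (z (Suc i)) (y (Suc i)) \<and> \<not> sim g h"
          then show ?thesis using gap_foreign unfolding e_def zz_def yy_def by blast
        qed
      qed
      have e3: "e 0 \<le> 3 * \<theta>1" "e 1 \<le> 3 * \<theta>1" "e 2 \<le> 3 * \<theta>1" by (rule e3, simp)+
      have cut: ?thesis if j: "j < 3" and b: "N - 126 * \<theta>1 \<le> 2 * s j" "N - 126 * \<theta>1 \<le> 2 * s (Suc j)"
          and T: "N - 40 * \<theta>1 \<le> \<bar>yy (Suc j) - zz j\<bar>" "\<bar>yy (Suc j) - zz j\<bar> \<le> N + 43 * \<theta>1" for j
      proof -
        define f :: int where "f = (if zz j \<le> yy (Suc j) then 1 else - 1)"
        have T1: "\<bar>yy (Suc j) - N * f - zz j\<bar> \<le> 43 * \<theta>1"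
        proof (cases "zz j \<le> yy (Suc j)")
          case True
          then have "N * f = N" by (simp add: f_def)
          then show ?thesis using T True theta1 by linarith
        next
          case False
          then have "N * f = - N" by (simp add: f_def)
          then show ?thesis using T False theta1 by linarith
        qed
        have "\<exists>\<eta>' z' y' k'. cfg P Q \<eta>' z' y' k' \<and> len z' y' < len z y"
          using cut_corner[OF c tm j, of g f] b T1 unfolding s_def zz_def yy_def by blast
        then show ?thesis using less.hyps by blast
      qed
      \<comment> \<open>Unless opposite sides cross \<open>g\<close>, two cyclically adjacent sides
        are short on it and the other two share the crossing. Case 5 is the corner where the polygon
        closes up only to \<open>k\<close>.\<close>
      consider "12 * \<theta>1 \<le> s 0 \<and> 12 * \<theta>1 \<le> s 2 \<or> 12 * \<theta>1 \<le> s 1 \<and> 12 * \<theta>1 \<le> s 3"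
        | "s 2 < 12 * \<theta>1" "s 3 < 12 * \<theta>1" | "s 0 < 12 * \<theta>1" "s 3 < 12 * \<theta>1"
        | "s 0 < 12 * \<theta>1" "s 1 < 12 * \<theta>1" | "s 1 < 12 * \<theta>1" "s 2 < 12 * \<theta>1" by linarith
      then show ?thesis
      proof cases
        case 1
        then show ?thesis using cr5[of 0] cr5[of 1] cr5[of 2] cr5[of 3] unfolding opp_def by auto
      next
        case 2
        \<comment> \<open>From \<open>N - 10 * \<theta>1\<close> subtract two short sides (24),
          three gaps (9) and the partner (half of \<open>N\<close> plus 20), then double.\<close>
        have "N - 126 * \<theta>1 \<le> 2 * s 0" "N - 126 * \<theta>1 \<le> 2 * s 1" using 2 tot tt4 e3 by (smt (verit))+
        moreover have "N - 40 * \<theta>1 \<le> \<bar>yy 1 - zz 0\<bar>" using far t012(1,2) 2 e3 by linarith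
        moreover have "\<bar>yy 1 - zz 0\<bar> \<le> N + 43 * \<theta>1" using tr' tt4 e3 by (smt (verit))
        ultimately show ?thesis using cut[of 0] by simp
      next
        case 3
        have "N - 126 * \<theta>1 \<le> 2 * s 1" "N - 126 * \<theta>1 \<le> 2 * s 2" using 3 tot tt4 e3 by (smt (verit))+
        moreover have "N - 40 * \<theta>1 \<le> \<bar>yy 2 - zz 1\<bar>" using far t012(3,4) 3 e3 by linarith
        moreover have "\<bar>yy 2 - zz 1\<bar> \<le> N + 43 * \<theta>1" using tr' tt4 e3 by (smt (verit))
        ultimately show ?thesis using cut[of 1] by (simp add: eval_nat_numeral)
      next
        case 4
        have "N - 126 * \<theta>1 \<le> 2 * s 2" "N - 126 * \<theta>1 \<le> 2 * s 3" using 4 tot tt4 e3 by (smt (verit))+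
        moreover have "N - 40 * \<theta>1 \<le> \<bar>yy 3 - zz 2\<bar>" using far t012(4,5) 4 e3 by linarith
        moreover have "\<bar>yy 3 - zz 2\<bar> \<le> N + 43 * \<theta>1" using tr' tt4 e3 by (smt (verit))
        ultimately show ?thesis using cut[of 2] by (simp add: eval_nat_numeral)
      next
        case 5
        \<comment> \<open>Here \<open>y 0\<close> and \<open>z 3\<close> project to \<open>g\<close>
          within \<open>33 * \<theta>1\<close> (three gaps and two short sides), so shortening the
          sides at the base corner closes the polygon without any rotation.\<close>
        have b: "12 * \<theta>1 \<le> s 0" "12 * \<theta>1 \<le> s 3" using 5 tot tt4 e3 N_theta1 theta1 by (smt (verit))+
        have b7: "7 \<le> \<bar>B g (y 0) - B g (z 0)\<bar>" "7 \<le> \<bar>B g (z 3) - B g (y 3)\<bar>"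
          using b theta1 unfolding s_def zz_def yy_def by linarith+
        obtain p where p: "p \<in> I (y 0) (z 0)" "d p (near g (y 0)) \<le> 6 * a" using cut_side[OF b7(1)] by metis
        obtain r where r: "r \<in> I (z 3) (y 3)" "d r (near g (z 3)) \<le> 6 * a" using cut_side[OF b7(2)] by metis
        have pI: "p \<in> I (z 0) (y 0)" using p(1) I_sym by blast
        define z' y' where "z' i = (if i = 0 then p else z i)" and "y' i = (if i = 3 then r else y i)" for i :: nat
        have "d r p \<le> d r (near g (z 3)) + A (B g (y 0) - B g (z 3)) + d p (near g (y 0))"
          using d_tri[of r p "near g (z 3)"] d_tri[of "near g (z 3)" p "near g (y 0)"] d_sym[of p "near g (y 0)"]
          by (simp add: near_def)
        moreover have "A (B g (y 0) - B g (z 3)) \<le> real_of_int (33 * \<theta>1) * a"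
        proof -
          have "\<bar>B g (y 0) - B g (z 3)\<bar> \<le> 33 * \<theta>1" using t012(6) 5 e3 unfolding zz_def[symmetric] yy_def[symmetric] by linarith
          then have "real_of_int \<bar>B g (y 0) - B g (z 3)\<bar> \<le> real_of_int (33 * \<theta>1)" by (simp only: of_int_le_iff)
          then show ?thesis using A_upper[of "B g (y 0) - B g (z 3)"] a1
            mult_right_mono[of "real_of_int \<bar>B g (y 0) - B g (z 3)\<bar>" "real_of_int (33 * \<theta>1)" a] by linarith
        qed
        moreover have "10 * a \<le> real_of_int \<theta>1 * a" by (rule mult_right_mono) (use theta1 a1 in auto)
        moreover have "real_of_int (33 * \<theta>1) * a = 33 * (real_of_int \<theta>1 * a)" "\<gamma> = 45 * (real_of_int \<theta>1 * a)"
          by (simp_all add: \<gamma>_def)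
        ultimately have rp: "d r p \<le> \<gamma>" using p(2) r(2) a1 by argo
        have sb': "sub (P i) (Q i) (\<eta> i) (z' i) (y' i)" if "i < 4" for i
        proof -
          consider "i = 0" | "i = 3" | "i \<noteq> 0" "i \<noteq> 3" by blast
          then show ?thesis
          proof cases
            case 1 then show ?thesis using sub_sub(1)[OF sb[OF that], of p "y 0"] pI by (simp add: z'_def y'_def)
          next
            case 2 then show ?thesis using sub_sub(1)[OF sb[OF that], of "z 3" r] r by (simp add: z'_def y'_def)
          next
            case 3 then show ?thesis using sb[OF that] by (simp add: z'_def y'_def)
          qed
        qed
        have "closed P Q \<eta> z' y'"
          unfolding closed_def using sb' gap_d[OF gp] rm rp cr[OF b(2)] by (auto simp: z'_def y'_def simp del: d_K0)
        then show ?thesis by blast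
      qed
    qed
  qed
qed

lemma engine_start:
  assumes tm: "\<And>i. i < 4 \<Longrightarrow> tame (P i) (Q i)" and cl: "d (Q 3) (k * P 0) = 0" "k \<in> K'"
    and gp: "\<And>i. i < 3 \<Longrightarrow> d (Q i) (P (Suc i)) = 0"
  shows "opp P Q \<or> (\<exists>\<eta> z y. closed P Q \<eta> z y)"
proof (rule engine[OF _ tm])
  have "sub (P i) (Q i) 1 (P i) (Q i)" for i unfolding sub_def using subgrp_one[OF subgrp_K'] by simp
  moreover have "d (1 * Q i) (Q i) = 0" for i by simp
  ultimately show "cfg P Q (\<lambda>_. 1) P Q k"
    unfolding cfg_def gap_def using cl gp by (simp del: d_K0)
qed

section \<open>The four-point condition and bigons in the quotient\<close>

lemma sub_length:
  assumes "sub P Q \<eta> z y" shows "d P Q = d P (\<eta> * z) + d z y + d (\<eta> * y) Q"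
proof -
  have "d P Q = d P (\<eta> * z) + d (\<eta> * z) Q" "d (\<eta> * z) Q = d (\<eta> * z) (\<eta> * y) + d (\<eta> * y) Q"
    using assms by (simp_all add: sub_def I_iff)
  then show ?thesis by simp
qed

lemma lift_side: obtains k where "k \<in> K'" "d x (k * y) = d' x y" "tame x (k * y)"
proof -
  obtain k where k: "k \<in> K'" "d' x y = d x (k * y)" using d'_ex by blast
  have "tame x (k * y)" by (rule short_tame') (use k d'_K'(2)[OF k(1)] in simp)
  then show ?thesis using that k by simp
qed

text \<open>Two approaches to a line cost \<open>6 * a\<close> each, and a line has diameter at most
  \<open>N * a\<close> in the quotient (\<open>line_d'\<close>).\<close>

definition \<Gamma> :: real where "\<Gamma> = 12 * a + real_of_int N * a"

lemma line_d': "d' (g * W i) (g * W j) \<le> real_of_int N * a"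
proof -
  define m where "m = (i - j) div N"
  define r where "r = (i - j) mod N"
  have r: "0 \<le> r" "r < N" using N_theta1 theta1 by (auto simp: r_def)
  have ij: "i - j = N * m + r" by (simp add: m_def r_def)
  have u: "zpow (u g) m * (g * W j) = g * W (N * m + j)" by (simp add: zpow_u zpow_add mgs)
  have "zpow (u g) m \<in> K'" by (rule subgrp_zpow[OF subgrp_K' u_K'])
  then have "d' (g * W i) (g * W j) \<le> d (g * W i) (g * W (N * m + j))" using d'_le(1) u by metis
  also have "\<dots> = A r" using ij A_commute[of i "N * m + j"] by (simp add: algebra_simps)
  also have "\<dots> \<le> real_of_int N * a"
  proof -
    have "real_of_int \<bar>r\<bar> \<le> real_of_int N" using r by linarith
    then show ?thesis using A_upper[of r] mult_right_mono[of "real_of_int \<bar>r\<bar>" "real_of_int N" a] a1 by linarith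
  qed
  finally show ?thesis .
qed

lemma opp_close:
  assumes "cross (5 * \<theta>1) P Q g" "cross (5 * \<theta>1) P' Q' g"
  shows "\<exists>p\<in>I P Q. \<exists>r\<in>I P' Q'. d' p r \<le> \<Gamma>"
proof -
  have *: "\<exists>p\<in>I P Q. \<exists>i. d' p (g * W i) \<le> 6 * a" if cr: "cross (5 * \<theta>1) P Q g" for P Q
  proof -
    obtain k where k: "k \<in> K'" "5 * \<theta>1 \<le> \<bar>B g (k * P) - B g (k * Q)\<bar>" using cr by (auto simp: cross_def)
    then have "7 \<le> \<bar>B g (k * P) - B g (k * Q)\<bar>" using theta1 by linarith
    then obtain p where p: "p \<in> I (k * P) (k * Q)" "d p (near g (k * P)) \<le> 6 * a" using cut_side by metis
    have "inverse k * p \<in> I P Q" using p(1) I_left_iff[of k "inverse k * p" P Q] by simp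
    moreover have "d' (inverse k * p) (near g (k * P)) \<le> 6 * a"
      using d'_K'(1)[OF subgrp_inv[OF subgrp_K' k(1)]] d'_le(2)[of p "near g (k * P)"] p(2) by simp
    ultimately show ?thesis unfolding near_def by blast
  qed
  obtain p i where p: "p \<in> I P Q" "d' p (g * W i) \<le> 6 * a" using *[OF assms(1)] by blast
  obtain r j where r: "r \<in> I P' Q'" "d' r (g * W j) \<le> 6 * a" using *[OF assms(2)] by blast
  have "d' p r \<le> \<Gamma>"
    using q.d_tri[of p r "g * W i"] q.d_tri[of "g * W i" r "g * W j"] q.d_sym[of r "g * W j"] p(2) r(2) line_d'[of g i j]
    unfolding \<Gamma>_def by linarith
  then show ?thesis using p(1) r(1) by blast
qed

text \<open>Both diagonals are routed over the short bridge between the opposite sides.\<close>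

lemma opp_sum:
  assumes "p \<in> I P Q" "r \<in> I P' Q'" "d' p r \<le> \<Gamma>"
  shows "d' P P' + d' Q Q' \<le> d P Q + d P' Q' + 2 * \<Gamma>"
proof -
  have "d' P P' \<le> d P p + \<Gamma> + d P' r"
    using q.d_tri[of P P' p] q.d_tri[of p P' r] d'_le(2)[of P p] d'_le(2)[of P' r] q.d_sym[of P' r] assms(3) by linarith
  moreover have "d' Q Q' \<le> d p Q + \<Gamma> + d r Q'"
    using q.d_tri[of Q Q' p] q.d_tri[of p Q' r] d'_le(2)[of p Q] d'_le(2)[of r Q'] q.d_sym[of p Q] assms(3) by linarith
  ultimately show ?thesis using assms(1,2) unfolding I_iff by linarith
qed

definition \<delta>' :: real where "\<delta>' = max (2 * \<Gamma>) (4 * \<gamma> + \<delta>)"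

lemma four_point':
  "d' x0 x2 + d' x1 x3 \<le> d' x0 x1 + d' x2 x3 + \<delta>' \<or> d' x0 x2 + d' x1 x3 \<le> d' x0 x3 + d' x1 x2 + \<delta>'"
proof -
  obtain k1 where k1: "k1 \<in> K'" "d x0 (k1 * x1) = d' x0 x1" "tame x0 (k1 * x1)" by (rule lift_side)
  obtain k2 where k2: "k2 \<in> K'" "d (k1 * x1) (k2 * x2) = d' (k1 * x1) x2" "tame (k1 * x1) (k2 * x2)" by (rule lift_side)
  obtain k3 where k3: "k3 \<in> K'" "d (k2 * x2) (k3 * x3) = d' (k2 * x2) x3" "tame (k2 * x2) (k3 * x3)" by (rule lift_side)
  obtain k4 where k4: "k4 \<in> K'" "d (k3 * x3) (k4 * x0) = d' (k3 * x3) x0" "tame (k3 * x3) (k4 * x0)" by (rule lift_side)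
  define P where "P = (!) [x0, k1 * x1, k2 * x2, k3 * x3]"
  define Q where "Q = (!) [k1 * x1, k2 * x2, k3 * x3, k4 * x0]"
  have PQ: "P 0 = x0" "P 1 = k1 * x1" "P 2 = k2 * x2" "P 3 = k3 * x3" "Q 0 = P 1" "Q 1 = P 2" "Q 2 = P 3" "Q 3 = k4 * x0"
    by (simp_all add: P_def Q_def eval_nat_numeral)
  have i4: "i = 0 \<or> i = 1 \<or> i = 2 \<or> i = 3" if "i < 4" for i :: nat using that by linarith
  have i3: "i = 0 \<or> i = 1 \<or> i = 2" if "i < 3" for i :: nat using that by linarith
  have eqs: "d' (P 0) x = d' x0 x" "d' (P 1) x = d' x1 x" "d' (P 2) x = d' x2 x" "d' (P 3) x = d' x3 x" "d' (Q 3) x = d' x0 x" for x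
    using k1(1) k2(1) k3(1) k4(1) unfolding PQ by (simp_all add: d'_K')
  have eqs2: "d' x (P 0) = d' x x0" "d' x (P 1) = d' x x1" "d' x (P 2) = d' x x2" "d' x (P 3) = d' x x3" "d' x (Q 3) = d' x x0" for x
    using k1(1) k2(1) k3(1) k4(1) unfolding PQ by (simp_all add: d'_K')
  have len: "d (P 0) (Q 0) = d' x0 x1" "d (P 1) (Q 1) = d' x1 x2" "d (P 2) (Q 2) = d' x2 x3" "d (P 3) (Q 3) = d' x3 x0"
    using k1 k2 k3 k4 unfolding PQ by (simp_all add: d'_K')
  have "opp P Q \<or> (\<exists>\<eta> z y. closed P Q \<eta> z y)"
  proof (rule engine_start[of P Q k4])
    show "tame (P i) (Q i)" if "i < 4" for i using i4[OF that] k1(3) k2(3) k3(3) k4(3) by (auto simp only: PQ)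
    show "d (Q i) (P (Suc i)) = 0" if "i < 3" for i using i3[OF that] by (auto simp: P_def Q_def eval_nat_numeral simp del: d_K0)
    show "d (Q 3) (k4 * P 0) = 0" by (simp add: PQ del: d_K0)
    show "k4 \<in> K'" by (rule k4)
  qed
  then show ?thesis
  proof
    assume "opp P Q"
    then obtain g where "cross (5 * \<theta>1) (P 0) (Q 0) g \<and> cross (5 * \<theta>1) (P 2) (Q 2) g \<or>
     cross (5 * \<theta>1) (P 1) (Q 1) g \<and> cross (5 * \<theta>1) (P 3) (Q 3) g" unfolding opp_def by blast
    then show ?thesis
    proof
      assume "cross (5 * \<theta>1) (P 0) (Q 0) g \<and> cross (5 * \<theta>1) (P 2) (Q 2) g"
      then obtain p r where "p \<in> I (P 0) (Q 0)" "r \<in> I (P 2) (Q 2)" "d' p r \<le> \<Gamma>" using opp_close by blast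
      from opp_sum[OF this] have "d' x0 x2 + d' x1 x3 \<le> d' x0 x1 + d' x2 x3 + 2 * \<Gamma>"
        using len unfolding PQ(5,7) eqs eqs2 by simp
      then show ?thesis unfolding \<delta>'_def by linarith
    next
      assume "cross (5 * \<theta>1) (P 1) (Q 1) g \<and> cross (5 * \<theta>1) (P 3) (Q 3) g"
      then obtain p r where "p \<in> I (P 1) (Q 1)" "r \<in> I (P 3) (Q 3)" "d' p r \<le> \<Gamma>" using opp_close by blast
      from opp_sum[OF this] have "d' x1 x3 + d' x2 x0 \<le> d' x1 x2 + d' x3 x0 + 2 * \<Gamma>"
        using len unfolding PQ(6) eqs eqs2 by simp
      then show ?thesis using q.d_sym[of x2 x0] q.d_sym[of x3 x0] unfolding \<delta>'_def by linarith
    qed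
  next
    assume "\<exists>\<eta> z y. closed P Q \<eta> z y"
    \<comment> \<open>The old four-point condition applies to the corners \<open>z i\<close> of the
      closed polygon; each original side accounts for the two cut-off ends and the distance between
      consecutive corners up to \<open>2 * \<gamma>\<close>.\<close>
    then obtain \<eta> z y where c: "closed P Q \<eta> z y" by blast
    have sb: "sub (P i) (Q i) (\<eta> i) (z i) (y i)" if "i < 4" for i using c that by (auto simp: closed_def)
    have gp: "d (y i) (z (Suc i)) \<le> \<gamma>" if "i < 3" for i using c that by (auto simp: closed_def)
    have gp4: "d (y 0) (z 1) \<le> \<gamma>" "d (y 1) (z 2) \<le> \<gamma>" "d (y 2) (z 3) \<le> \<gamma>" "d (y 3) (z 0) \<le> \<gamma>"
      using gp[of 0] gp[of 1] gp[of 2] c by (simp_all add: closed_def eval_nat_numeral)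
    have side: "d' (P i) (z i) + d' (Q i) z' + d (z i) z' - 2 * \<gamma> \<le> d (P i) (Q i)"
      if i: "i < 4" and g: "d (y i) z' \<le> \<gamma>" for i z'
    proof -
      have e: "\<eta> i \<in> K'" using sb[OF i] by (simp add: sub_def)
      have "d' (P i) (z i) \<le> d (P i) (\<eta> i * z i)" using d'_le(1)[OF e] .
      moreover have "d' (Q i) (y i) \<le> d (\<eta> i * y i) (Q i)" using d'_le(1)[OF e, of "Q i" "y i"] d_sym[of "Q i"] by simp
      moreover have "d' (Q i) z' \<le> d' (Q i) (y i) + \<gamma>" using q.d_tri[of "Q i" z' "y i"] d'_le(2)[of "y i" z'] g by linarith
      moreover have "d (z i) z' \<le> d (z i) (y i) + \<gamma>" using d_tri[of "z i" z' "y i"] g by linarith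
      ultimately show ?thesis using sub_length[OF sb[OF i]] by linarith
    qed
    have "d' x0 (z 0) + d' x1 (z 1) + d (z 0) (z 1) - 2 * \<gamma> \<le> d' x0 x1"
      "d' x1 (z 1) + d' x2 (z 2) + d (z 1) (z 2) - 2 * \<gamma> \<le> d' x1 x2"
      "d' x2 (z 2) + d' x3 (z 3) + d (z 2) (z 3) - 2 * \<gamma> \<le> d' x2 x3"
      "d' x3 (z 3) + d' x0 (z 0) + d (z 3) (z 0) - 2 * \<gamma> \<le> d' x3 x0"
      using side[OF _ gp4(1)] side[OF _ gp4(2)] side[OF _ gp4(3)] side[OF _ gp4(4)] unfolding len unfolding PQ(5-7) eqs by simp_all
    moreover have "d' x0 x2 \<le> d' x0 (z 0) + d (z 0) (z 2) + d' x2 (z 2)" "d' x1 x3 \<le> d' x1 (z 1) + d (z 1) (z 3) + d' x3 (z 3)"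
      using q.d_tri[of x0 x2 "z 0"] q.d_tri[of "z 0" x2 "z 2"] d'_le(2)[of "z 0" "z 2"] q.d_sym[of "z 2" x2]
        q.d_tri[of x1 x3 "z 1"] q.d_tri[of "z 1" x3 "z 3"] d'_le(2)[of "z 1" "z 3"] q.d_sym[of "z 3" x3] by linarith+
    ultimately have "d' x0 x2 + d' x1 x3 \<le> d' x0 x1 + d' x2 x3 + (4 * \<gamma> + \<delta>) \<or> d' x0 x2 + d' x1 x3 \<le> d' x0 x3 + d' x1 x2 + (4 * \<gamma> + \<delta>)"
      using hyp4[of "z 0" "z 2" "z 1" "z 3"] d_sym[of "z 3" "z 0"] q.d_sym[of x3 x0] by argo
    then show ?thesis unfolding \<delta>'_def by linarith
  qed
qed

lemma delta'0: "0 \<le> \<delta>'"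
  unfolding \<delta>'_def using gamma0 delta0 by linarith

lemma hyp': "hyp \<nu>' \<delta>'"
  by (intro hyp.intro gnorm' hyp_axioms.intro) (use delta'0 four_point' in blast)+

lemma tame_refl: "tame x x"
  by (rule tame_ends) (use N_theta1 theta1 in simp)

text \<open>A bigon is a quadrilateral with two trivial sides. These cross no line, so there is no
  opposite crossing and the base corner stays uncut. Tame segments are therefore quasi-geodesics in
  the quotient.\<close>

lemma bigon:
  assumes "tame x y" shows "d x y \<le> 2 * d' x y + 4 * \<gamma>"
proof -
  obtain k where k: "k \<in> K'" "d y (k * x) = d' y x" "tame y (k * x)" by (rule lift_side)
  define P where "P = (!) [x, y, k * x, k * x]"
  define Q where "Q = (!) [y, k * x, k * x, k * x]"
  have PQ: "P 0 = x" "P 1 = y" "P 2 = k * x" "P 3 = k * x" "Q 0 = y" "Q 1 = k * x" "Q 2 = k * x" "Q 3 = k * x"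
    by (simp_all add: P_def Q_def eval_nat_numeral)
  have i4: "i = 0 \<or> i = 1 \<or> i = 2 \<or> i = 3" if "i < 4" for i :: nat using that by linarith
  have i3: "i = 0 \<or> i = 1 \<or> i = 2" if "i < 3" for i :: nat using that by linarith
  have nc: "\<not> cross c z z g" if "0 < c" for c z g using that by (auto simp: cross_def)
  have "opp P Q \<or> (\<exists>\<eta> z y. closed P Q \<eta> z y)"
  proof (rule engine_start[of P Q k])
    show "tame (P i) (Q i)" if "i < 4" for i using i4[OF that] assms k(3) tame_refl by (auto simp only: PQ)
    show "d (Q i) (P (Suc i)) = 0" if "i < 3" for i using i3[OF that] by (auto simp: P_def Q_def eval_nat_numeral simp del: d_K0)
    show "d (Q 3) (k * P 0) = 0" by (simp add: PQ del: d_K0)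
    show "k \<in> K'" by (rule k)
  qed
  moreover have "\<not> opp P Q" unfolding opp_def PQ using nc theta1 by simp
  ultimately obtain \<eta> z y' where c: "closed P Q \<eta> z y'" by blast
  have sb: "sub (P i) (Q i) (\<eta> i) (z i) (y' i)" if "i < 4" for i using c that by (auto simp: closed_def)
  have gr: "d (y' i) (z (Suc i)) \<le> \<gamma> \<and> d (\<eta> i * y' i) (Q i) \<le> 2 * d (P (Suc i)) (\<eta> (Suc i) * z (Suc i))" if "i < 3" for i
    using c that by (auto simp: closed_def)
  have s: "Suc 0 = 1" "Suc 1 = 2" "Suc 2 = 3" by simp_all
  have g: "d (y' 0) (z 1) \<le> \<gamma>" "d (y' 1) (z 2) \<le> \<gamma>" "d (y' 2) (z 3) \<le> \<gamma>" "d (y' 3) (z 0) \<le> \<gamma>"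
    using gr[of 0] gr[of 1] gr[of 2] c unfolding s closed_def by auto
  have r: "d (\<eta> 0 * y' 0) y \<le> 2 * d y (\<eta> 1 * z 1)"
    using gr[of 0] unfolding s PQ by simp
  have z0: "d x (\<eta> 0 * z 0) = 0" using c nc theta1 by (simp add: closed_def PQ del: d_K0)
  have l: "d x y = d x (\<eta> 0 * z 0) + d (z 0) (y' 0) + d (\<eta> 0 * y' 0) y"
    "d y (k * x) = d y (\<eta> 1 * z 1) + d (z 1) (y' 1) + d (\<eta> 1 * y' 1) (k * x)"
    "d (k * x) (k * x) = d (k * x) (\<eta> 2 * z 2) + d (z 2) (y' 2) + d (\<eta> 2 * y' 2) (k * x)"
    "d (k * x) (k * x) = d (k * x) (\<eta> 3 * z 3) + d (z 3) (y' 3) + d (\<eta> 3 * y' 3) (k * x)"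
    using sub_length[OF sb[of 0]] sub_length[OF sb[of 1]] sub_length[OF sb[of 2]] sub_length[OF sb[of 3]] unfolding PQ by simp_all
  have "d (z 2) (y' 2) = 0" "d (z 3) (y' 3) = 0"
    using l(3,4) d_refl[of "k * x"] d_nonneg[of "k * x" "\<eta> 2 * z 2"] d_nonneg[of "\<eta> 2 * y' 2" "k * x"] d_nonneg[of "z 2" "y' 2"]
      d_nonneg[of "k * x" "\<eta> 3 * z 3"] d_nonneg[of "\<eta> 3 * y' 3" "k * x"] d_nonneg[of "z 3" "y' 3"] by linarith+
  then have "d (z 0) (y' 0) \<le> d (z 1) (y' 1) + 4 * \<gamma>"
    using d_tri[of "y' 0" "z 0" "z 1"] d_tri[of "z 1" "z 0" "y' 1"] d_tri[of "y' 1" "z 0" "z 2"] d_tri[of "z 2" "z 0" "y' 2"]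
      d_tri[of "y' 2" "z 0" "z 3"] d_tri[of "z 3" "z 0" "y' 3"] d_sym[of "z 0" "y' 0"] g by linarith
  then show ?thesis using l(1,2) z0 r k(2) q.d_sym[of x y] d_nonneg[of "\<eta> 1 * y' 1" "k * x"] d_nonneg[of "z 1" "y' 1"] by linarith
qed

end

section \<open>Powers of minimal elements\<close>

context gnorm
begin

lemma d_pow: "d (h ^ m) (h ^ (m + n)) = real (\<nu> (h ^ n))"
  by (simp add: power_add d_right_mult)

text \<open>Dividing the exponent by \<open>s\<close> leaves a remainder of bounded length, which
  only enlarges the radius.\<close>

lemma wpd_power: assumes "wpd h" "0 < s" shows "wpd (h ^ s)"
  unfolding wpd_def
proof (intro allI)
  fix R M0
  define R' where "R' = R + 2 * (s * \<nu> h)"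
  obtain M where M: "M \<ge> M0 * s" "finK {f. \<nu> f \<le> R' \<and> \<nu> (inverse (h ^ M) * f * h ^ M) \<le> R'}"
    using assms(1) unfolding wpd_def by metis
  define q r where "q = M div s" and "r = M mod s"
  have r: "r < s" "M = q * s + r" using assms(2) by (simp_all add: q_def r_def)
  have q: "M0 \<le> q" using M(1) assms(2) by (simp add: q_def less_eq_div_iff_mult_less_eq)
  have hM: "h ^ M = (h ^ s) ^ q * h ^ r" by (simp add: r(2) power_add power_mult mult.commute[of q])
  have "\<nu> (inverse (h ^ M) * f * h ^ M) \<le> R'" if f: "\<nu> (inverse ((h ^ s) ^ q) * f * (h ^ s) ^ q) \<le> R" for f
  proof -
    have "inverse (h ^ M) * f * h ^ M = inverse (h ^ r) * (inverse ((h ^ s) ^ q) * f * (h ^ s) ^ q) * h ^ r"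
      by (simp add: hM mgs)
    then have "\<nu> (inverse (h ^ M) * f * h ^ M) \<le> \<nu> (h ^ r) + R + \<nu> (h ^ r)"
      using nu_mult[of "inverse (h ^ r) * (inverse ((h ^ s) ^ q) * f * (h ^ s) ^ q)" "h ^ r"]
        nu_mult[of "inverse (h ^ r)" "inverse ((h ^ s) ^ q) * f * (h ^ s) ^ q"] f by simp
    moreover have "\<nu> (h ^ r) \<le> s * \<nu> h"
      using nu_power[of h r] r(1) mult_right_mono[of r s "\<nu> h"] by linarith
    ultimately show ?thesis by (simp add: R'_def)
  qed
  then have "finK {f. \<nu> f \<le> R \<and> \<nu> (inverse ((h ^ s) ^ q) * f * (h ^ s) ^ q) \<le> R}"
    by (intro finK_subset[OF M(2)]) (auto simp: R'_def)
  then show "\<exists>M\<ge>M0. finK {f. \<nu> f \<le> R \<and> \<nu> (inverse ((h ^ s) ^ M) * f * (h ^ s) ^ M) \<le> R}" using q by blast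
qed

end

context hyp
begin

text \<open>Local to global: the backtracking in \<open>h * h\<close> is small against the length of
  \<open>h\<close>, so each further factor makes progress, and this excludes the wrong alternative
  of the four-point condition.\<close>

lemma quasi_add:
  assumes T: "2 * real (\<nu> h) \<le> real (\<nu> (h * h)) + T" and L: "T + 2 * \<delta> < real (\<nu> h)"
  shows "real (\<nu> (h ^ m)) + real (\<nu> (h ^ n)) \<le> real (\<nu> (h ^ (m + n))) + T + 2 * \<delta>"
proof -
  define f where "f n = real (\<nu> (h ^ n))" for n
  have f1: "f 1 = real (\<nu> h)" and f0: "f 0 = 0" and f2: "f 2 = real (\<nu> (h * h))"
    by (simp_all add: f_def power2_eq_square)
  have df: "d (h ^ m) (h ^ n) = f (n - m)" if "m \<le> n" for m n
    using d_pow[of h m "n - m"] that by (simp add: f_def)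
  have T0: "0 \<le> T" using T nu_mult[of h h] by linarith
  have P: "f n + f 1 - T - \<delta> \<le> f (Suc n)" for n
  proof (induction n)
    case 0
    then show ?case using f0 T0 delta0 by simp
  next
    case (Suc n)
    from hyp4[of "h ^ 0" "h ^ Suc n" "h ^ n" "h ^ Suc (Suc n)"]
    have "f (Suc n) + f 2 \<le> f n + f 1 + \<delta> \<or> f (Suc n) + f 2 \<le> f (Suc (Suc n)) + f 1 + \<delta>"
      using d_sym[of "h ^ Suc n" "h ^ n"] unfolding df[OF le0] by (simp add: df del: power_Suc power_0)
    then show ?case using Suc T L delta0 unfolding f1 f2 by argo
  qed
  show ?thesis
  proof (cases "n = 0")
    case True
    then show ?thesis using T0 delta0 by simp
  next
    case False
    then obtain k where n: "n = Suc k" by (cases n) auto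
    from hyp4[of "h ^ 0" "h ^ Suc m" "h ^ m" "h ^ (m + n)"]
    have "f (Suc m) + f n \<le> f m + f k + \<delta> \<or> f (Suc m) + f n \<le> f (m + n) + f 1 + \<delta>"
      using d_sym[of "h ^ Suc m" "h ^ m"] unfolding df[OF le0] by (simp add: df n del: power_Suc power_0)
    then have "f m + f n \<le> f (m + n) + T + 2 * \<delta>" using P[of m] P[of k] L delta0 unfolding n f1 by linarith
    then show ?thesis by (simp add: f_def)
  qed
qed

text \<open>If the geodesics \<open>[1, h]\<close> and \<open>[h, h * h]\<close> ran together too
  long near \<open>h\<close>, the point at distance \<open>s\<close> from \<open>1\<close>, with
  \<open>s\<close> the least integer above \<open>\<delta>\<close>, would be moved by less than the
  minimum.\<close>

lemma no_backtrack:
  assumes min: "\<And>x. real (\<nu> h) \<le> d x (h * x)" and L: "2 * \<delta> + 2 \<le> real (\<nu> h)"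
  shows "2 * real (\<nu> h) \<le> real (\<nu> (h * h)) + (2 * \<delta> + 2)"
proof (rule ccontr)
  assume c: "\<not> ?thesis"
  define L where "L = real (\<nu> h)"
  define s where "s = real (nat \<lfloor>\<delta>\<rfloor> + 1)"
  have s: "\<delta> < s" "s \<le> \<delta> + 1" "0 \<le> s" unfolding s_def using delta0 by (simp_all, linarith+)
  have sN: "s \<in> \<nat>" unfolding s_def by (rule of_nat_in_Nats)
  have dL: "d 1 h = L" "d h (h * h) = L" by (simp_all add: L_def d_one d_right_mult)
  obtain q' where q': "q' \<in> I 1 h" "d 1 q' = s" using geod_point[of s 1 h] s sN L dL unfolding L_def by auto
  have q'h: "d q' h = L - s" using q' dL by (simp add: I_iff)
  have "L - 2 * s \<in> \<nat>"
  proof -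
    have "L - 2 * s = real (\<nu> h - 2 * (nat \<lfloor>\<delta>\<rfloor> + 1))"
      using L s(2) unfolding s_def L_def by (subst of_nat_diff) auto
    then show ?thesis by simp
  qed
  then obtain q where q: "q \<in> I q' h" "d q' q = L - 2 * s"
    using geod_point[of "L - 2 * s" q' h] q'h s L unfolding L_def by auto
  have qh: "d q h = s" using q q'h by (simp add: I_iff)
  have q1: "d 1 q = L - s" using I_sub2[OF q'(1) q(1)] qh dL by (simp add: I_iff)
  define y where "y = h * q'"
  have y: "d h y = s" "d y (h * h) = L - s"
    using q'(2) q'h d_left[of h 1 q'] d_left[of h q' h] by (simp_all add: y_def)
  have h2: "d 1 (h * h) < 2 * L - 2 * s" using c s(2) by (simp add: d_one L_def)
  have 1: "d q (h * h) \<le> L - s + \<delta>"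
    using hyp4[of q "h * h" 1 h] h2 qh q1 dL d_sym[of q 1] d_sym[of "h * h" h] by linarith
  have "d q y \<le> 2 * \<delta>"
    using hyp4[of q y "h * h" h] 1 qh y dL d_sym[of "h * h" h] d_sym[of "h * h" y] d_sym[of h y] delta0 by argo
  then have "d q' y \<le> L - 2 * s + 2 * \<delta>" using d_tri[of q' y q] q(2) by linarith
  then show False using min[of q'] s(1) unfolding y_def L_def by linarith
qed

text \<open>If doubling the exponent never gained more than \<open>2 * \<delta>\<close>, the length
  of \<open>h ^ (2 ^ k)\<close> would grow only linearly in \<open>k\<close>, against
  loxodromy.\<close>

lemma axis_exists:
  assumes "lox h" "wpd h"
  shows "\<exists>s>0. \<exists>\<kappa>. axis \<nu> \<delta> (h ^ s) \<kappa> \<and> wpd (h ^ s)"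
proof -
  define f where "f n = real (\<nu> (h ^ n))" for n
  obtain c where c: "0 < c" "\<And>n. c * real n \<le> f n" using assms(1) by (auto simp: lox_def f_def)
  have "\<exists>s>0. f s + 2 * \<delta> < f (2 * s)"
  proof (rule ccontr)
    assume "\<not> ?thesis"
    then have n: "f (2 * s) \<le> f s + 2 * \<delta>" if "0 < s" for s using that not_less by blast
    have "f (2 ^ k) \<le> f 1 + 2 * \<delta> * real k" for k
    proof (induction k)
      case (Suc k)
      then show ?case using n[of "2 ^ k"] by (simp add: algebra_simps)
    qed simp
    then have up: "c * 2 ^ k \<le> f 1 + 2 * \<delta> * real k" for k using c(2)[of "2 ^ k"] by (simp add: order_trans)
    obtain j where j: "4 * \<delta> + f 1 + 1 \<le> c * real j"
      using reals_Archimedean3[OF c(1)] by (metis less_imp_le mult.commute)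
    have f1: "0 \<le> f 1" by (simp add: f_def)
    have j1: "1 \<le> real j" using j f1 delta0 by (cases j) auto
    have j2: "real j \<le> 2 ^ j" using of_nat_less_two_power[of j, where 'a = real] by simp
    have "real j * (4 * \<delta> + f 1 + 1) \<le> real j * (c * 2 ^ j)"
      by (rule mult_left_mono) (use j j1 mult_left_mono[OF j2, of c] c(1) in linarith)+
    also have "\<dots> \<le> 2 ^ j * (c * 2 ^ j)" by (rule mult_right_mono[OF j2]) (use c(1) in simp)
    also have "\<dots> = c * 2 ^ (2 * j)" by (simp add: mult_2 power_add)
    also have "\<dots> \<le> f 1 + 2 * \<delta> * real (2 * j)" by (rule up)
    also have "\<dots> = f 1 + 4 * \<delta> * real j" by simp
    finally have "real j * (f 1 + 1) \<le> f 1" by (simp add: algebra_simps)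
    moreover have "1 * (f 1 + 1) \<le> real j * (f 1 + 1)" using j1 f1 by (intro mult_right_mono) auto
    ultimately have "1 * (f 1 + 1) \<le> f 1" by (meson order_trans)
    then show False by simp
  qed
  then obtain s where s: "0 < s" "f s + 2 * \<delta> < f (2 * s)" by blast
  define T where "T = 2 * f s - f (2 * s)"
  have fs: "real (\<nu> (h ^ s)) = f s" "real (\<nu> (h ^ s * h ^ s)) = f (2 * s)"
    by (simp_all add: f_def mult_2 power_add)
  have qa: "f (s * m) + f (s * n) \<le> f (s * (m + n)) + T + 2 * \<delta>" for m n
    using quasi_add[of "h ^ s" T m n] s(2) unfolding fs by (simp add: T_def f_def power_mult)
  define \<kappa> where "\<kappa> = max \<delta> (T + 2 * \<delta>)"
  \<comment> \<open>The defect \<open>\<kappa>\<close> is the same for all further powers, so a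
    large power makes it relatively small.\<close>
  obtain r where r: "100 * \<kappa> + 1 \<le> c * real r"
    using reals_Archimedean3[OF c(1)] by (metis less_imp_le mult.commute)
  have k0: "0 \<le> \<kappa>" using delta0 by (simp add: \<kappa>_def)
  have r0: "0 < r" using r k0 by (cases r) auto
  define s' where "s' = s * r"
  have big: "100 * \<kappa> + 1 \<le> f s'"
  proof -
    have "r \<le> s'" using s(1) by (simp add: s'_def)
    then have "c * real r \<le> c * real s'" using c(1) by (intro mult_left_mono) simp_all
    then show ?thesis using c(2)[of s'] r by linarith
  qed
  have "axis \<nu> \<delta> (h ^ s') \<kappa>"
  proof unfold_locales
    show "real (\<nu> ((h ^ s') ^ m)) + real (\<nu> ((h ^ s') ^ n)) \<le> real (\<nu> ((h ^ s') ^ (m + n))) + \<kappa>" for m n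
      using qa[of "r * m" "r * n"] unfolding f_def s'_def
      by (simp add: \<kappa>_def distrib_left mult.assoc flip: power_mult)
    show "\<delta> \<le> \<kappa>" by (simp add: \<kappa>_def)
    show "100 * \<kappa> \<le> real (\<nu> (h ^ s'))" using big by (simp add: f_def)
    show "0 < \<nu> (h ^ s')" using big k0 by (auto simp: f_def intro: Nat.gr0I)
  qed
  moreover have "0 < s'" using s(1) r0 by (simp add: s'_def)
  ultimately show ?thesis using wpd_power[OF assms(2)] by blast
qed

end

context wind
begin

interpretation q: hyp \<nu>' \<delta>' by (rule hyp')

section \<open>Lines crossed by a segment, and elements of minimal length\<close>

lemma b_one: "b 1 = 0"
proof -
  have "d 1 (W (b 1)) \<le> 0" using b_min[of 1 0] by simp
  then have "A (b 1) \<le> real_of_int 0 * a" using d_W[of 0 "b 1"] by simp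
  from A_indexi[OF this] show ?thesis by simp
qed

lemma B_near: "B g (near g x) = B g x"
  unfolding near_def B_line b_one by simp

text \<open>Two such lines with equal distances from \<open>x\<close> and from \<open>y\<close> have
  close feet at both ends, hence overlap by more than \<open>\<theta>\<close> and are equivalent;
  only finitely many pairs of distances occur.\<close>

lemma finite_lines:
  "\<exists>G. finite G \<and> (\<forall>g. 5 * \<theta>1 \<le> \<bar>B g x - B g y\<bar> \<longrightarrow> (\<exists>h\<in>G. sim h g))"
proof -
  obtain n p where n: "d x y = real n" and p: "\<And>t. t \<le> n \<Longrightarrow> p t \<in> I x y \<and> d x (p t) = real t"
    using geod_path'[of x y] by metis
  define S where "S = {g. 5 * \<theta>1 \<le> \<bar>B g x - B g y\<bar>}"
  define \<phi> where "\<phi> g = (dist g x, dist g y)" for g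
  have le: "dist g x \<le> real n" "dist g y \<le> real n" if "g \<in> S" for g
    using dist_le_d[of g x y] dist_le_d[of g y x] that d_sym[of x y] n theta1 unfolding S_def by auto
  have nat: "\<exists>m. dist g z = real m" for g z by (simp add: dist_def d_Ints)
  have "\<phi> g \<in> real ` {..n} \<times> real ` {..n}" if g: "g \<in> S" for g
  proof -
    obtain i j where "dist g x = real i" "dist g y = real j" using nat by metis
    then show ?thesis using le[OF g] by (auto simp: \<phi>_def)
  qed
  then have "\<phi> ` S \<subseteq> real ` {..n} \<times> real ` {..n}" by blast
  then have "finite (\<phi> ` S)" using finite_subset by blast
  then obtain G where G: "G \<subseteq> S" "finite G" "\<phi> ` S = \<phi> ` G"
    by (metis finite_subset_image order_refl)
  have "\<exists>h\<in>G. sim h g" if g: "g \<in> S" for g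
  proof -
    obtain h where h: "h \<in> G" "\<phi> h = \<phi> g" using G(3) g by (metis imageE imageI)
    then have hS: "h \<in> S" using G(1) by blast
    have far: "3 \<le> \<bar>B g x - B g y\<bar>" "3 \<le> \<bar>B h x - B h y\<bar>" "3 \<le> \<bar>B g y - B g x\<bar>" "3 \<le> \<bar>B h y - B h x\<bar>"
      using g hS theta1 unfolding S_def by auto
    obtain i where i: "dist g x = real i" using nat by blast
    obtain j where j: "dist g y = real j" using nat by blast
    have ij: "i \<le> n" "j \<le> n" using le[OF g] i j by auto
    have hd: "dist h x = real i" "dist h y = real j" using h(2) i j by (auto simp: \<phi>_def)
    have "d (p i) (near g x) \<le> 6 * a" "d (p i) (near h x) \<le> 6 * a"
      using near_line[OF far(1), of "p i"] near_line[OF far(2), of "p i"] p[OF ij(1)] i hd by auto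
    then have 1: "d (near g x) (near h x) \<le> real_of_int 12 * a"
      using d_tri[of "near g x" "near h x" "p i"] d_sym[of "near g x" "p i"] by simp
    have "p (n - j) \<in> I y x" "d y (p (n - j)) = real j"
    proof -
      have "p (n - j) \<in> I x y" "d x (p (n - j)) = real (n - j)" using p[of "n - j"] by auto
      then show "p (n - j) \<in> I y x" "d y (p (n - j)) = real j"
        using I_sym n ij(2) d_sym[of y "p (n - j)"] by (auto simp: I_iff of_nat_diff)
    qed
    then have "d (p (n - j)) (near g y) \<le> 6 * a" "d (p (n - j)) (near h y) \<le> 6 * a"
      using near_line[OF far(3), of "p (n - j)"] near_line[OF far(4), of "p (n - j)"] j hd by auto
    then have 2: "d (near g y) (near h y) \<le> real_of_int 12 * a"
      using d_tri[of "near g y" "near h y" "p (n - j)"] d_sym[of "near g y" "p (n - j)"] by simp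
    have "\<bar>B h (near g x) - B h x\<bar> \<le> 18" "\<bar>B h (near g y) - B h y\<bar> \<le> 18"
      using B_Lipi[OF 1, of h] B_Lipi[OF 2, of h] unfolding B_near by simp_all
    moreover have "5 * \<theta>1 \<le> \<bar>B h x - B h y\<bar>" using hS by (simp add: S_def)
    ultimately have "\<theta> < \<bar>B h (near g x) - B h (near g y)\<bar>" using theta1 \<theta>1_def theta0 by linarith
    then have "sim h g" using proj_bounded[of h g "B g x" "B g y"] unfolding near_def by linarith
    then show ?thesis using h(1) by blast
  qed
  then show ?thesis using G(2) unfolding S_def by blast
qed

lemma W_N_K': "W (N * i) \<in> K'"
  using subgrp_zpow[OF subgrp_K' u_K'[of 1], of i] by (simp add: zpow_u)

text \<open>A conjugate of \<open>h\<close> lies in \<open>E\<close>, where the powers of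
  \<open>w ^ N\<close>, trivial in the quotient, have finite index modulo \<open>K\<close>.\<close>

lemma torsion_sim:
  assumes "sim g (h * g)" shows "q.torsion h"
proof -
  define f where "f = inverse g * h * g"
  have f: "f \<in> E" using assms by (simp add: f_def sim_def mgs)
  have fp: "f ^ n \<in> E" for n
  proof (induction n)
    case 0 then show ?case using E_one by simp
  next
    case (Suc n) then show ?case using E_mult[OF f] by simp
  qed
  have N0': "0 < N" using N_theta1 theta1 by linarith
  obtain F where F: "finite F" "\<And>f. f \<in> E \<Longrightarrow> \<exists>i. \<exists>e\<in>F. eqK f (W (N * i) * e)"
    using E_cosets[OF N0'] by blast
  obtain i e where ie: "\<And>n. e n \<in> F \<and> eqK (f ^ n) (W (N * i n) * e n)" using F(2)[OF fp] by metis
  have "\<not> inj e"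
    using F(1) ie by (metis finite_imageD finite_subset image_subsetI infinite_UNIV_nat)
  then obtain m n where mn: "m < n" "e m = e n" unfolding inj_def by (metis linorder_neq_iff)
  have "eqK (f ^ n * inverse (f ^ m)) (W (N * i n) * e n * inverse (W (N * i m) * e m))"
    using eqK_mult[OF conjunct2[OF ie[of n]] eqK_inv[OF conjunct2[OF ie[of m]]]] .
  moreover have "W (N * i n) * e n * inverse (W (N * i m) * e m) = W (N * (i n - i m))"
    by (simp add: mn(2) mgs right_diff_distrib zpow_diff)
  moreover have "f ^ n = f ^ (n - m) * f ^ m" using mn(1) by (simp flip: power_add)
  ultimately have "eqK (f ^ (n - m)) (W (N * (i n - i m)))" by (simp add: mgs)
  then have "f ^ (n - m) \<in> K'" using eqK_subgrp[OF _ subgrp_K' K_K' W_N_K'] by blast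
  moreover have "f ^ k = inverse g * h ^ k * g" for k
    using zpow_conj[of "inverse g" h "int k"] by (simp add: f_def zpow_of_nat)
  ultimately have "inverse g * h ^ (n - m) * g \<in> K'" by simp
  from K'_conj[OF this, of g] have "h ^ (n - m) \<in> K'" by (simp add: mgs)
  then show ?thesis unfolding q.torsion_def q.K_def using mn(1) by (auto simp: nu'_zero intro!: exI[of _ "n - m"])
qed

text \<open>A discrete intermediate value argument: the first point of a path satisfying the second
  alternative is an end or one step after a point satisfying the first, and a step changes a
  projection by at most 6.\<close>

lemma path_transition:
  assumes all: "\<And>x. \<bar>B g x - c'\<bar> \<le> \<theta>1 \<or> \<bar>B g (h * x) - c\<bar> \<le> \<theta>1"
    and pa: "\<bar>B g x - c'\<bar> \<le> \<theta>1 \<and> \<bar>B g (h * y) - c\<bar> \<le> \<theta>1 \<or> \<bar>B g y - c'\<bar> \<le> \<theta>1 \<and> \<bar>B g (h * x) - c\<bar> \<le> \<theta>1"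
  shows "\<exists>p\<in>I x y. \<bar>B g p - c'\<bar> \<le> \<theta>1 + 6 \<and> \<bar>B g (h * p) - c\<bar> \<le> \<theta>1"
proof -
  define aa bb where "aa x \<longleftrightarrow> \<bar>B g x - c'\<bar> \<le> \<theta>1" and "bb x \<longleftrightarrow> \<bar>B g (h * x) - c\<bar> \<le> \<theta>1" for x
  have main: "\<exists>p\<in>I x y. \<bar>B g p - c'\<bar> \<le> \<theta>1 + 6 \<and> bb p" if ab: "aa x" "bb y" for x y
  proof -
    obtain n p where p: "p 0 = x" "d (p n) y = 0" "\<And>t. t \<le> n \<Longrightarrow> p t \<in> I x y \<and> d x (p t) = real t"
      "\<And>t. t < n \<Longrightarrow> d (p t) (p (Suc t)) = 1" using geod_path'[of x y] by metis
    have "d (h * p n) (h * y) = 0" using p(2) unfolding d_left .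
    then have bn: "bb (p n)" using ab(2) B_cong[of "h * p n" "h * y" g] unfolding bb_def by simp
    define t where "t = (LEAST t. bb (p t))"
    have t: "bb (p t)" unfolding t_def by (rule LeastI[of "\<lambda>t. bb (p t)" n]) (rule bn)
    have tn: "t \<le> n" unfolding t_def by (rule Least_le) (rule bn)
    have "\<bar>B g (p t) - c'\<bar> \<le> \<theta>1 + 6"
    proof (cases t)
      case 0
      then show ?thesis using ab(1) p(1) by (simp add: aa_def)
    next
      case (Suc s)
      then have "\<not> bb (p s)" using not_less_Least[of s "\<lambda>t. bb (p t)"] unfolding t_def by simp
      then have "aa (p s)" using all unfolding aa_def bb_def by blast
      moreover have "\<bar>B g (p s) - B g (p t)\<bar> \<le> 6" using B_Lip1[of "p s" "p t" g] p(4)[of s] Suc tn by simp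
      ultimately show ?thesis unfolding aa_def by linarith
    qed
    then show ?thesis using t p(3)[OF tn] by blast
  qed
  show ?thesis using main[of x y] main[of y x] pa I_sym[of x y] unfolding aa_def bb_def by blast
qed

text \<open>As \<open>d x (k * h * x)\<close> is the length of a conjugate of \<open>k * h\<close>,
  the element \<open>h\<close> is shortest among all conjugates modulo \<open>K'\<close>.\<close>

definition minimal :: "'a \<Rightarrow> bool" where
  "minimal h \<longleftrightarrow> (\<forall>x. \<forall>k\<in>K'. real (\<nu> h) \<le> d x (k * h * x))"

text \<open>A point between consecutive powers of \<open>h\<close> is moved by exactly the minimal
  amount, so its image is nearest in its \<open>K'\<close>-orbit and \<open>short_tame\<close>
  applies.\<close>

lemma minimal_step:
  assumes "minimal h" "p \<in> I (h ^ m) (h ^ Suc m)"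
  shows "2 * \<bar>B g p - B g (h * p)\<bar> \<le> N + 6" "d p (h * p) = real (\<nu> h)"
proof -
  have "d p (h * p) \<le> d p (h ^ Suc m) + d (h ^ Suc m) (h * p)" by (rule d_tri)
  also have "d (h ^ Suc m) (h * p) = d (h ^ m) p" by simp
  also have "d p (h ^ Suc m) + d (h ^ m) p = d (h ^ m) (h ^ Suc m)" using assms(2) by (simp add: I_iff)
  also have "\<dots> = real (\<nu> h)" using d_pow[of h m 1] by simp
  finally have le: "d p (h * p) \<le> real (\<nu> h)" .
  have mn: "real (\<nu> h) \<le> d p (k * (h * p))" if "k \<in> K'" for k
    using assms(1) that unfolding minimal_def by (simp add: mult.assoc)
  show "2 * \<bar>B g p - B g (h * p)\<bar> \<le> N + 6" by (rule short_tame) (use le mn in fastforce)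
  show "d p (h * p) = real (\<nu> h)" using le mn[OF subgrp_one[OF subgrp_K']] by simp
qed

lemma near_between:
  assumes "d x y + d y z \<le> d x z + C" "3 \<le> \<bar>B g x - B g y\<bar>" "3 \<le> \<bar>B g y - B g z\<bar>"
  shows "2 * dist g y \<le> C + 10 * a"
proof -
  have "A (B g x - B g z) \<le> A (B g x - B g y) + A (B g y - B g z)"
    using A_tri[of "B g x - B g y" "B g y - B g z"] by simp
  then show ?thesis using line_lower[OF assms(2)] line_lower[OF assms(3)] line_upper[of x z g] assms(1) by linarith
qed

text \<open>Points almost on the way from \<open>x\<close> to \<open>z\<close> that project away
  from both ends lie near the line, so their distance is controlled by their projections.\<close>

lemma cross_near:
  assumes y: "d x y + d y z \<le> d x z + 3 * a" and y': "d x y' + d y' z \<le> d x z + 3 * a"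
    and c: "\<bar>B g y - c\<bar> \<le> 3 * \<theta>1 + 6" "\<bar>B g y' - c\<bar> \<le> 3 * \<theta>1 + 6"
    and far: "4 * \<theta>1 \<le> \<bar>B g x - c\<bar>" "4 * \<theta>1 \<le> \<bar>B g z - c\<bar>"
  shows "d y y' \<le> 9 * real_of_int \<theta>1 * a"
proof -
  have f: "3 \<le> \<bar>B g x - B g y\<bar>" "3 \<le> \<bar>B g y - B g z\<bar>" "3 \<le> \<bar>B g x - B g y'\<bar>" "3 \<le> \<bar>B g y' - B g z\<bar>"
    using c far theta1 by linarith+
  have "\<bar>B g y - B g y'\<bar> \<le> 6 * \<theta>1 + 12" using c by linarith
  then have "real_of_int \<bar>B g y - B g y'\<bar> \<le> real_of_int (6 * \<theta>1 + 12)" by (simp only: of_int_le_iff)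
  then have 1: "A (B g y - B g y') \<le> real_of_int (6 * \<theta>1 + 12) * a"
    using A_upper[of "B g y - B g y'"] a1 mult_right_mono[of "real_of_int \<bar>B g y - B g y'\<bar>" "real_of_int (6 * \<theta>1 + 12)" a] by linarith
  have 2: "10 * a \<le> real_of_int \<theta>1 * a" by (rule mult_right_mono) (use theta1 a1 in auto)
  have "d y y' \<le> dist g y + A (B g y - B g y') + dist g y'" by (rule line_upper)
  moreover have "real_of_int (6 * \<theta>1 + 12) * a = 6 * (real_of_int \<theta>1 * a) + 12 * a" "9 * real_of_int \<theta>1 * a = 9 * (real_of_int \<theta>1 * a)" by (simp_all add: algebra_simps)
  ultimately show ?thesis using near_between[OF y f(1,2)] near_between[OF y' f(3,4)] 1 2 a1 by argo
qed

lemma ind_switch: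
  fixes Pa Pb :: "nat \<Rightarrow> bool"
  assumes "\<And>n. Pa n \<or> Pb n" "Pa 0" "Pb n"
  shows "\<exists>m\<le>n. Pa m \<and> (Pb m \<or> (m < n \<and> Pb (Suc m)))"
proof -
  define t where "t = (LEAST t. Pb t)"
  have t: "Pb t" unfolding t_def by (rule LeastI[of Pb n]) (rule assms)
  have tn: "t \<le> n" unfolding t_def by (rule Least_le) (rule assms)
  show ?thesis
  proof (cases t)
    case 0 then show ?thesis using t assms(2) by auto
  next
    case (Suc s)
    then have "\<not> Pb s" using not_less_Least[of s Pb] unfolding t_def by simp
    then have "Pa s" using assms(1) by blast
    then show ?thesis using t tn Suc by (intro exI[of _ s]) auto
  qed
qed

text \<open>As \<open>g\<close> and \<open>h * g\<close> are inequivalent, Behrstock's inequality shows that for every \<open>x\<close> the step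
  from \<open>x\<close> to \<open>h * x\<close> starts near \<open>c'\<close> or ends near \<open>c\<close> in the projection to \<open>g\<close>.  The only bad pattern
  is a large step ending in \<open>c\<close>, followed later by a large step starting from the nearby \<open>c'\<close>; it
  would make \<open>h\<close> move some point near the line by less than its translation length.\<close>

lemma axis_step_bound:
  assumes min: "minimal h" and ns: "\<And>g. \<not> sim g (h * g)"
  shows "2 * \<bar>B g 1 - B g (h ^ n)\<bar> \<le> N + 37 * \<theta>1"
proof (cases n)
  case 0
  then show ?thesis using N_theta1 theta1 by simp
next
  case (Suc n')
  define c where "c = B g (h * g)"
  define c' where "c' = B (h * g) g"
  define x where "x i = h ^ i" for i
  define \<beta> where "\<beta> i = B g (x i)" for i
  have hx: "h * x i = x (Suc i)" for i by (simp add: x_def)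
  have all: "\<bar>B g y - c'\<bar> \<le> \<theta>1 \<or> \<bar>B g (h * y) - c\<bar> \<le> \<theta>1" for y
    using behrstock_theta1[OF ns, of g "h * y"] unfolding c_def c'_def B_left by blast
  define Pa Pb where "Pa i \<longleftrightarrow> \<bar>\<beta> i - c'\<bar> \<le> \<theta>1" and "Pb i \<longleftrightarrow> \<bar>\<beta> (Suc i) - c\<bar> \<le> \<theta>1" for i
  have ab: "Pa i \<or> Pb i" for i using all[of "x i"] unfolding Pa_def Pb_def \<beta>_def hx .
  have xI: "x i \<in> I (h ^ i) (h ^ Suc i)" for i by (simp add: x_def)
  have st: "2 * \<bar>\<beta> i - \<beta> (Suc i)\<bar> \<le> N + 6" for i
    using minimal_step(1)[OF min xI[of i], of g] unfolding hx \<beta>_def .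
  have sw: "2 * \<bar>c - c'\<bar> \<le> N + 18 + 4 * \<theta>1"
    if "p \<in> I (h ^ i) (h ^ Suc i)" "\<bar>B g p - c'\<bar> \<le> \<theta>1 + 6" "\<bar>B g (h * p) - c\<bar> \<le> \<theta>1" for p i
    using minimal_step(1)[OF min that(1), of g] that(2,3) by (smt (verit))
  have goal: "2 * \<bar>\<beta> 0 - \<beta> n\<bar> \<le> N + 37 * \<theta>1"
  proof -
    consider "Pa 0" "Pa n'" | "Pb 0" "Pb n'" | "Pa 0" "Pb n'" | "\<not> Pa 0" "\<not> Pb n'" "Pb 0" "Pa n'" using ab by blast
    then show ?thesis
    proof cases
      case 1
      then have "\<bar>\<beta> 0 - c'\<bar> \<le> \<theta>1" "\<bar>\<beta> n' - c'\<bar> \<le> \<theta>1" by (auto simp: Pa_def)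
      then show ?thesis using st[of n'] theta1 unfolding Suc by (smt (verit))
    next
      case 2
      then have "\<bar>\<beta> (Suc 0) - c\<bar> \<le> \<theta>1" "\<bar>\<beta> n - c\<bar> \<le> \<theta>1" by (auto simp: Pb_def Suc)
      then show ?thesis using st[of 0] theta1 by (smt (verit))
    next
      case 3
      obtain m where m: "m \<le> n'" "Pa m" "Pb m \<or> (m < n' \<and> Pb (Suc m))"
        using ind_switch[of Pa Pb n'] ab 3 by blast
      have "2 * \<bar>c - c'\<bar> \<le> N + 18 + 4 * \<theta>1"
      proof (cases "Pb m")
        case True
        then show ?thesis using sw[OF xI[of m]] m(2) unfolding Pa_def Pb_def \<beta>_def hx by simp
      next
        case False
        then have "\<exists>p\<in>I (x m) (x (Suc m)). \<bar>B g p - c'\<bar> \<le> \<theta>1 + 6 \<and> \<bar>B g (h * p) - c\<bar> \<le> \<theta>1"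
          using m path_transition[OF all, of "x m" "x (Suc m)"] unfolding Pa_def Pb_def \<beta>_def hx by blast
        then show ?thesis using sw[of _ m] unfolding x_def by blast
      qed
      moreover have "\<bar>\<beta> 0 - c'\<bar> \<le> \<theta>1" "\<bar>\<beta> n - c\<bar> \<le> \<theta>1" using 3 by (auto simp: Pa_def Pb_def Suc)
      ultimately show ?thesis using theta1 by (smt (verit))
    next
      case 4
      then have "n' \<noteq> 0" by metis
      have "\<exists>m<n'. Pb m \<and> Pa (Suc m)"
      proof -
        define t where "t = (LEAST t. Pa t)"
        have t: "Pa t" unfolding t_def by (rule LeastI[of Pa n']) (rule 4)
        have tn: "t \<le> n'" unfolding t_def by (rule Least_le) (rule 4)
        obtain s where s: "t = Suc s" using t 4 by (cases t) auto
        then have "\<not> Pa s" using not_less_Least[of s Pa] unfolding t_def by simp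
        then show ?thesis using ab[of s] t tn s by (intro exI[of _ s]) auto
      qed
      then obtain m where m: "m < n'" "Pb m" "Pa (Suc m)" by blast
      then have cc: "\<bar>c - c'\<bar> \<le> 2 * \<theta>1" unfolding Pa_def Pb_def by linarith
      have b1: "\<bar>\<beta> (Suc 0) - c\<bar> \<le> \<theta>1" "\<bar>\<beta> n' - c'\<bar> \<le> \<theta>1" using 4 by (auto simp: Pa_def Pb_def)
      then have b1': "\<bar>\<beta> n' - c\<bar> \<le> 3 * \<theta>1" using cc by linarith
      show ?thesis
      proof (cases "\<bar>\<beta> 0 - c\<bar> < 4 * \<theta>1 \<or> \<bar>\<beta> n - c\<bar> < 4 * \<theta>1")
        case True
        then show ?thesis using st[of 0] st[of n'] b1 b1' theta1 N_theta1 unfolding Suc by (smt (verit))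
      next
        case False
        then have far: "4 * \<theta>1 \<le> \<bar>\<beta> 0 - c\<bar>" "4 * \<theta>1 \<le> \<bar>\<beta> n - c\<bar>" by linarith+
        show ?thesis
        \<comment> \<open>A short translation length makes each step small in projection. A long one
          makes the powers of \<open>h\<close> a quasi-geodesic, which cannot return to the same
          place near \<open>c\<close>.\<close>
        proof (cases "real (\<nu> h) \<le> 10 * real_of_int \<theta>1 * a")
          case True
          have "d (x i) (x (Suc i)) \<le> real_of_int (10 * \<theta>1) * a" for i
            using True d_pow[of h i 1] by (simp add: x_def)
          note L = B_Lipi[OF this, of g]
          have "99 * v \<le> 100 * (10 * \<theta>1 + 5) \<Longrightarrow> v \<le> 11 * \<theta>1" for v using theta1 by (smt (verit))
          then have "\<bar>\<beta> i - \<beta> (Suc i)\<bar> \<le> 11 * \<theta>1" for i using L[of i] unfolding \<beta>_def by blast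
          from this[of 0] this[of n'] show ?thesis using b1 b1' N_theta1 theta1 unfolding Suc by (smt (verit))
        next
          case False
          have t10: "10 * a \<le> real_of_int \<theta>1 * a" by (rule mult_right_mono) (use theta1 a1 in auto)
          have big: "10 * real_of_int \<theta>1 * a < real (\<nu> h)" using False by linarith
          have big': "100 * a < real (\<nu> h)" using big t10 by argo
          have nb: "2 * real (\<nu> h) \<le> real (\<nu> (h * h)) + (2 * \<delta> + 2)"
          proof (rule no_backtrack)
            show "real (\<nu> h) \<le> d x (h * x)" for x
              using min subgrp_one[OF subgrp_K'] unfolding minimal_def by fastforce
            show "2 * \<delta> + 2 \<le> real (\<nu> h)" using big' delta_a a1 by argo
          qed
          have qa: "real (\<nu> (h ^ i)) + real (\<nu> (h ^ j)) \<le> real (\<nu> (h ^ (i + j))) + 3 * a" for i j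
            using quasi_add[OF nb, of i j] big' delta_a a1 by argo
          have dx: "d (x i) (x (i + j)) = real (\<nu> (h ^ j))" for i j unfolding x_def by (rule d_pow)
          have bet: "d (x 0) (x i) + d (x i) (x n) \<le> d (x 0) (x n) + 3 * a" if "i \<le> n" for i
            using dx[of 0 i] dx[of i "n - i"] dx[of 0 n] qa[of i "n - i"] that by simp
          show ?thesis
          \<comment> \<open>With only two steps, \<open>x 1\<close> and \<open>x n'\<close>
            coincide; a point \<open>p\<close> inside the first step and its image then replace
            them.\<close>
          proof (cases "n' = 1")
            case n1: True
            have "\<exists>p\<in>I (x 0) (x 1). \<bar>B g p - c'\<bar> \<le> \<theta>1 + 6 \<and> \<bar>B g (h * p) - c\<bar> \<le> \<theta>1"
              using path_transition[OF all, of "x 0" "x 1"] 4 n1 unfolding Pa_def Pb_def \<beta>_def hx by simp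
            then obtain p where p: "p \<in> I (x 0) (x 1)" "\<bar>B g p - c'\<bar> \<le> \<theta>1 + 6" "\<bar>B g (h * p) - c\<bar> \<le> \<theta>1" by blast
            have n2: "n = 2" using n1 Suc by simp
            have b: "d (x 0) (x 1) + d (x 1) (x 2) \<le> d (x 0) (x 2) + 3 * a" using bet[of 1] n2 by simp
            have hp: "h * p \<in> I (x 1) (x 2)" using I_left[OF p(1), of h] unfolding hx by (simp add: eval_nat_numeral)
            have "d p (h * p) \<le> 9 * real_of_int \<theta>1 * a"
            proof (rule cross_near[of "x 0" p "x 2"])
              show "d (x 0) p + d p (x 2) \<le> d (x 0) (x 2) + 3 * a"
                using p(1) d_tri[of p "x 2" "x 1"] b unfolding I_iff by linarith
              show "d (x 0) (h * p) + d (h * p) (x 2) \<le> d (x 0) (x 2) + 3 * a"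
                using hp d_tri[of "x 0" "h * p" "x 1"] b unfolding I_iff by linarith
              show "\<bar>B g p - c\<bar> \<le> 3 * \<theta>1 + 6" using p(2) cc by linarith
              show "\<bar>B g (h * p) - c\<bar> \<le> 3 * \<theta>1 + 6" using p(3) theta1 by linarith
              show "4 * \<theta>1 \<le> \<bar>B g (x 0) - c\<bar>" "4 * \<theta>1 \<le> \<bar>B g (x 2) - c\<bar>" using far unfolding \<beta>_def n2 by simp_all
            qed
            moreover have "d p (h * p) = real (\<nu> h)"
              using minimal_step(2)[OF min, of p 0] p(1) by (simp add: x_def)
            ultimately have False using big t10 a1 by argo
            then show ?thesis by blast
          next
            case False
            then have n2: "2 \<le> n'" using \<open>n' \<noteq> 0\<close> by linarith
            have "d (x 1) (x n') \<le> 9 * real_of_int \<theta>1 * a"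
            proof (rule cross_near[of "x 0" "x 1" "x n"])
              show "d (x 0) (x 1) + d (x 1) (x n) \<le> d (x 0) (x n) + 3 * a" by (rule bet) (use Suc in simp)
              show "d (x 0) (x n') + d (x n') (x n) \<le> d (x 0) (x n) + 3 * a" by (rule bet) (use Suc in simp)
              show "\<bar>B g (x 1) - c\<bar> \<le> 3 * \<theta>1 + 6" using b1 theta1 unfolding \<beta>_def by simp
              show "\<bar>B g (x n') - c\<bar> \<le> 3 * \<theta>1 + 6" using b1' unfolding \<beta>_def by linarith
              show "4 * \<theta>1 \<le> \<bar>B g (x 0) - c\<bar>" "4 * \<theta>1 \<le> \<bar>B g (x n) - c\<bar>" using far unfolding \<beta>_def by simp_all
            qed
            moreover have "real (\<nu> h) - 3 * a \<le> d (x 1) (x n')"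
            proof -
              have "d (x 1) (x n') = real (\<nu> (h ^ (n' - 1)))" using dx[of 1 "n' - 1"] n2 by simp
              moreover have "real (\<nu> (h ^ 1)) + real (\<nu> (h ^ (n' - 2))) \<le> real (\<nu> (h ^ (n' - 1))) + 3 * a"
                using qa[of 1 "n' - 2"] n2 by (simp add: numeral_2_eq_2 Suc_diff_Suc)
              ultimately show ?thesis by simp
            qed
            ultimately have False using big t10 a1 by argo
            then show ?thesis by blast
          qed
        qed
      qed
    qed
  qed
  then show ?thesis by (simp add: \<beta>_def x_def)
qed

end

section \<open>Admissible lengths\<close>

context gnorm
begin

text \<open>The additive error disappears on applying the bound to \<open>h ^ (n * k)\<close> for
  large \<open>k\<close>, as lengths are subadditive.\<close>

lemma lox_linear:
  assumes "0 < c" "\<And>n. c * real n - C \<le> real (\<nu> (h ^ n))" shows "lox h"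
  unfolding lox_def
proof (intro exI[of _ c] conjI allI)
  fix n
  show "c * real n \<le> real (\<nu> (h ^ n))"
  proof (rule ccontr)
    assume "\<not> ?thesis"
    then have e: "0 < c * real n - real (\<nu> (h ^ n))" by simp
    obtain k where k: "C < real k * (c * real n - real (\<nu> (h ^ n)))"
      using reals_Archimedean3[OF e] by blast
    have "\<nu> (h ^ (n * k)) \<le> k * \<nu> (h ^ n)" unfolding power_mult by (rule nu_power)
    then have "real (\<nu> (h ^ (n * k))) \<le> real k * real (\<nu> (h ^ n))"
      by (metis of_nat_le_iff of_nat_mult)
    moreover have "c * real (n * k) - C \<le> real (\<nu> (h ^ (n * k)))" by (rule assms(2))
    ultimately show False using k by (simp add: algebra_simps)
  qed
qed (rule assms(1))

lemma conj_power: "(inverse x * h * x) ^ n = inverse x * h ^ n * (x :: 'g)"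
  using zpow_conj[of "inverse x" h "int n"] by (simp add: zpow_of_nat)

lemma nu_conj_le: "\<nu> (inverse x * f * x) \<le> \<nu> f + 2 * \<nu> x"
  using nu_mult[of "inverse x * f" x] nu_mult[of "inverse x" f] by simp

lemma torsion_conj: assumes "torsion h0" "eqK h0 (inverse x * h * x)" shows "torsion h"
proof -
  obtain n where n: "0 < n" "h0 ^ n \<in> K" using assms(1) by (auto simp: torsion_def)
  have "eqK 1 (inverse x * h ^ n * x)"
    using eqK_trans[OF _ eqK_power[OF assms(2), of n], of 1] n(2) by (simp add: eqK_one conj_power)
  then have "inverse x * h ^ n * x \<in> K" by (simp add: eqK_one)
  from K_conj[OF this, of x] have "h ^ n \<in> K" by (simp add: mgs)
  then show ?thesis using n(1) by (auto simp: torsion_def)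
qed

lemma lox_conj: assumes "lox h0" "eqK h0 (inverse x * h * x)" shows "lox h"
proof -
  obtain c where c: "0 < c" "\<And>n. c * real n \<le> real (\<nu> (h0 ^ n))" using assms(1) by (auto simp: lox_def)
  have "c * real n - 2 * real (\<nu> x) \<le> real (\<nu> (h ^ n))" for n
  proof -
    have "\<nu> (h0 ^ n) = \<nu> (inverse x * h ^ n * x)"
      using eqK_nu[OF eqK_power[OF assms(2), of n]] by (simp add: conj_power)
    then have "real (\<nu> (h0 ^ n)) \<le> real (\<nu> (h ^ n)) + 2 * real (\<nu> x)"
      using nu_conj_le[of x "h ^ n"] by (metis of_nat_le_iff of_nat_add of_nat_mult of_nat_numeral)
    then show ?thesis using c(2)[of n] by linarith
  qed
  then show ?thesis using lox_linear[OF c(1)] by blast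
qed

lemma wpd_conj: assumes "wpd h0" "eqK h0 (inverse x * h * x)" shows "wpd h"
  unfolding wpd_def
proof (intro allI)
  fix R M0
  define R' where "R' = R + 2 * \<nu> x"
  obtain M where M: "M0 \<le> M" "finK {f. \<nu> f \<le> R' \<and> \<nu> (inverse (h0 ^ M) * f * h0 ^ M) \<le> R'}"
    using assms(1) unfolding wpd_def by metis
  then obtain F where F: "finite F" "\<And>f. \<nu> f \<le> R' \<Longrightarrow> \<nu> (inverse (h0 ^ M) * f * h0 ^ M) \<le> R' \<Longrightarrow> \<exists>e\<in>F. eqK e f"
    unfolding finK_def by auto
  have hp: "eqK (h0 ^ M) (inverse x * h ^ M * x)" using eqK_power[OF assms(2), of M] by (simp add: conj_power)
  have "\<exists>e\<in>(\<lambda>e. x * e * inverse x) ` F. eqK e f"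
    if f: "\<nu> f \<le> R" "\<nu> (inverse (h ^ M) * f * h ^ M) \<le> R" for f
  proof -
    define f1 where "f1 = inverse x * f * x"
    have 1: "\<nu> f1 \<le> R'" using nu_conj_le[of x f] f(1) by (simp add: f1_def R'_def)
    have "eqK (inverse (h0 ^ M) * f1 * h0 ^ M) (inverse (inverse x * h ^ M * x) * f1 * (inverse x * h ^ M * x))"
      by (intro eqK_mult eqK_inv hp eqK_refl)
    also have "inverse (inverse x * h ^ M * x) * f1 * (inverse x * h ^ M * x) = inverse x * (inverse (h ^ M) * f * h ^ M) * x"
      by (simp add: f1_def mgs)
    finally have "\<nu> (inverse (h0 ^ M) * f1 * h0 ^ M) \<le> R'"
      using eqK_nu nu_conj_le[of x "inverse (h ^ M) * f * h ^ M"] f(2) by (simp add: R'_def)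
    then obtain e where e: "e \<in> F" "eqK e f1" using F(2)[OF 1] by blast
    have "eqK (x * e * inverse x) (x * f1 * inverse x)" using e(2) by (simp add: eqK_cancel_left eqK_cancel_right)
    then have "eqK (x * e * inverse x) f" by (simp add: f1_def mgs)
    then show ?thesis using e(1) by blast
  qed
  then have "finK {f. \<nu> f \<le> R \<and> \<nu> (inverse (h ^ M) * f * h ^ M) \<le> R}"
    unfolding finK_def using F(1) by (intro exI[of _ "(\<lambda>e. x * e * inverse x) ` F"]) blast
  then show "\<exists>M\<ge>M0. finK {f. \<nu> f \<le> R \<and> \<nu> (inverse (h ^ M) * f * h ^ M) \<le> R}" using M(1) by blast
qed

end

text \<open>\<open>wpd\<close> is weak proper discontinuity.\<close>

definition admissible :: "('g::mgroup \<Rightarrow> nat) \<Rightarrow> bool" where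
  "admissible \<nu> \<longleftrightarrow> (\<exists>\<delta>. hyp \<nu> \<delta>) \<and> (\<forall>h. gnorm.torsion \<nu> h \<or> gnorm.lox \<nu> h \<and> gnorm.wpd \<nu> h)"

context wind
begin

interpretation q: hyp \<nu>' \<delta>' by (rule hyp')

section \<open>Loxodromic and WPD elements of the quotient\<close>

lemma tame_sub: "tame x y \<Longrightarrow> p \<in> I x y \<Longrightarrow> tame p y" "tame x y \<Longrightarrow> p \<in> I x y \<Longrightarrow> tame x p"
  unfolding tame_def using I_sub2(1)[of p x y] I_sub(1)[of p x y] by blast+

lemma minimal_tame:
  assumes "minimal h" "\<And>g. \<not> sim g (h * g)" shows "tame 1 (h ^ n)"
  by (rule tame_ends) (rule axis_step_bound[OF assms])

lemma minimal_lox: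
  assumes "minimal h" "\<And>g. \<not> sim g (h * g)" "lox h" shows "q.lox h"
proof -
  obtain c where c: "0 < c" "\<And>n. c * real n \<le> real (\<nu> (h ^ n))" using assms(3) by (auto simp: lox_def)
  have "c / 2 * real n - 2 * \<gamma> \<le> real (\<nu>' (h ^ n))" for n
    using bigon[OF minimal_tame[OF assms(1,2), of n]] c(2)[of n] unfolding d_one q.d_one by simp
  then show ?thesis by (rule q.lox_linear[rotated]) (use c(1) in simp)
qed

lemma q_eqK: "f = k * e \<Longrightarrow> k \<in> K' \<Longrightarrow> q.eqK e f"
  using K'_conj'[of k e] by (simp add: q.eqK_def q.K_def nu'_zero mgs)

text \<open>For \<open>f\<close> moving \<open>1\<close> and \<open>H = h ^ M\<close> little in the
  quotient, \<open>engine\<close> is applied to the corners \<open>1, H, F * H, F\<close>. A line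
  crossed by both long sides leaves finitely many choices for \<open>f\<close>; one crossed by both
  short sides is excluded by the length of \<open>H\<close>; in the closed case a translate of
  \<open>f\<close> moves both points little already in the old metric.\<close>

lemma minimal_wpd:
  assumes min: "minimal h" and ns: "\<And>g. \<not> sim g (h * g)" and lox: "lox h" and wpd: "wpd h" shows "q.wpd h"
  unfolding q.wpd_def
proof (intro allI)
  fix R M0
  obtain c where c: "0 < c" "\<And>n. c * real n \<le> real (\<nu>' (h ^ n))"
    using minimal_lox[OF min ns lox] by (auto simp: q.lox_def)
  obtain M1 where M1: "2 * real R + \<Gamma> < real M1 * c" using reals_Archimedean3[OF c(1)] by blast
  \<comment> \<open>Two ends cost \<open>2 * R + 6 * \<gamma>\<close> each, and the passage between
    the long sides costs \<open>R + 2 * \<gamma>\<close>.\<close>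
  define R' where "R' = nat \<lceil>5 * real R + 14 * \<gamma>\<rceil>"
  obtain M where M: "max M0 M1 \<le> M" and finM: "finK {f. \<nu> f \<le> R' \<and> \<nu> (inverse (h ^ M) * f * h ^ M) \<le> R'}"
    using wpd unfolding wpd_def by metis
  obtain F1 where F1: "finite F1" "\<And>f. \<nu> f \<le> R' \<Longrightarrow> \<nu> (inverse (h ^ M) * f * h ^ M) \<le> R' \<Longrightarrow> \<exists>e\<in>F1. eqK e f"
    using finM unfolding finK_def by auto
  define H where "H = h ^ M"
  have Hbig: "2 * real R + \<Gamma> < d' 1 H"
  proof -
    have "real M1 * c \<le> real M * c" by (rule mult_right_mono) (use M c(1) in auto)
    then show ?thesis using c(2)[of M] M1 by (simp add: q.d_one H_def mult.commute)
  qed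
  obtain G where G: "finite G" "\<And>g. 5 * \<theta>1 \<le> \<bar>B g 1 - B g H\<bar> \<Longrightarrow> \<exists>h\<in>G. sim h g"
    using finite_lines[of 1 H] by blast
  have N0': "0 < N" using N_theta1 theta1 by linarith
  obtain F0 where F0: "finite F0" "\<And>f. f \<in> E \<Longrightarrow> \<exists>i. \<exists>e\<in>F0. eqK f (W (N * i) * e)"
    using E_cosets[OF N0'] by blast
  \<comment> \<open>If translates of both long sides cross \<open>g\<close>, then up to
    \<open>K'\<close> the element \<open>F\<close> leads from one of the finitely many lines in
    \<open>G\<close> to another, through one of the finitely many classes in
    \<open>F0\<close>.\<close>
  define F2 where "F2 = (\<lambda>(g1, e, g2). g1 * e * inverse g2) ` (G \<times> F0 \<times> G)"
  have main: "\<exists>e\<in>F1 \<union> F2. q.eqK e f"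
    if f: "\<nu>' f \<le> R" "\<nu>' (inverse H * f * H) \<le> R" for f
  proof -
    obtain k1 where k1: "k1 \<in> K'" "d H (k1 * (f * H)) = d' H (f * H)" "tame H (k1 * (f * H))" by (rule lift_side)
    define F where "F = k1 * f"
    obtain k where k: "k \<in> K'" "d F (k * 1) = d' F 1" "tame F (k * 1)" by (rule lift_side)
    have l1: "d H (F * H) \<le> real R"
      using k1(2) f(2) by (simp add: F_def q.d_def mgs)
    have "\<nu>' F = \<nu>' f" using nu'_mult_K'(2)[OF k1(1)] by (simp add: F_def)
    then have l3: "d F k \<le> real R" using k(2) f(1) by (simp add: q.d_one)
    have conv: "\<exists>e\<in>S. q.eqK e f" if "e \<in> S" "F = k2 * e" "k2 \<in> K'" for e S k2
    proof -
      have "f = (inverse k1 * k2) * e" using that(2) unfolding F_def by (metis mg_cancel1 mult.assoc)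
      moreover have "inverse k1 * k2 \<in> K'" using that(3) k1(1) subgrp_K' by (simp add: subgrp_mult subgrp_inv)
      ultimately show ?thesis using q_eqK that(1) by blast
    qed
    define P where "P = (!) [1, H, F * H, F]"
    define Q where "Q = (!) [H, F * H, F, k]"
    have PQ: "P 0 = 1" "P 1 = H" "P 2 = F * H" "P 3 = F" "Q 0 = H" "Q 1 = F * H" "Q 2 = F" "Q 3 = k"
      by (simp_all add: P_def Q_def eval_nat_numeral)
    have i4: "i = 0 \<or> i = 1 \<or> i = 2 \<or> i = 3" if "i < 4" for i :: nat using that by linarith
    have i3: "i = 0 \<or> i = 1 \<or> i = 2" if "i < 3" for i :: nat using that by linarith
    have t0: "tame 1 H" unfolding H_def by (rule minimal_tame[OF min ns])
    have t2: "tame (F * H) F" using tame_left[OF tame_sym[OF t0], of F] by simp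
    have tm: "tame (P i) (Q i)" if "i < 4" for i using i4[OF that] t0 t2 k1(3) k(3) by (auto simp: PQ[simplified] F_def mgs)
    have "opp P Q \<or> (\<exists>\<eta> z y. closed P Q \<eta> z y)"
    proof (rule engine_start[of P Q k])
      show "tame (P i) (Q i)" if "i < 4" for i by (rule tm[OF that])
      show "d (Q i) (P (Suc i)) = 0" if "i < 3" for i using i3[OF that] by (auto simp: P_def Q_def eval_nat_numeral simp del: d_K0)
      show "d (Q 3) (k * P 0) = 0" by (simp add: PQ del: d_K0)
      show "k \<in> K'" by (rule k)
    qed
    then show ?thesis
    proof
      assume "opp P Q"
      then obtain g where "cross (5 * \<theta>1) (P 0) (Q 0) g \<and> cross (5 * \<theta>1) (P 2) (Q 2) g \<or>
       cross (5 * \<theta>1) (P 1) (Q 1) g \<and> cross (5 * \<theta>1) (P 3) (Q 3) g" unfolding opp_def by blast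
      then show ?thesis
      proof
        assume g: "cross (5 * \<theta>1) (P 0) (Q 0) g \<and> cross (5 * \<theta>1) (P 2) (Q 2) g"
        obtain a1' where a1: "a1' \<in> K'" "5 * \<theta>1 \<le> \<bar>B g (a1' * 1) - B g (a1' * H)\<bar>" using g unfolding PQ cross_def by blast
        obtain a2 where a2: "a2 \<in> K'" "5 * \<theta>1 \<le> \<bar>B g (a2 * (F * H)) - B g (a2 * F)\<bar>" using g unfolding PQ cross_def by blast
        have "5 * \<theta>1 \<le> \<bar>B (inverse a1' * g) 1 - B (inverse a1' * g) H\<bar>"
          using a1(2) by (simp add: B_mult_left[of g a1' 1, simplified] B_mult_left[of g a1'])
        then obtain g1 where g1: "g1 \<in> G" "sim g1 (inverse a1' * g)" using G(2) by blast
        have "5 * \<theta>1 \<le> \<bar>B (inverse (a2 * F) * g) 1 - B (inverse (a2 * F) * g) H\<bar>"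
          using a2(2) by (simp add: B_def mgs abs_minus_commute)
        then obtain g2 where g2: "g2 \<in> G" "sim g2 (inverse (a2 * F) * g)" using G(2) by blast
        define e1 where "e1 = inverse g1 * (inverse a1' * g)"
        define e2 where "e2 = inverse g2 * (inverse (a2 * F) * g)"
        have "e1 * inverse e2 \<in> E" using g1(2) g2(2) E_mult E_inv unfolding sim_def e1_def e2_def by blast
        then obtain i e where e: "e \<in> F0" "eqK (e1 * inverse e2) (W (N * i) * e)" using F0(2) by blast
        define x where "x = W (N * i) * e"
        have "eqK x (e1 * inverse e2)" using e(2) eqK_sym unfolding x_def by blast
        then have xk: "inverse x * (e1 * inverse e2) \<in> K'" using K_K' unfolding eqK_def by blast
        define k0 where "k0 = x * (inverse x * (e1 * inverse e2)) * inverse x"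
        have k0: "k0 \<in> K'" unfolding k0_def by (rule K'_conj[OF xk])
        have ee: "e1 * inverse e2 = k0 * (W (N * i) * e)" by (simp add: k0_def x_def mgs)
        have "F = inverse a2 * a1' * (g1 * (e1 * inverse e2) * inverse g2)"
          by (simp add: e1_def e2_def mgs)
        also have "\<dots> = (inverse a2 * a1' * (g1 * (k0 * W (N * i)) * inverse g1)) * (g1 * e * inverse g2)"
          unfolding ee by (simp add: mgs)
        finally have FF: "F = (inverse a2 * a1' * (g1 * (k0 * W (N * i)) * inverse g1)) * (g1 * e * inverse g2)" .
        have "k0 * W (N * i) \<in> K'" using k0 W_N_K' subgrp_K' by (simp add: subgrp_mult)
        then have "inverse a2 * a1' * (g1 * (k0 * W (N * i)) * inverse g1) \<in> K'"
          using K'_conj a1(1) a2(1) subgrp_K' by (metis subgrp_mult subgrp_inv)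
        moreover have "g1 * e * inverse g2 \<in> F1 \<union> F2" unfolding F2_def using g1(1) g2(1) e(1) by force
        ultimately show ?thesis using conv[OF _ FF] by blast
      next
        assume g: "cross (5 * \<theta>1) (P 1) (Q 1) g \<and> cross (5 * \<theta>1) (P 3) (Q 3) g"
        then obtain p r where p: "p \<in> I H (F * H)" "r \<in> I F k" "d' p r \<le> \<Gamma>" using opp_close unfolding PQ by blast
        have "d' H p \<le> real R" using d'_le(2)[of H p] p(1) l1 d_nonneg[of p "F * H"] unfolding I_iff by linarith
        moreover have "d' r 1 \<le> real R"
        proof -
          have "d' r k = d' r 1" using d'_K'(2)[OF k(1), of r 1] by simp
          then show ?thesis using d'_le(2)[of r k] p(2) l3 d_nonneg[of F r] unfolding I_iff by linarith
        qed
        ultimately have "d' H 1 \<le> 2 * real R + \<Gamma>"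
          using q.d_tri[of H 1 p] q.d_tri[of p 1 r] p(3) by linarith
        then show ?thesis using Hbig q.d_sym[of H 1] by linarith
      qed
    next
      assume "\<exists>\<eta> z y. closed P Q \<eta> z y"
      then obtain \<eta> z y where c: "closed P Q \<eta> z y" by blast
      have sb: "sub (P i) (Q i) (\<eta> i) (z i) (y i)" if "i < 4" for i using c that by (auto simp: closed_def)
      have gp: "d (y i) (z (Suc i)) \<le> \<gamma>" if "i < 3" for i using c that by (auto simp: closed_def)
      have s: "Suc 0 = 1" "Suc 1 = 2" "Suc 2 = 3" by simp_all
      have g: "d (y 0) (z 1) \<le> \<gamma>" "d (y 1) (z 2) \<le> \<gamma>" "d (y 2) (z 3) \<le> \<gamma>" "d (y 3) (z 0) \<le> \<gamma>"
        using gp[of 0] gp[of 1] gp[of 2] c unfolding s closed_def by auto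
      have ek: "\<eta> i \<in> K'" and zI: "\<eta> i * z i \<in> I (P i) (Q i)" and yI: "\<eta> i * y i \<in> I (P i) (Q i)" if "i < 4" for i
        using sb[OF that] I_sub2(1) unfolding sub_def by blast+
      have de: "d' (\<eta> i * x) x' = d' x x'" "d' x' (\<eta> i * x) = d' x' x" if "i < 4" for i x x' using d'_K' ek[OF that] by auto
      have end1: "d (P i) (\<eta> i * z i) \<le> 2 * d' (P i) (z i) + 4 * \<gamma>" if "i < 4" for i
        using bigon[OF tame_sub(2)[OF tm zI], OF that that] de[OF that] by simp
      have end2: "d (\<eta> i * y i) (Q i) \<le> 2 * d' (y i) (Q i) + 4 * \<gamma>" if "i < 4" for i
        using bigon[OF tame_sub(1)[OF tm yI], OF that that] de[OF that] by simp
      have len1: "d (z 1) (y 1) \<le> real R" "d' H (z 1) \<le> real R" "d' (y 1) (F * H) \<le> real R"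
      proof -
        have l: "d H (F * H) = d H (\<eta> 1 * z 1) + d (z 1) (y 1) + d (\<eta> 1 * y 1) (F * H)"
          using sub_length[OF sb[of 1]] unfolding PQ by simp
        show "d (z 1) (y 1) \<le> real R" using l l1 d_nonneg[of H "\<eta> 1 * z 1"] d_nonneg[of "\<eta> 1 * y 1" "F * H"] by linarith
        have "d' H (\<eta> 1 * z 1) \<le> real R"
          using l l1 d'_le(2)[of H "\<eta> 1 * z 1"] d_nonneg[of "z 1" "y 1"] d_nonneg[of "\<eta> 1 * y 1" "F * H"] by linarith
        then show "d' H (z 1) \<le> real R" using de[of 1] by simp
        have "d' (\<eta> 1 * y 1) (F * H) \<le> real R"
          using l l1 d'_le(2)[of "\<eta> 1 * y 1" "F * H"] d_nonneg[of "z 1" "y 1"] d_nonneg[of H "\<eta> 1 * z 1"] by linarith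
        then show "d' (y 1) (F * H) \<le> real R" using de[of 1] by simp
      qed
      have len3: "d (z 3) (y 3) \<le> real R" "d' F (z 3) \<le> real R" "d' (y 3) 1 \<le> real R"
      proof -
        have l: "d F k = d F (\<eta> 3 * z 3) + d (z 3) (y 3) + d (\<eta> 3 * y 3) k"
          using sub_length[OF sb[of 3]] unfolding PQ by simp
        show "d (z 3) (y 3) \<le> real R" using l l3 d_nonneg[of F "\<eta> 3 * z 3"] d_nonneg[of "\<eta> 3 * y 3" k] by linarith
        have "d' F (\<eta> 3 * z 3) \<le> real R"
          using l l3 d'_le(2)[of F "\<eta> 3 * z 3"] d_nonneg[of "z 3" "y 3"] d_nonneg[of "\<eta> 3 * y 3" k] by linarith
        then show "d' F (z 3) \<le> real R" using de[of 3] by simp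
        have "d' (\<eta> 3 * y 3) k \<le> real R"
          using l l3 d'_le(2)[of "\<eta> 3 * y 3" k] d_nonneg[of "z 3" "y 3"] d_nonneg[of F "\<eta> 3 * z 3"] by linarith
        then show "d' (y 3) 1 \<le> real R" using de[of 3] d'_K'(2)[OF k(1), of "y 3" 1] by simp
      qed
      have e0: "d 1 (\<eta> 0 * z 0) \<le> 2 * real R + 6 * \<gamma>"
        using end1[of 0] q.d_tri[of 1 "z 0" "y 3"] q.d_sym[of 1 "y 3"] d'_le(2)[of "y 3" "z 0"] g(4) len3(3) unfolding PQ by simp
      have e1: "d (\<eta> 0 * y 0) H \<le> 2 * real R + 6 * \<gamma>"
        using end2[of 0] q.d_tri[of "y 0" H "z 1"] q.d_sym[of H "z 1"] d'_le(2)[of "y 0" "z 1"] g(1) len1(2) unfolding PQ by simp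
      have e2: "d (F * H) (\<eta> 2 * z 2) \<le> 2 * real R + 6 * \<gamma>"
        using end1[of 2] q.d_tri[of "F * H" "z 2" "y 1"] q.d_sym[of "F * H" "y 1"] d'_le(2)[of "y 1" "z 2"] g(2) len1(3) unfolding PQ by simp
      have e3: "d (\<eta> 2 * y 2) F \<le> 2 * real R + 6 * \<gamma>"
        using end2[of 2] q.d_tri[of "y 2" F "z 3"] q.d_sym[of F "z 3"] d'_le(2)[of "y 2" "z 3"] g(3) len3(2) unfolding PQ by simp
      have e02: "d (z 2) (y 0) \<le> real R + 2 * \<gamma>"
        using d_tri[of "y 0" "z 2" "z 1"] d_tri[of "z 1" "z 2" "y 1"] g(1,2) len1(1) d_sym[of "z 2" "y 0"] by linarith
      have e20: "d (z 0) (y 2) \<le> real R + 2 * \<gamma>"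
        using d_tri[of "y 2" "z 0" "z 3"] d_tri[of "z 3" "z 0" "y 3"] g(3,4) len3(1) d_sym[of "z 0" "y 2"] by linarith
      define v where "v = \<eta> 0 * inverse (\<eta> 2)"
      have v: "v \<in> K'" unfolding v_def using ek[of 0] ek[of 2] subgrp_K' by (simp add: subgrp_mult subgrp_inv)
      have v2: "v * (\<eta> 2 * x) = \<eta> 0 * x" for x by (simp add: v_def mgs)
      define f1 where "f1 = v * F"
      have f1h: "f1 * H = v * (F * H)" by (simp add: f1_def mgs)
      have "d 1 f1 \<le> d 1 (\<eta> 0 * z 0) + d (\<eta> 0 * z 0) (\<eta> 0 * y 2) + d (\<eta> 0 * y 2) f1"
        using d_tri[of 1 f1 "\<eta> 0 * z 0"] d_tri[of "\<eta> 0 * z 0" f1 "\<eta> 0 * y 2"] by linarith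
      moreover have "d (\<eta> 0 * y 2) f1 = d (\<eta> 2 * y 2) F" unfolding f1_def v2[symmetric] by simp
      ultimately have n1: "real (\<nu> f1) \<le> 5 * real R + 14 * \<gamma>" using e0 e20 e3 by (simp add: d_one)
      have "d (f1 * H) H \<le> d (f1 * H) (\<eta> 0 * z 2) + d (\<eta> 0 * z 2) (\<eta> 0 * y 0) + d (\<eta> 0 * y 0) H"
        using d_tri[of "f1 * H" H "\<eta> 0 * z 2"] d_tri[of "\<eta> 0 * z 2" H "\<eta> 0 * y 0"] by linarith
      moreover have "d (f1 * H) (\<eta> 0 * z 2) = d (F * H) (\<eta> 2 * z 2)" unfolding f1h v2[symmetric] by simp
      ultimately have "d (f1 * H) H \<le> 5 * real R + 14 * \<gamma>" using e1 e02 e2 by simp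
      then have n2: "real (\<nu> (inverse H * f1 * H)) \<le> 5 * real R + 14 * \<gamma>"
        using d_sym[of "f1 * H" H] by (simp add: d_def mgs)
      have "\<nu> f1 \<le> R'" "\<nu> (inverse H * f1 * H) \<le> R'" using n1 n2 unfolding R'_def by linarith+
      then obtain e where e: "e \<in> F1" "eqK e f1" using F1(2) unfolding H_def by blast
      define k0 where "k0 = e * (inverse e * f1) * inverse e"
      have "k0 \<in> K'" unfolding k0_def using K'_conj e(2) K_K' unfolding eqK_def by blast
      moreover have "F = (inverse v * k0) * e" by (simp add: k0_def f1_def mgs)
      ultimately show ?thesis using conv[of e "F1 \<union> F2" "inverse v * k0"] e(1) v subgrp_K' by (simp add: subgrp_mult subgrp_inv)
    qed
  qed
  have "finite (F1 \<union> F2)" unfolding F2_def using F1(1) G(1) F0(1) by simp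
  then have "q.finK {f. \<nu>' f \<le> R \<and> \<nu>' (inverse (h ^ M) * f * h ^ M) \<le> R}"
    unfolding q.finK_def using main unfolding H_def by blast
  then show "\<exists>M\<ge>M0. q.finK {f. \<nu>' f \<le> R \<and> \<nu>' (inverse (h ^ M) * f * h ^ M) \<le> R}" using M by auto
qed

lemma admissible':
  assumes adm: "\<And>h. torsion h \<or> lox h \<and> wpd h"
  shows "admissible \<nu>'"
  unfolding admissible_def
proof (intro conjI allI)
  show "\<exists>\<delta>. hyp \<nu>' \<delta>" using hyp' by blast
  fix h
  show "q.torsion h \<or> q.lox h \<and> q.wpd h"
  proof -
    \<comment> \<open>A shortest conjugate modulo \<open>K'\<close> is minimal; torsion, loxodromy
      and WPD pass back along the conjugation.\<close>
    define V where "V = {\<nu> (k * (inverse x * h * x)) |k x. k \<in> K'}"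
    have "V \<noteq> {}" unfolding V_def using subgrp_one[OF subgrp_K'] by blast
    then have "(LEAST n. n \<in> V) \<in> V" by (metis LeastI_ex all_not_in_conv)
    then obtain k0 x0 where k0: "k0 \<in> K'" "(LEAST n. n \<in> V) = \<nu> (k0 * (inverse x0 * h * x0))" unfolding V_def by blast
    define h0 where "h0 = k0 * (inverse x0 * h * x0)"
    have min: "minimal h0"
      unfolding minimal_def
    proof (intro allI ballI)
      fix x k assume k: "k \<in> K'"
      have "inverse x * (k * h0 * x) = (inverse x * (k * k0) * x) * (inverse (x0 * x) * h * (x0 * x))"
        by (simp add: h0_def mgs)
      moreover have "inverse x * (k * k0) * x \<in> K'" using K'_conj' k k0(1) subgrp_K' by (simp add: subgrp_mult)
      ultimately have "\<nu> (inverse x * (k * h0 * x)) \<in> V" unfolding V_def by auto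
      then show "real (\<nu> h0) \<le> d x (k * h0 * x)" using Least_le[of "\<lambda>n. n \<in> V"] k0(2) by (simp add: d_def h0_def)
    qed
    have "q.eqK (inverse x0 * h * x0) h0" by (rule q_eqK[of _ k0]) (simp_all add: h0_def k0)
    then have eq: "q.eqK h0 (inverse x0 * h * x0)" by (rule q.eqK_sym)
    show ?thesis
    proof (cases "q.torsion h0")
      case True
      then show ?thesis using q.torsion_conj[OF _ eq] by blast
    next
      case False
      have "\<not> torsion h0"
      proof
        assume "torsion h0"
        then obtain n where "0 < n" "h0 ^ n \<in> K" unfolding torsion_def by blast
        then have "q.torsion h0" unfolding q.torsion_def q.K_def using K_K' nu'_zero by blast
        then show False using False by blast
      qed
      then have lw: "lox h0" "wpd h0" using adm by blast+
      have ns: "\<not> sim g (h0 * g)" for g using torsion_sim False by blast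
      show ?thesis using q.lox_conj[OF minimal_lox[OF min ns lw(1)] eq] q.wpd_conj[OF minimal_wpd[OF min ns lw] eq] by blast
    qed
  qed
qed

end

theorem admissible_step:
  assumes adm: "admissible \<nu>"
  shows "\<exists>\<nu>'. admissible \<nu>' \<and> (\<forall>x. \<nu>' x \<le> \<nu> x) \<and> (\<exists>n>0. \<nu>' (h ^ n) = 0) \<and> (\<forall>x. \<nu> x \<le> 2 \<longrightarrow> \<nu>' x = 0 \<longrightarrow> \<nu> x = 0)"
proof -
  obtain \<delta> where "hyp \<nu> \<delta>" using adm by (auto simp: admissible_def)
  then interpret hyp \<nu> \<delta> .
  have alt: "torsion f \<or> lox f \<and> wpd f" for f using adm by (simp add: admissible_def)
  show ?thesis
  proof (cases "torsion h")
    case True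
    then show ?thesis using adm by (intro exI[of _ \<nu>]) (auto simp: torsion_def K_def)
  next
    case False
    then have "lox h" "wpd h" using alt by blast+
    then obtain s \<kappa> where s: "0 < s" "axis \<nu> \<delta> (h ^ s) \<kappa>" "wpd (h ^ s)" using axis_exists by blast
    then interpret waxis \<nu> \<delta> "h ^ s" \<kappa> by (intro waxis.intro waxis_axioms.intro) auto
    obtain N0 \<theta> where N0: "0 < N0" "0 \<le> \<theta>" "\<And>g i j. \<theta> < \<bar>b (g * W i) - b (g * W j)\<bar> \<Longrightarrow> g \<in> ES N0"
      using overlap by blast
    interpret lines \<nu> \<delta> "h ^ s" \<kappa> N0 \<theta> by unfold_locales (use N0 in auto)
    define N where "N = N0 * (3000 * (\<theta> + 10))"
    have "1 * (3000 * (\<theta> + 10)) \<le> N0 * (3000 * (\<theta> + 10))" by (rule mult_right_mono) (use N0 theta0 in simp_all)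
    then interpret wind \<nu> \<delta> "h ^ s" \<kappa> N0 \<theta> N by unfold_locales (simp_all add: N_def)
    have N1: "0 < N" using N_theta1 theta1 by linarith
    have "zpow (h ^ s) N \<in> K'" using W_N_K'[of 1] by simp
    then have "\<nu>' (h ^ (s * nat N)) = 0" using N1 by (simp add: zpow_def power_mult nu'_zero)
    moreover have "0 < s * nat N" using s(1) N1 by simp
    ultimately show ?thesis using admissible'[OF alt] nu'_le_nu ball2_inj by (intro exI[of _ \<nu>']) blast
  qed
qed

section \<open>Amalgamated products\<close>

typedef 'b sym = "{f :: 'b \<Rightarrow> 'b. bij f}"
  by (rule exI[of _ id]) simp

setup_lifting type_definition_sym

instantiation sym :: (type) mgroup
begin

lift_definition one_sym :: "'a sym" is id by simp
lift_definition times_sym :: "'a sym \<Rightarrow> 'a sym \<Rightarrow> 'a sym" is "(\<circ>)" by (simp add: bij_comp)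
lift_definition inverse_sym :: "'a sym \<Rightarrow> 'a sym" is "inv_into UNIV" by (simp add: bij_imp_bij_inv)

instance
proof
  fix x y z :: "'a sym"
  show "x * y * z = x * (y * z)" by transfer (rule comp_assoc)
  show "1 * x = x" "x * 1 = x" by (transfer, simp)+
  show "inverse x * x = 1" by transfer (auto simp: bij_is_inj)
qed

end

definition eval :: "('a \<Rightarrow> 'g::mgroup) \<Rightarrow> ('a \<times> bool) list \<Rightarrow> 'g" where
  "eval \<phi> ws = foldr (\<lambda>(l, e) x. (if e then \<phi> l else inverse (\<phi> l)) * x) ws 1"

lemma eval_simps [simp]: "eval \<phi> [] = 1" "eval \<phi> ((l, e) # ws) = (if e then \<phi> l else inverse (\<phi> l)) * eval \<phi> ws"
  by (simp_all add: eval_def)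

lemma eval_append: "eval \<phi> (u @ v) = eval \<phi> u * eval \<phi> v"
  by (induction u) (auto simp: mult.assoc)

lemma eval_inverse: "eval \<phi> (rev (map (\<lambda>(l, e). (l, \<not> e)) ws)) = inverse (eval \<phi> ws)"
  by (induction ws) (auto simp: eval_append mg_inv_mult)

text \<open>The free group on \<open>'a\<close>, realised by the evaluations of words at all assignments of
  permutations of \<open>'a \<times> 'a list\<close>: this type does not depend on the amalgam.\<close>

typedef 'a fg = "range (\<lambda>ws (\<phi> :: 'a \<Rightarrow> ('a \<times> 'a list) sym). eval \<phi> ws)"
  by blast

setup_lifting type_definition_fg

instantiation fg :: (type) mgroup
begin

lift_definition one_fg :: "'a fg" is "\<lambda>\<phi>. 1"
  by (rule image_eqI[of _ _ "[]"]) auto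

lift_definition times_fg :: "'a fg \<Rightarrow> 'a fg \<Rightarrow> 'a fg" is "\<lambda>x y \<phi>. x \<phi> * y \<phi>"
  by (auto simp flip: eval_append)

lift_definition inverse_fg :: "'a fg \<Rightarrow> 'a fg" is "\<lambda>x \<phi>. inverse (x \<phi>)"
  by (auto simp flip: eval_inverse)

instance
proof
  fix x y z :: "'a fg"
  show "x * y * z = x * (y * z)" by transfer (simp add: mult.assoc)
  show "1 * x = x" "x * 1 = x" by (transfer, simp)+
  show "inverse x * x = 1" by transfer simp
qed

end

lift_definition lt :: "'a \<Rightarrow> 'a fg" is "\<lambda>l \<phi>. \<phi> l"
  by (rule image_eqI[of _ _ "[(l, True)]" for l]) auto

lemma fg_eval: "eval lt ws = Abs_fg (\<lambda>\<phi>. eval \<phi> ws)"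
proof (induction ws)
  case Nil
  then show ?case by (simp add: one_fg_def)
next
  case (Cons le ws)
  obtain l e where le: "le = (l, e)" by force
  have r: "Rep_fg (Abs_fg (\<lambda>\<phi>. eval \<phi> ws)) = (\<lambda>\<phi>. eval \<phi> ws)" by (rule Abs_fg_inverse) blast
  have "Rep_fg (eval lt (le # ws)) = (\<lambda>\<phi>. eval \<phi> (le # ws))"
    by (cases e) (simp_all add: le Cons times_fg.rep_eq inverse_fg.rep_eq lt.rep_eq r)
  then show ?case by (metis Rep_fg_inverse)
qed

lemma fg_surj: "\<exists>ws. x = eval lt ws"
  unfolding fg_eval using Rep_fg[of x] by (metis Rep_fg_inverse rangeE)

lemma fg_induct:
  assumes "P 1" "\<And>l x. P x \<Longrightarrow> P (lt l * x)" "\<And>l x. P x \<Longrightarrow> P (inverse (lt l) * x)"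
  shows "P x"
proof -
  obtain ws where "x = eval lt ws" using fg_surj by blast
  moreover have "P (eval lt ws)" by (induction ws) (use assms in auto)
  ultimately show ?thesis by simp
qed

section \<open>Common prefixes and the tree metric on stacks\<close>

fun lcp :: "'a list \<Rightarrow> 'a list \<Rightarrow> nat" where
  "lcp (x # xs) (y # ys) = (if x = y then Suc (lcp xs ys) else 0)"
| "lcp _ _ = 0"

lemma lcp_sym: "lcp s t = lcp t s"
  by (induction s t rule: lcp.induct) auto

lemma lcp_ultra: "min (lcp s t) (lcp t u) \<le> lcp s u"
proof (induction s t arbitrary: u rule: lcp.induct)
  case (1 x xs y ys)
  then show ?case by (cases u) auto
qed auto

lemma lcp_take: "m \<le> length r \<Longrightarrow> lcp r (take m r) = m"
proof (induction r arbitrary: m)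
  case (Cons x r) then show ?case by (cases m) auto
qed simp

lemma lcp_take_snoc: "m \<le> length r \<Longrightarrow> (m < length r \<Longrightarrow> r ! m \<noteq> s) \<Longrightarrow> lcp r (take m r @ [s]) = m"
proof (induction r arbitrary: m)
  case (Cons x r) then show ?case by (cases m) auto
qed simp

lemma lcp_snoc: "lcp r t < length t \<Longrightarrow> lcp r (t @ u) = lcp r t"
  by (induction r t rule: lcp.induct) (auto split: if_splits)

text \<open>Distance in the rooted tree of lists in which removing the head leads to the parent;
  common ancestors are common suffixes, hence \<open>rev\<close>.\<close>

definition tau :: "'a list \<Rightarrow> 'a list \<Rightarrow> int" where
  "tau s t = int (length s) + int (length t) - 2 * int (lcp (rev s) (rev t))"

text \<open>The ultrametric inequality for common prefixes gives the four-point condition of a tree,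
  with constant zero.\<close>

lemma tau_four: "tau a c + tau b d \<le> tau a b + tau c d \<or> tau a c + tau b d \<le> tau a d + tau b c"
proof -
  define f where "f x y = lcp (rev x) (rev y)" for x y :: "'a list"
  have u: "f x z \<ge> f x y \<or> f x z \<ge> f y z" for x y z using lcp_ultra[of "rev x" "rev y" "rev z"] unfolding f_def by linarith
  have s: "f x y = f y x" for x y unfolding f_def by (rule lcp_sym)
  have "f a b + f c d \<le> f a c + f b d \<or> f a d + f b c \<le> f a c + f b d"
  proof -
    have ar: "(p \<le> m \<or> s \<le> m) \<Longrightarrow> (r \<le> m \<or> q \<le> m) \<Longrightarrow> (p \<le> n \<or> r \<le> n) \<Longrightarrow> (s \<le> n \<or> q \<le> n) \<Longrightarrow>
       p + q \<le> m + n \<or> r + s \<le> m + n" for p q r s m n :: nat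
      by linarith
    show ?thesis
      by (rule ar) (use u[of a b c] u[of a d c] u[of b a d] u[of b c d] s[of b a] s[of d c] in simp_all)
  qed
  then show ?thesis unfolding tau_def f_def by linarith
qed

section \<open>Normal forms in the amalgamated product\<close>

locale amalg =
  fixes A B :: "'a monoid" and C :: "'a set"
  assumes amal: "amalgam A B C" and perA: "periodic_group A" and perB: "periodic_group B" and finC: "finite C"
begin

definition GG :: "bool \<Rightarrow> 'a monoid" where "GG i = (if i then A else B)"
abbreviation car :: "bool \<Rightarrow> 'a set" where "car i \<equiv> carrier (GG i)"
abbreviation mu :: "bool \<Rightarrow> 'a \<Rightarrow> 'a \<Rightarrow> 'a" where "mu i x y \<equiv> x \<otimes>\<^bsub>GG i\<^esub> y"
abbreviation iv :: "bool \<Rightarrow> 'a \<Rightarrow> 'a" where "iv i x \<equiv> inv\<^bsub>GG i\<^esub> x"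
definition e :: 'a where "e = \<one>\<^bsub>A\<^esub>"

lemma grp: "group (GG i)" using amal by (simp add: GG_def amalgam_def)
lemma subC: "subgroup C (GG i)" using amal unfolding GG_def amalgam_def by (cases i) auto
lemma C_def': "C = car True \<inter> car False" using amal by (simp add: GG_def amalgam_def)
lemma C_car: "x \<in> C \<Longrightarrow> x \<in> car i" using C_def' by (cases i) auto
lemma C_int: "x \<in> car i \<Longrightarrow> x \<in> car j \<Longrightarrow> i \<noteq> j \<Longrightarrow> x \<in> C" using C_def' by (cases i; cases j) auto
lemma mu_C: "x \<in> C \<Longrightarrow> y \<in> C \<Longrightarrow> mu i x y = mu j x y"
  using amal by (cases i; cases j) (auto simp: GG_def amalgam_def)

lemma e_one: "\<one>\<^bsub>GG i\<^esub> = e"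
proof (cases i)
  case True then show ?thesis by (simp add: e_def GG_def)
next
  case False
  have eC: "e \<in> C" unfolding e_def using subgroup.one_closed[OF subC[of True]] by (simp add: GG_def)
  have "mu False e e = mu True e e" by (rule mu_C) (rule eC)+
  also have "mu True e e = e" using group.is_monoid[OF grp[of True]] eC C_car[of e True]
    by (simp add: e_def GG_def monoid.l_one)
  finally have "mu False e e = e" .
  then have "e = \<one>\<^bsub>GG False\<^esub>" using group.l_cancel_one[OF grp[of False] C_car[OF eC] C_car[OF eC]] by simp
  then show ?thesis using False by simp
qed

lemma eC: "e \<in> C" using subgroup.one_closed[OF subC[of True]] by (simp add: e_one)

lemma mu_closed: "x \<in> car i \<Longrightarrow> y \<in> car i \<Longrightarrow> mu i x y \<in> car i"
  and mu_assoc: "x \<in> car i \<Longrightarrow> y \<in> car i \<Longrightarrow> z \<in> car i \<Longrightarrow> mu i (mu i x y) z = mu i x (mu i y z)"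
  and mu_e: "x \<in> car i \<Longrightarrow> mu i x e = x" "x \<in> car i \<Longrightarrow> mu i e x = x"
  and iv_closed: "x \<in> car i \<Longrightarrow> iv i x \<in> car i"
  and mu_iv: "x \<in> car i \<Longrightarrow> mu i x (iv i x) = e" "x \<in> car i \<Longrightarrow> mu i (iv i x) x = e"
proof -
  interpret group "GG i" by (rule grp)
  show "x \<in> car i \<Longrightarrow> y \<in> car i \<Longrightarrow> mu i x y \<in> car i" by simp
  show "x \<in> car i \<Longrightarrow> y \<in> car i \<Longrightarrow> z \<in> car i \<Longrightarrow> mu i (mu i x y) z = mu i x (mu i y z)" by (simp add: m_assoc)
  show "x \<in> car i \<Longrightarrow> mu i x e = x" "x \<in> car i \<Longrightarrow> mu i e x = x" by (simp_all flip: e_one[of i])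
  show "x \<in> car i \<Longrightarrow> iv i x \<in> car i" by simp
  show "x \<in> car i \<Longrightarrow> mu i x (iv i x) = e" "x \<in> car i \<Longrightarrow> mu i (iv i x) x = e" by (simp_all flip: e_one[of i])
qed

lemma mu_CC: "x \<in> C \<Longrightarrow> y \<in> C \<Longrightarrow> mu i x y \<in> C"
  and iv_C: "x \<in> C \<Longrightarrow> iv i x \<in> C"
  using subgroup.m_closed[OF subC] subgroup.m_inv_closed[OF subC] by auto

lemma mu_C_iff: assumes "c \<in> C" "g \<in> car i" shows "mu i c g \<in> C \<longleftrightarrow> g \<in> C" "mu i g c \<in> C \<longleftrightarrow> g \<in> C"
proof -
  have c: "c \<in> car i" "iv i c \<in> car i" using assms(1) C_car iv_closed by auto
  have "mu i (iv i c) (mu i c g) = g" using c assms(2) by (simp add: mu_iv mu_e flip: mu_assoc)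
  then show "mu i c g \<in> C \<longleftrightarrow> g \<in> C" using mu_CC iv_C assms(1) by metis
  have "mu i (mu i g c) (iv i c) = g" using c assms(2) by (simp add: mu_iv mu_e mu_assoc)
  then show "mu i g c \<in> C \<longleftrightarrow> g \<in> C" using mu_CC iv_C assms(1) by metis
qed

definition coset :: "bool \<Rightarrow> 'a \<Rightarrow> 'a set" where "coset i g = (\<lambda>c. mu i c g) ` C"
text \<open>Choosing from the coset as a set makes the representative depend on the coset only. That
  of \<open>C\<close> itself need not be the identity; \<open>join\<close> never inserts it.\<close>

definition \<rho> :: "bool \<Rightarrow> 'a \<Rightarrow> 'a" where "\<rho> i g = (SOME r. r \<in> coset i g)"
definition \<kappa> :: "bool \<Rightarrow> 'a \<Rightarrow> 'a" where "\<kappa> i g = mu i g (iv i (\<rho> i g))"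

lemma coset_C: assumes "c \<in> C" "g \<in> car i" shows "coset i (mu i c g) = coset i g"
proof -
  have *: "coset i (mu i c g) \<subseteq> coset i g" if "c \<in> C" "g \<in> car i" for c g
    unfolding coset_def using that by (auto simp: C_car mu_CC simp flip: mu_assoc)
  have c: "c \<in> car i" "iv i c \<in> car i" using assms(1) C_car iv_closed by auto
  have "mu i (iv i c) (mu i c g) = g" using c assms(2) by (simp add: mu_iv mu_e flip: mu_assoc)
  then have "coset i g \<subseteq> coset i (mu i c g)" using *[OF iv_C[OF assms(1)], of "mu i c g" i] assms c mu_closed by metis
  then show ?thesis using *[OF assms] by blast
qed

lemma rho_coset: assumes "g \<in> car i" obtains c where "c \<in> C" "\<rho> i g = mu i c g"
proof -
  have "g \<in> coset i g" unfolding coset_def using eC mu_e(2)[OF assms] by force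
  then have "\<rho> i g \<in> coset i g" unfolding \<rho>_def by (rule someI)
  then show ?thesis using that by (auto simp: coset_def)
qed

lemma rho_car: "g \<in> car i \<Longrightarrow> \<rho> i g \<in> car i"
  and rho_C: "g \<in> car i \<Longrightarrow> \<rho> i g \<in> C \<longleftrightarrow> g \<in> C"
  and rho_mult: "g \<in> car i \<Longrightarrow> c \<in> C \<Longrightarrow> \<rho> i (mu i c g) = \<rho> i g"
  and rho_idem: "g \<in> car i \<Longrightarrow> \<rho> i (\<rho> i g) = \<rho> i g"
  and kappa_C: "g \<in> car i \<Longrightarrow> \<kappa> i g \<in> C"
  and kappa_rho: "g \<in> car i \<Longrightarrow> mu i (\<kappa> i g) (\<rho> i g) = g"
proof -
  show rm: "\<rho> i (mu i c g) = \<rho> i g" if "g \<in> car i" "c \<in> C" for g c by (simp add: \<rho>_def coset_C that)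
  assume g: "g \<in> car i"
  obtain c where c: "c \<in> C" "\<rho> i g = mu i c g" by (rule rho_coset[OF g])
  have cc: "c \<in> car i" "iv i c \<in> car i" using c C_car iv_closed by auto
  show rc: "\<rho> i g \<in> car i" using c cc g by (simp add: mu_closed)
  show "\<rho> i g \<in> C \<longleftrightarrow> g \<in> C" using c g mu_C_iff(1) by simp
  show "\<rho> i (\<rho> i g) = \<rho> i g" using rm[OF g c(1)] c(2) by simp
  have gg: "g = mu i (iv i c) (\<rho> i g)" using cc g by (simp add: c(2) mu_iv mu_e flip: mu_assoc)
  have "\<kappa> i g = mu i (mu i (iv i c) (\<rho> i g)) (iv i (\<rho> i g))" unfolding \<kappa>_def using gg by simp
  also have "\<dots> = iv i c" using cc rc by (simp add: mu_assoc iv_closed mu_iv mu_e)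
  finally have k: "\<kappa> i g = iv i c" .
  show "\<kappa> i g \<in> C" using k iv_C c(1) by simp
  show "mu i (\<kappa> i g) (\<rho> i g) = g" using k gg by simp
qed

fun nfl :: "'a list \<Rightarrow> bool" where
  "nfl [] \<longleftrightarrow> True"
| "nfl (s # ss) \<longleftrightarrow> nfl ss \<and> (\<exists>i. s \<in> car i - C \<and> \<rho> i s = s \<and> (ss = [] \<or> hd ss \<notin> car i))"

definition NF :: "'a \<times> 'a list \<Rightarrow> bool" where "NF N \<longleftrightarrow> fst N \<in> C \<and> nfl (snd N)"
definition rest :: "bool \<Rightarrow> 'a list \<Rightarrow> bool" where "rest i ss \<longleftrightarrow> ss = [] \<or> hd ss \<notin> car i"

text \<open>The pair \<open>(c, [s1, \<dots>, sn])\<close> is the normal form \<open>c s1 \<dots> sn\<close> with right coset representatives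
  \<open>si\<close>; the action of the factors follows van der Waerden.\<close>

definition split :: "bool \<Rightarrow> 'a \<times> 'a list \<Rightarrow> 'a \<times> 'a list" where
  "split i N = (if rest i (snd N) then N else (mu i (fst N) (hd (snd N)), tl (snd N)))"
definition join :: "bool \<Rightarrow> 'a \<times> 'a list \<Rightarrow> 'a \<times> 'a list" where
  "join i N = (if fst N \<in> C then N else (\<kappa> i (fst N), \<rho> i (fst N) # snd N))"

text \<open>The maps \<open>split i\<close> and \<open>join i\<close> are inverse bijections between
  normal forms and these pairs, on which factor \<open>i\<close> acts by left multiplication in the
  first entry.\<close>

definition SP :: "bool \<Rightarrow> 'a \<times> 'a list \<Rightarrow> bool" where
  "SP i N \<longleftrightarrow> fst N \<in> car i \<and> nfl (snd N) \<and> rest i (snd N)"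

lemma nfl_Cons: "nfl (s # ss) \<Longrightarrow> s \<in> car i \<Longrightarrow> nfl ss \<and> s \<in> car i - C \<and> \<rho> i s = s \<and> rest i ss"
proof -
  assume n: "nfl (s # ss)" and s: "s \<in> car i"
  then obtain j where j: "s \<in> car j - C" "\<rho> j s = s" "ss = [] \<or> hd ss \<notin> car j" "nfl ss" by auto
  then have "j = i" using s C_int by blast
  then show ?thesis using j unfolding rest_def by blast
qed

lemma SP_split: assumes "NF N" shows "SP i (split i N)"
proof (cases "rest i (snd N)")
  case True then show ?thesis using assms C_car by (auto simp: SP_def split_def NF_def)
next
  case False
  then obtain s ss where s: "snd N = s # ss" "s \<in> car i" by (cases "snd N") (auto simp: rest_def)
  then show ?thesis using assms False nfl_Cons[of s ss i] C_car[of "fst N" i] by (auto simp: SP_def split_def NF_def mu_closed)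
qed

lemma NF_join: assumes "SP i N" shows "NF (join i N)"
proof (cases "fst N \<in> C")
  case True then show ?thesis using assms by (auto simp: SP_def join_def NF_def)
next
  case False
  then show ?thesis using assms kappa_C[of "fst N" i] rho_car[of "fst N" i] rho_C[of "fst N" i] rho_idem[of "fst N" i]
    by (auto simp: SP_def join_def NF_def rest_def)
qed

lemma split_join: assumes "SP i N" shows "split i (join i N) = N"
proof (cases "fst N \<in> C")
  case True then show ?thesis using assms by (auto simp: SP_def join_def split_def)
next
  case False
  then show ?thesis using assms rho_car[of "fst N" i] kappa_rho[of "fst N" i]
    by (auto simp: SP_def join_def split_def rest_def)
qed

lemma join_split: assumes "NF N" shows "join i (split i N) = N"
proof (cases "rest i (snd N)")
  case True then show ?thesis using assms by (auto simp: join_def split_def NF_def)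
next
  case False
  then obtain s ss where s: "snd N = s # ss" "s \<in> car i" by (cases "snd N") (auto simp: rest_def)
  obtain c where c: "N = (c, s # ss)" using s by (cases N) auto
  have nf: "s \<in> car i - C" "\<rho> i s = s" "c \<in> C" using assms nfl_Cons[of s ss i] s(2) by (auto simp: c NF_def)
  have cc: "c \<in> car i" using nf C_car by blast
  have "mu i c s \<notin> C" using mu_C_iff(1)[OF nf(3) s(2)] nf(1) by blast
  moreover have "\<rho> i (mu i c s) = s" using rho_mult[OF s(2) nf(3)] nf(2) by simp
  moreover have "\<kappa> i (mu i c s) = c" unfolding \<kappa>_def using calculation(2) cc s(2) by (simp add: mu_assoc iv_closed mu_iv mu_e)
  ultimately show ?thesis using False by (simp add: c join_def split_def)
qed

text \<open>Extended by the identity off normal forms and for letters outside factor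
  \<open>i\<close>, so as to be a permutation of the whole type.\<close>

definition act :: "bool \<Rightarrow> 'a \<Rightarrow> 'a \<times> 'a list \<Rightarrow> 'a \<times> 'a list" where
  "act i a N = (if NF N \<and> a \<in> car i then join i (mu i a (fst (split i N)), snd (split i N)) else N)"

lemma act_SP: "SP i N \<Longrightarrow> a \<in> car i \<Longrightarrow> SP i (mu i a (fst N), snd N)"
  by (auto simp: SP_def mu_closed)

lemma act_NF: "NF N \<Longrightarrow> NF (act i a N)"
  unfolding act_def using NF_join[OF act_SP[OF SP_split]] by auto

lemma act_mult: assumes "a \<in> car i" "b \<in> car i" shows "act i (mu i a b) N = act i a (act i b N)"
proof (cases "NF N")
  case True
  have sp: "SP i (mu i b (fst (split i N)), snd (split i N))" by (rule act_SP[OF SP_split[OF True] assms(2)])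
  have g: "fst (split i N) \<in> car i" using SP_split[OF True, of i] by (simp add: SP_def)
  have "NF (act i b N)" by (rule act_NF[OF True])
  then show ?thesis using True assms sp g split_join[OF sp]
    by (simp add: act_def mu_closed mu_assoc)
next
  case False then show ?thesis by (simp add: act_def)
qed

lemma act_e: "act i e N = N"
proof (cases "NF N")
  case True
  have g: "fst (split i N) \<in> car i" using SP_split[OF True, of i] by (simp add: SP_def)
  show ?thesis using True C_car[OF eC, of i] mu_e(2)[OF g] join_split[OF True] by (simp add: act_def)
qed (simp add: act_def)

lemma act_C: assumes "c \<in> C" "NF N" shows "act i c N = (mu i c (fst N), snd N)"
proof (cases "rest i (snd N)")
  case True
  then show ?thesis using assms C_car mu_CC by (simp add: act_def split_def join_def NF_def)
next
  case False
  then obtain s ss where s: "snd N = s # ss" "s \<in> car i" by (cases "snd N") (auto simp: rest_def)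
  obtain c0 where c0: "N = (c0, s # ss)" using s by (cases N) auto
  have c0C: "c0 \<in> C" using assms by (simp add: c0 NF_def)
  have NF': "NF (mu i c c0, s # ss)" using assms c0C by (simp add: NF_def c0 mu_CC)
  have "split i (mu i c c0, s # ss) = (mu i c (fst (split i N)), snd (split i N))"
    using False c0C assms(1) C_car s(2) by (simp add: split_def c0 mu_assoc)
  then have "join i (mu i c (fst (split i N)), snd (split i N)) = (mu i c c0, s # ss)" using join_split[OF NF', of i] by simp
  then show ?thesis using assms C_car by (simp add: act_def c0)
qed

lemma act_C_indep: "c \<in> C \<Longrightarrow> act i c = act j c"
proof
  fix N assume c: "c \<in> C"
  show "act i c N = act j c N"
    using act_C[OF c] mu_C[OF c] by (cases "NF N") (auto simp: NF_def act_def)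
qed

lemma act_bij: "bij (act i a)"
proof (cases "a \<in> car i")
  case True
  have "act i (iv i a) (act i a N) = N" "act i a (act i (iv i a) N) = N" for N
    using act_mult[of "iv i a" i a N] act_mult[of a i "iv i a" N] True by (simp_all add: iv_closed mu_iv act_e)
  then show ?thesis by (metis bijI' )
next
  case False
  then have "act i a = id" by (auto simp: act_def)
  then show ?thesis by simp
qed

text \<open>Letters in both factors act alike by \<open>act_C_indep\<close>, and letters in neither
  act trivially.\<close>

definition \<phi>0 :: "'a \<Rightarrow> ('a \<times> 'a list) sym" where
  "\<phi>0 l = Abs_sym (if l \<in> car True then act True l else act False l)"

definition \<pi> :: "'a fg \<Rightarrow> 'a \<times> 'a list \<Rightarrow> 'a \<times> 'a list" where
  "\<pi> x = Rep_sym (Rep_fg x \<phi>0)"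

lemma pi_one [simp]: "\<pi> 1 N = N"
  by (simp add: \<pi>_def one_fg.rep_eq one_sym.rep_eq)

lemma pi_mult [simp]: "\<pi> (x * y) N = \<pi> x (\<pi> y N)"
  by (simp add: \<pi>_def times_fg.rep_eq times_sym.rep_eq)

lemma pi_inv [simp]: "\<pi> (inverse x) (\<pi> x N) = N" "\<pi> x (\<pi> (inverse x) N) = N"
  by (simp_all flip: pi_mult)

lemma pi_lt: "l \<in> car i \<Longrightarrow> \<pi> (lt l) = act i l"
proof -
  assume l: "l \<in> car i"
  have "(if l \<in> car True then act True l else act False l) = act i l"
  proof (cases i)
    case True then show ?thesis using l by simp
  next
    case False
    have "act True l = act False l" if "l \<in> car True"
      by (rule act_C_indep) (rule C_int[OF that l], use False in simp)
    then show ?thesis using False by simp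
  qed
  then show ?thesis using act_bij by (simp add: \<pi>_def lt.rep_eq \<phi>0_def Abs_sym_inverse)
qed

lemma pi_lt_out: "l \<notin> car True \<Longrightarrow> l \<notin> car False \<Longrightarrow> \<pi> (lt l) = id"
  using act_bij[of False l] by (auto simp: \<pi>_def lt.rep_eq \<phi>0_def Abs_sym_inverse act_def)

text \<open>Equality in the amalgamated product, read off from the action; by
  \<open>pi_faithful\<close> the image of a single normal form decides it.\<close>

definition eq :: "'a fg \<Rightarrow> 'a fg \<Rightarrow> bool" where "eq x y \<longleftrightarrow> \<pi> x = \<pi> y"

lemma eq_refl [simp]: "eq x x" and eq_sym: "eq x y \<Longrightarrow> eq y x" and eq_trans: "eq x y \<Longrightarrow> eq y z \<Longrightarrow> eq x z"
  by (simp_all add: eq_def)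

lemma eq_mult: "eq x y \<Longrightarrow> eq u v \<Longrightarrow> eq (x * u) (y * v)"
  by (auto simp: eq_def)

lemma eq_inv: "eq x y \<Longrightarrow> eq (inverse x) (inverse y)"
  unfolding eq_def by (metis ext pi_inv)

definition L :: "'a set" where "L = car True \<union> car False"

lemma L_car: "l \<in> L \<Longrightarrow> \<exists>i. l \<in> car i" "l \<in> car i \<Longrightarrow> l \<in> L"
  by (auto simp: L_def) (cases i; simp)

lemma eq_lt_mult: "l \<in> car i \<Longrightarrow> l' \<in> car i \<Longrightarrow> eq (lt (mu i l l')) (lt l * lt l')"
  unfolding eq_def by (rule ext) (simp add: pi_lt[of _ i] mu_closed act_mult)

lemma eq_lt_e: "eq (lt e) 1"
  unfolding eq_def by (rule ext) (simp add: pi_lt[OF C_car[OF eC, of True]] act_e)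

lemma eq_lt_inv: assumes "l \<in> car i" shows "eq (lt (iv i l)) (inverse (lt l))"
proof -
  have "eq (lt l * lt (iv i l)) 1"
    using eq_lt_mult[OF assms iv_closed[OF assms]] eq_lt_e assms by (auto simp: mu_iv eq_def)
  then have "eq (inverse (lt l) * (lt l * lt (iv i l))) (inverse (lt l) * 1)" by (intro eq_mult eq_refl)
  then show ?thesis by (simp add: eq_sym)
qed

definition wd :: "'a list \<Rightarrow> 'a fg" where "wd ws = prod_list (map lt ws)"

lemma wd_simps [simp]: "wd [] = 1" "wd (l # ws) = lt l * wd ws" "wd (u @ v) = wd u * wd v"
  by (simp_all add: wd_def)

lemma wd_inv: "set ws \<subseteq> L \<Longrightarrow> \<exists>vs. length vs = length ws \<and> set vs \<subseteq> L \<and> eq (wd vs) (inverse (wd ws))"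
proof (induction ws)
  case Nil then show ?case by (intro exI[of _ "[]"]) auto
next
  case (Cons l ws)
  then obtain vs where vs: "length vs = length ws" "set vs \<subseteq> L" "eq (wd vs) (inverse (wd ws))" by auto
  obtain i where i: "l \<in> car i" using Cons.prems L_car(1)[of l] by auto
  have "eq (wd (vs @ [iv i l])) (inverse (wd (l # ws)))"
    using eq_mult[OF vs(3) eq_lt_inv[OF i]] by (simp add: mg_inv_mult)
  then show ?case using vs i L_car(2)[OF iv_closed[OF i]] by (intro exI[of _ "vs @ [iv i l]"]) auto
qed

lemma wd_surj: "\<exists>ws. set ws \<subseteq> L \<and> eq x (wd ws)"
proof (induction x rule: fg_induct)
  case 1 show ?case by (intro exI[of _ "[]"]) auto
next
  case (2 l x)
  then obtain ws where ws: "set ws \<subseteq> L" "eq x (wd ws)" by blast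
  show ?case
  proof (cases "l \<in> L")
    case True then show ?thesis using ws eq_mult[OF eq_refl ws(2), of "lt l"] by (intro exI[of _ "l # ws"]) auto
  next
    case False then have "eq (lt l * x) x" using pi_lt_out[of l] by (auto simp: eq_def L_def)
    then show ?thesis using ws eq_trans by blast
  qed
next
  case (3 l x)
  then obtain ws where ws: "set ws \<subseteq> L" "eq x (wd ws)" by blast
  show ?case
  proof (cases "l \<in> L")
    case True
    then obtain i where i: "l \<in> car i" using L_car(1)[OF True] by blast
    have "eq (inverse (lt l) * x) (wd (iv i l # ws))" using eq_mult[OF eq_sym[OF eq_lt_inv[OF i]] ws(2)] by simp
    then show ?thesis using ws L_car(2)[OF iv_closed[OF i]] by (intro exI[of _ "iv i l # ws"]) auto
  next
    case False then have "eq (lt l) 1" using pi_lt_out[of l] by (auto simp: eq_def L_def)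
    from eq_mult[OF eq_inv[OF this] eq_refl, of x] have "eq (inverse (lt l) * x) x" by simp
    then show ?thesis using ws eq_trans by blast
  qed
qed

text \<open>Word length over the union of the factors: the number of syllables, except that
  nontrivial elements of \<open>C\<close> have length one, so that only the identity has length
  zero.\<close>

definition \<nu>0 :: "'a fg \<Rightarrow> nat" where
  "\<nu>0 x = (LEAST n. \<exists>ws. length ws = n \<and> set ws \<subseteq> L \<and> eq x (wd ws))"

lemma nu0_ex: "\<exists>ws. length ws = \<nu>0 x \<and> set ws \<subseteq> L \<and> eq x (wd ws)"
  unfolding \<nu>0_def by (rule LeastI_ex) (use wd_surj in blast)

lemma nu0_le: "set ws \<subseteq> L \<Longrightarrow> eq x (wd ws) \<Longrightarrow> \<nu>0 x \<le> length ws"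
  unfolding \<nu>0_def by (rule Least_le) blast

lemma nu0_zero: "\<nu>0 x = 0 \<longleftrightarrow> eq x 1"
  using nu0_ex[of x] nu0_le[of "[]" x] by auto

lemma gnorm0: "gnorm \<nu>0"
proof
  show "\<nu>0 1 = 0" by (simp add: nu0_zero)
  have i: "\<nu>0 (inverse x) \<le> \<nu>0 x" for x
  proof -
    obtain ws where ws: "length ws = \<nu>0 x" "set ws \<subseteq> L" "eq x (wd ws)" using nu0_ex by blast
    obtain vs where vs: "length vs = length ws" "set vs \<subseteq> L" "eq (wd vs) (inverse (wd ws))" using wd_inv[OF ws(2)] by blast
    show ?thesis using nu0_le[OF vs(2), of "inverse x"] vs(1,3) ws(1) eq_trans[OF eq_inv[OF ws(3)] eq_sym[OF vs(3)]] by simp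
  qed
  show "\<nu>0 (inverse x) = \<nu>0 x" for x using i[of x] i[of "inverse x"] by simp
  show m: "\<nu>0 (x * y) \<le> \<nu>0 x + \<nu>0 y" for x y
  proof -
    obtain ws where ws: "length ws = \<nu>0 x" "set ws \<subseteq> L" "eq x (wd ws)" using nu0_ex by blast
    obtain vs where vs: "length vs = \<nu>0 y" "set vs \<subseteq> L" "eq y (wd vs)" using nu0_ex by blast
    show ?thesis using nu0_le[of "ws @ vs" "x * y"] eq_mult[OF ws(3) vs(3)] ws vs by simp
  qed
  show "\<nu>0 (g * k * inverse g) = 0" if "\<nu>0 k = 0" for g k
  proof -
    have "\<pi> k N = N" for N using that unfolding nu0_zero eq_def by simp
    then show ?thesis unfolding nu0_zero eq_def by (intro ext) simp
  qed
  show "\<exists>y. \<nu>0 y = m \<and> \<nu>0 (inverse y * x) = \<nu>0 x - m" if mx: "m \<le> \<nu>0 x" for m x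
  proof -
    obtain ws where ws: "length ws = \<nu>0 x" "set ws \<subseteq> L" "eq x (wd ws)" using nu0_ex by blast
    define y where "y = wd (take m ws)"
    have 1: "\<nu>0 y \<le> m" using nu0_le[of "take m ws" y] ws set_take_subset[of m ws] mx by (simp add: y_def)
    have "wd ws = y * wd (drop m ws)" unfolding y_def wd_simps(3)[symmetric] by simp
    then have "eq (inverse y * x) (wd (drop m ws))" using eq_mult[OF eq_refl ws(3), of "inverse y"] by simp
    then have 2: "\<nu>0 (inverse y * x) \<le> \<nu>0 x - m" using nu0_le[of "drop m ws"] ws set_drop_subset[of m ws] by simp
    have "\<nu>0 x \<le> \<nu>0 y + \<nu>0 (inverse y * x)" using m[of y "inverse y * x"] by simp
    then show ?thesis using 1 2 mx by (intro exI[of _ y]) linarith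
  qed
qed

end

section \<open>Admissibility of the syllable length\<close>

context amalg
begin

interpretation g: gnorm \<nu>0 by (rule gnorm0)

lemma eqK0: "g.eqK x y \<longleftrightarrow> eq x y"
proof -
  have "eq (inverse x * y) 1 \<longleftrightarrow> eq x y"
    using eq_mult[OF eq_refl[of x], of "inverse x * y" 1] eq_mult[OF eq_refl[of "inverse x"], of x y]
    by (auto intro: eq_sym)
  then show ?thesis by (simp add: g.eqK_def g.K_def nu0_zero)
qed

section \<open>Reduced words and their action on stacks\<close>

definition same :: "'a \<Rightarrow> 'a \<Rightarrow> bool" where "same l l' \<longleftrightarrow> (\<exists>i. l \<in> car i \<and> l' \<in> car i)"
definition red :: "'a list \<Rightarrow> bool" where
  "red ws \<longleftrightarrow> set ws \<subseteq> L - C \<and> successively (\<lambda>l l'. \<not> same l l') ws"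

abbreviation base :: "'a \<times> 'a list" where "base \<equiv> (e, [])"

lemma NF_base: "NF base" by (simp add: NF_def eC)

lemma pi_wd_Cons: "l \<in> car i \<Longrightarrow> \<pi> (wd (l # ws)) N = act i l (\<pi> (wd ws) N)"
  by (simp add: pi_lt)

lemma wd_NF: "set ws \<subseteq> L \<Longrightarrow> NF N \<Longrightarrow> NF (\<pi> (wd ws) N)"
proof (induction ws)
  case (Cons l ws)
  then obtain i where "l \<in> car i" using L_car(1)[of l] by auto
  then show ?case using Cons act_NF by (simp add: pi_wd_Cons del: wd_simps)
qed simp

lemma pi_NF: "NF N \<Longrightarrow> NF (\<pi> x N)"
  using wd_surj[of x] wd_NF unfolding eq_def by metis

lemma act_push:
  assumes "l \<in> car i - C" "NF N" "rest i (snd N)"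
  shows "\<exists>s. s \<in> car i - C \<and> snd (act i l N) = s # snd N"
proof -
  have c: "fst N \<in> C" "fst N \<in> car i" using assms(2) C_car by (auto simp: NF_def)
  have "mu i l (fst N) \<in> car i" "mu i l (fst N) \<notin> C" using mu_C_iff(2)[OF c(1)] assms(1) c mu_closed by auto
  then show ?thesis using assms rho_car rho_C by (auto simp: act_def split_def join_def)
qed

lemma act_top:
  assumes "l \<in> car i" "NF N" "snd N = s # ss" "s \<in> car i"
  shows "snd (act i l N) = ss \<or> (\<exists>s'. s' \<in> car i - C \<and> (l \<notin> C \<longrightarrow> s' \<noteq> s) \<and> snd (act i l N) = s' # ss)"
proof -
  have c: "fst N \<in> C" "fst N \<in> car i" using assms(2) C_car by (auto simp: NF_def)
  have nr: "\<not> rest i (snd N)" using assms by (simp add: rest_def)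
  define g where "g = mu i l (mu i (fst N) s)"
  have g: "g \<in> car i" using assms c by (simp add: g_def mu_closed)
  have a: "act i l N = join i (g, ss)" using assms nr by (simp add: act_def split_def g_def)
  show ?thesis
  proof (cases "g \<in> C")
    case True then show ?thesis using a by (simp add: join_def)
  next
    case False
    have "l \<in> C" if "\<rho> i g = s"
    proof -
      have k: "\<kappa> i g \<in> C" "\<kappa> i g \<in> car i" using kappa_C[OF g] C_car by auto
      have "mu i (\<kappa> i g) s = mu i (mu i l (fst N)) s" using kappa_rho[OF g] that assms c by (simp add: g_def mu_assoc)
      then have "\<kappa> i g = mu i l (fst N)"
        using group.right_cancel[OF grp[of i], of s "\<kappa> i g" "mu i l (fst N)"] k assms c mu_closed by simp
      then show ?thesis using k(1) mu_C_iff(2)[OF c(1) assms(1)] by simp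
    qed
    then show ?thesis using a False rho_car[OF g] rho_C[OF g] by (auto simp: join_def)
  qed
qed

lemma act_step:
  assumes "l \<in> car i" "NF N"
  shows "\<exists>u. length u \<le> 1 \<and> (snd (act i l N) = u @ snd N \<or> snd (act i l N) = u @ tl (snd N))"
proof (cases "rest i (snd N)")
  case True
  show ?thesis
  proof (cases "l \<in> C")
    case True then show ?thesis using act_C[OF True assms(2)] by (intro exI[of _ "[]"]) auto
  next
    case False
    then obtain s where "snd (act i l N) = s # snd N" using act_push True assms by blast
    then show ?thesis by (intro exI[of _ "[s]"]) auto
  qed
next
  case False
  then obtain s ss where s: "snd N = s # ss" "s \<in> car i" by (cases "snd N") (auto simp: rest_def)
  from act_top[OF assms s] show ?thesis
  proof
    assume "snd (act i l N) = ss"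
    then show ?thesis using s by (intro exI[of _ "[]"]) auto
  next
    assume "\<exists>s'. s' \<in> car i - C \<and> (l \<notin> C \<longrightarrow> s' \<noteq> s) \<and> snd (act i l N) = s' # ss"
    then obtain s' where "snd (act i l N) = s' # ss" by blast
    then show ?thesis using s by (intro exI[of _ "[s']"]) auto
  qed
qed

lemma wd_length: "set ws \<subseteq> L \<Longrightarrow> NF N \<Longrightarrow> length (snd (\<pi> (wd ws) N)) \<le> length (snd N) + length ws"
proof (induction ws)
  case (Cons l ws)
  then obtain i where i: "l \<in> car i" using L_car(1)[of l] by auto
  have "NF (\<pi> (wd ws) N)" by (rule pi_NF[OF Cons.prems(2)])
  from act_step[OF i this] obtain u where "length u \<le> 1" "snd (act i l (\<pi> (wd ws) N)) = u @ snd (\<pi> (wd ws) N) \<or>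
     snd (act i l (\<pi> (wd ws) N)) = u @ tl (snd (\<pi> (wd ws) N))" by blast
  then have "length (snd (act i l (\<pi> (wd ws) N))) \<le> Suc (length (snd (\<pi> (wd ws) N)))" by auto
  then show ?case using Cons pi_wd_Cons[OF i, of ws N] by auto
qed simp

lemma pi_length: "NF N \<Longrightarrow> length (snd (\<pi> x N)) \<le> length (snd N) + \<nu>0 x"
  using nu0_ex[of x] wd_length[of _ N] by (metis eq_def)

lemma wd_suffix: "set ws \<subseteq> L \<Longrightarrow> NF N \<Longrightarrow> \<exists>u. snd (\<pi> (wd ws) N) = u @ drop (length ws) (snd N)"
proof (induction ws)
  case (Cons l ws)
  then obtain i where i: "l \<in> car i" using L_car(1)[of l] by auto
  have NF': "NF (\<pi> (wd ws) N)" by (rule pi_NF[OF Cons.prems(2)])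
  obtain u where u: "snd (\<pi> (wd ws) N) = u @ drop (length ws) (snd N)" using Cons by auto
  have dr: "drop (length ws) (snd N) = take 1 (drop (length ws) (snd N)) @ drop (Suc (length ws)) (snd N)"
    using append_take_drop_id[of 1 "drop (length ws) (snd N)"] by simp
  have tl: "\<exists>u'. tl (snd (\<pi> (wd ws) N)) = u' @ drop (Suc (length ws)) (snd N)"
  proof (cases u)
    case Nil then show ?thesis by (intro exI[of _ "[]"]) (simp add: u tl_drop drop_Suc)
  next
    case (Cons a u') then show ?thesis using dr by (intro exI[of _ "u' @ take 1 (drop (length ws) (snd N))"]) (simp add: u)
  qed
  have nt: "\<exists>u'. snd (\<pi> (wd ws) N) = u' @ drop (Suc (length ws)) (snd N)"
    using dr u by (metis append.assoc)
  from act_step[OF i NF'] show ?case using tl nt pi_wd_Cons[OF i, of ws N]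
    by (simp del: wd_simps) (metis append.assoc)
qed (auto intro: exI[of _ "[]"])

text \<open>Each letter touches the top syllable only, so \<open>R\<close> letters leave everything
  below depth \<open>R\<close> unchanged.\<close>

lemma pi_suffix: assumes "NF N" "\<nu>0 x \<le> R" shows "\<exists>u. snd (\<pi> x N) = u @ drop R (snd N)"
proof -
  obtain ws where ws: "length ws = \<nu>0 x" "set ws \<subseteq> L" "eq x (wd ws)" using nu0_ex by blast
  obtain u where u: "snd (\<pi> x N) = u @ drop (\<nu>0 x) (snd N)" using wd_suffix[OF ws(2) assms(1)] ws(1,3) by (auto simp: eq_def)
  have "drop (\<nu>0 x) (snd N) = take (R - \<nu>0 x) (drop (\<nu>0 x) (snd N)) @ drop R (snd N)"
    using append_take_drop_id[of "R - \<nu>0 x" "drop (\<nu>0 x) (snd N)"] assms(2) by simp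
  then show ?thesis using u by (metis append.assoc)
qed

text \<open>A letter changes only the top, so at the moment when \<open>v\<close> first appears at
  the bottom, the whole stack is \<open>v\<close>.\<close>

lemma wd_reach:
  assumes "set ws \<subseteq> L" "NF N" "\<not> (\<exists>u. snd N = u @ v)" "\<exists>u. snd (\<pi> (wd ws) N) = u @ v"
  shows "\<exists>k\<le>length ws. snd (\<pi> (wd (drop k ws)) N) = v"
  using assms(1,4)
proof (induction ws)
  case Nil then show ?case using assms(3) by simp
next
  case (Cons l ws)
  show ?case
  proof (cases "\<exists>u. snd (\<pi> (wd ws) N) = u @ v")
    case True
    then obtain k where "k \<le> length ws" "snd (\<pi> (wd (drop k ws)) N) = v" using Cons by auto
    then show ?thesis by (intro exI[of _ "Suc k"]) auto
  next
    case False
    obtain i where i: "l \<in> car i" using L_car(1)[of l] Cons.prems(1) by auto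
    define M where "M = \<pi> (wd ws) N"
    have NF': "NF M" unfolding M_def by (rule pi_NF[OF assms(2)])
    obtain u where u: "snd (act i l M) = u @ v" using Cons.prems(2) pi_wd_Cons[OF i, of ws N] by (auto simp: M_def)
    obtain u' where u': "length u' \<le> 1" "snd (act i l M) = u' @ snd M \<or> snd (act i l M) = u' @ tl (snd M)"
      using act_step[OF i NF'] by blast
    have nt: "\<not> (\<exists>u. tl (snd M) = u @ v)"
    proof
      assume "\<exists>u. tl (snd M) = u @ v"
      then obtain u where "tl (snd M) = u @ v" by blast
      then have "\<exists>u. snd M = u @ v"
      proof (cases "snd M")
        case Nil then show ?thesis using \<open>tl (snd M) = u @ v\<close> by auto
      next
        case (Cons a t) then show ?thesis using \<open>tl (snd M) = u @ v\<close> by (intro exI[of _ "a # u"]) simp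
      qed
      then show False using False unfolding M_def by blast
    qed
    have "u = []"
    proof (cases u)
      case (Cons a u2)
      obtain r where r: "snd (act i l M) = u' @ r" "\<not> (\<exists>u. r = u @ v)" using u'(2) nt False unfolding M_def by blast
      have "u' @ r = a # u2 @ v" using r(1) u Cons by simp
      then have "r = u2 @ v \<or> r = a # u2 @ v" using u'(1) by (cases u') auto
      then show ?thesis using r(2) by (metis append_Cons)
    qed simp
    then show ?thesis using u pi_wd_Cons[OF i, of ws N] by (intro exI[of _ 0]) (simp add: M_def del: wd_simps)
  qed
qed

lemma same_sym: "same l l' \<Longrightarrow> same l' l" by (auto simp: same_def)

lemma red_Cons: "red (l # ws) \<longleftrightarrow> l \<in> L - C \<and> red ws \<and> (ws \<noteq> [] \<longrightarrow> \<not> same l (hd ws))"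
  by (cases ws) (auto simp: red_def)

lemma red_push: "red (l # ws) \<Longrightarrow> \<exists>s i. l \<in> car i \<and> s \<in> car i - C \<and> snd (\<pi> (wd (l # ws)) base) = s # snd (\<pi> (wd ws) base)"
proof (induction ws arbitrary: l)
  case Nil
  then obtain i where i: "l \<in> car i" "l \<notin> C" using L_car(1)[of l] by (auto simp: red_Cons)
  then show ?case using act_push[of l i base] NF_base by (auto simp: rest_def pi_lt)
next
  case (Cons l2 ws)
  obtain i where i: "l \<in> car i" "l \<notin> C" using L_car(1)[of l] Cons.prems by (auto simp: red_Cons)
  obtain s2 j where s2: "l2 \<in> car j" "s2 \<in> car j - C" "snd (\<pi> (wd (l2 # ws)) base) = s2 # snd (\<pi> (wd ws) base)"
  proof -
    have "red (l2 # ws)" using Cons.prems by (simp add: red_Cons)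
    from Cons.IH[OF this] show ?thesis using that by blast
  qed
  have "\<not> same l l2" using Cons.prems by (simp add: red_Cons)
  then have "i \<noteq> j" using s2(1) i unfolding same_def by blast
  then have "rest i (snd (\<pi> (wd (l2 # ws)) base))" using s2 C_int[of s2 j i] by (auto simp: rest_def simp del: wd_simps)
  then obtain s where "s \<in> car i - C" "snd (act i l (\<pi> (wd (l2 # ws)) base)) = s # snd (\<pi> (wd (l2 # ws)) base)"
    using act_push[of l i "\<pi> (wd (l2 # ws)) base"] i pi_NF[OF NF_base] by blast
  then show ?case using i pi_wd_Cons[OF i(1), of "l2 # ws" base] by (metis)
qed

lemma red_list: "red ws \<Longrightarrow> length (snd (\<pi> (wd ws) base)) = length ws"
proof (induction ws)
  case (Cons l ws)
  then show ?case using red_push[OF Cons.prems] by (auto simp: red_Cons simp del: wd_simps)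
qed simp

lemma red_drop: "red ws \<Longrightarrow> snd (\<pi> (wd (drop k ws)) base) = drop k (snd (\<pi> (wd ws) base))"
proof (induction ws arbitrary: k)
  case (Cons l ws)
  obtain s where "snd (\<pi> (wd (l # ws)) base) = s # snd (\<pi> (wd ws) base)" using red_push[OF Cons.prems] by blast
  then show ?case using Cons by (cases k) (auto simp: red_Cons simp del: wd_simps)
qed simp

text \<open>Neighbours in one factor could be merged into a single letter. A letter of
  \<open>C\<close> shares a factor with any neighbour, and in a word of length at least two it has
  one.\<close>

lemma geodesic_red:
  assumes "length ws = \<nu>0 x" "set ws \<subseteq> L" "eq x (wd ws)" "2 \<le> \<nu>0 x"
  shows "red ws"
proof -
  have ns: "\<not> same (ws ! k) (ws ! Suc k)" if k: "Suc k < length ws" for k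
  proof
    assume "same (ws ! k) (ws ! Suc k)"
    then obtain i where i: "ws ! k \<in> car i" "ws ! Suc k \<in> car i" by (auto simp: same_def)
    define u v where "u = take k ws" and "v = drop (Suc (Suc k)) ws"
    have w: "ws = u @ [ws ! k, ws ! Suc k] @ v"
      unfolding u_def v_def using k by (metis Cons_nth_drop_Suc Suc_lessD append_Cons append_Nil append_take_drop_id)
    define w' where "w' = u @ [mu i (ws ! k) (ws ! Suc k)] @ v"
    have "eq (wd w') (wd (u @ [ws ! k, ws ! Suc k] @ v))"
      using eq_mult[OF eq_refl[of "wd u"] eq_mult[OF eq_lt_mult[OF i] eq_refl[of "wd v"]]]
      by (simp add: w'_def mult.assoc)
    then have "eq x (wd w')" using assms(3) w eq_trans eq_sym by metis
    moreover have "set w' \<subseteq> L" unfolding w'_def u_def v_def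
      using assms(2) L_car(2)[OF mu_closed[OF i]] set_take_subset[of k ws] set_drop_subset[of "Suc (Suc k)" ws] by auto
    ultimately have "\<nu>0 x \<le> length w'" using nu0_le by blast
    moreover have "Suc (length w') = length ws" unfolding w'_def by (subst w) simp
    ultimately show False using assms(1) by simp
  qed
  have "l \<notin> C" if "l \<in> set ws" for l
  proof
    assume lC: "l \<in> C"
    obtain k where k: "k < length ws" "l = ws ! k" using \<open>l \<in> set ws\<close> by (metis in_set_conv_nth)
    have sm: "same l l'" if "l' \<in> set ws" for l' using L_car(1)[of l'] assms(2) that C_car[OF lC] by (auto simp: same_def)
    show False
    proof (cases "Suc k < length ws")
      case True then show ?thesis using ns[OF True] sm[of "ws ! Suc k"] k(2) by auto
    next
      case False
      then obtain k' where k': "k = Suc k'" using k(1) assms(1,4) by (cases k) auto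
      then show ?thesis using ns[of k'] sm[of "ws ! k'"] same_sym k by auto
    qed
  qed
  then show ?thesis using assms(2) ns by (auto simp: red_def successively_conv_nth)
qed

lemma tau_drop: "k \<le> length t \<Longrightarrow> tau t (drop k t) = int k"
  by (simp add: tau_def rev_drop lcp_take of_nat_diff)

text \<open>Consecutive letters come from different factors, so a reduced word first pops syllables,
  possibly replaces one, and from then on only pushes. A replacement costs two in the tree for one
  letter, whence the extra 1.\<close>

lemma red_tau_aux:
  assumes "red ws" "NF N"
  shows "(length ws \<le> length (snd N) \<and> snd (\<pi> (wd ws) N) = drop (length ws) (snd N) \<and>
      (ws \<noteq> [] \<longrightarrow> (\<exists>i. hd ws \<in> car i \<and> snd N ! (length ws - 1) \<in> car i - C))) \<or>
    (ws \<noteq> [] \<and> (\<exists>i s r. hd ws \<in> car i \<and> snd (\<pi> (wd ws) N) = s # r \<and> s \<in> car i - C \<and>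
      lcp (rev (snd N)) (rev (s # r)) < length (s # r) \<and>
      (tau (snd N) (s # r) = int (length ws) \<or> tau (snd N) (s # r) = int (length ws) + 1)))"
  using assms(1)
proof (induction ws)
  case Nil then show ?case by simp
next
  case (Cons l ws)
  define t where "t = snd N"
  define M where "M = \<pi> (wd ws) N"
  define k where "k = length ws"
  obtain i where i: "l \<in> car i" "l \<notin> C" using L_car(1)[of l] Cons.prems by (auto simp: red_Cons)
  have NF': "NF M" unfolding M_def by (rule pi_NF[OF assms(2)])
  have pm: "\<pi> (wd (l # ws)) N = act i l M" unfolding M_def by (rule pi_wd_Cons[OF i(1)])
  have ne: "i \<noteq> j" if "ws \<noteq> []" "hd ws \<in> car j" for j
  proof -
    have "\<not> same l (hd ws)" using Cons.prems that(1) by (simp add: red_Cons)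
    then show ?thesis using that(2) i(1) unfolding same_def by blast
  qed
  have red: "red ws" using Cons.prems by (simp add: red_Cons)
  show ?case
    using Cons.IH[OF red]
  proof
    assume "length ws \<le> length (snd N) \<and> snd (\<pi> (wd ws) N) = drop (length ws) (snd N) \<and>
      (ws \<noteq> [] \<longrightarrow> (\<exists>i. hd ws \<in> car i \<and> snd N ! (length ws - 1) \<in> car i - C))"
    then have h: "k \<le> length t" "snd M = drop k t" "ws \<noteq> [] \<Longrightarrow> \<exists>i. hd ws \<in> car i \<and> t ! (k - 1) \<in> car i - C"
      by (auto simp: M_def k_def t_def)
    show ?case
    proof (cases "rest i (snd M)")
      case True
      then obtain s where s: "s \<in> car i - C" "snd (act i l M) = s # drop k t" using act_push[of l i M] i NF' h(2) by auto
      have "rev t ! (length t - k) \<noteq> s" if "length t - k < length (rev t)"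
      proof -
        have k0: "ws \<noteq> []" "0 < k" using that by (auto simp: k_def)
        obtain j where j: "hd ws \<in> car j" "t ! (k - 1) \<in> car j - C" using h(3) k0 by blast
        have "rev t ! (length t - k) = t ! (k - 1)" using that h(1) k0 by (simp add: rev_nth Suc_diff_Suc)
        then show ?thesis using j s(1) ne[OF k0(1) j(1)] C_int[of s i j] by auto
      qed
      then have lc: "lcp (rev t) (rev (s # drop k t)) = length t - k"
        using lcp_take_snoc[of "length t - k" "rev t" s] by (simp add: rev_drop)
      moreover have "tau t (s # drop k t) = int (Suc k)" unfolding tau_def lc using h(1) by (simp add: of_nat_diff)
      ultimately show ?thesis unfolding pm using s i h(1) by (intro disjI2[of "_ \<and> _"] conjI exI[of _ i] exI[of _ s] exI[of _ "drop k t"]) (auto simp: t_def k_def)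
    next
      case False
      then obtain s r where s: "snd M = s # r" "s \<in> car i" by (cases "snd M") (auto simp: rest_def)
      have kl: "k < length t" using s h by (metis drop_all list.distinct(1) not_less)
      have sr: "s = t ! k" "r = drop (Suc k) t" using s(1) h(2) kl by (metis Cons_nth_drop_Suc list.inject)+
      have sC: "s \<in> car i - C" using nfl_Cons[of s r i] NF' s by (auto simp: NF_def)
      from act_top[OF i(1) NF' s] show ?thesis
      proof
        assume "snd (act i l M) = r"
        then show ?thesis unfolding pm using kl sC sr i(1) by (intro disjI1) (auto simp: t_def k_def)
      next
        assume "\<exists>s'. s' \<in> car i - C \<and> (l \<notin> C \<longrightarrow> s' \<noteq> s) \<and> snd (act i l M) = s' # r"
        then obtain s' where s': "s' \<in> car i - C" "s' \<noteq> s" "snd (act i l M) = s' # r" using i(2) by blast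
        have "rev t ! (length t - Suc k) = t ! k" using kl by (simp add: rev_nth)
        then have lc: "lcp (rev t) (rev (s' # r)) = length t - Suc k"
          using lcp_take_snoc[of "length t - Suc k" "rev t" s'] s'(2) sr by (simp add: rev_drop)
        moreover have "tau t (s' # r) = int (Suc k) + 1" unfolding tau_def lc using kl sr by (simp add: of_nat_diff)
        ultimately show ?thesis unfolding pm using s' i kl sr(2) by (intro disjI2[of "_ \<and> _"] conjI exI[of _ i] exI[of _ s'] exI[of _ r]) (auto simp: t_def k_def)
      qed
    qed
  next
    assume "ws \<noteq> [] \<and> (\<exists>i s r. hd ws \<in> car i \<and> snd (\<pi> (wd ws) N) = s # r \<and> s \<in> car i - C \<and>
      lcp (rev (snd N)) (rev (s # r)) < length (s # r) \<and>
      (tau (snd N) (s # r) = int (length ws) \<or> tau (snd N) (s # r) = int (length ws) + 1))"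
    then obtain j s r where h: "ws \<noteq> []" "hd ws \<in> car j" "snd M = s # r" "s \<in> car j - C"
      "lcp (rev t) (rev (s # r)) < length (s # r)" "tau t (s # r) = int k \<or> tau t (s # r) = int k + 1"
      unfolding M_def t_def k_def by blast
    have "rest i (snd M)" using h(3,4) ne[OF h(1,2)] C_int[of s j i] by (auto simp: rest_def)
    then obtain s' where s': "s' \<in> car i - C" "snd (act i l M) = s' # s # r" using act_push[of l i M] i NF' h(3) by auto
    have lc: "lcp (rev t) (rev (s' # s # r)) = lcp (rev t) (rev (s # r))"
      using lcp_snoc[of "rev t" "rev (s # r)" "[s']"] h(5) by simp
    have "tau t (s' # s # r) = tau t (s # r) + 1" unfolding tau_def lc by simp
    then show ?thesis unfolding pm using s' i lc h(5,6) by (intro disjI2[of "_ \<and> _"] conjI exI[of _ i] exI[of _ s'] exI[of _ "s # r"]) (auto simp: t_def k_def)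
  qed
qed

lemma red_tau:
  assumes "red ws" "NF N"
  shows "\<bar>tau (snd N) (snd (\<pi> (wd ws) N)) - int (length ws)\<bar> \<le> 1"
  using red_tau_aux[OF assms] tau_drop[of "length ws" "snd N"] by auto

lemma nu0_tau:
  assumes "NF N" shows "\<bar>tau (snd N) (snd (\<pi> x N)) - int (\<nu>0 x)\<bar> \<le> 1"
proof -
  obtain ws where ws: "length ws = \<nu>0 x" "set ws \<subseteq> L" "eq x (wd ws)" using nu0_ex by blast
  have px: "\<pi> x = \<pi> (wd ws)" using ws(3) by (simp add: eq_def)
  have t0: "tau t t = 0" for t :: "'a list" using tau_drop[of 0 t] by simp
  consider "2 \<le> \<nu>0 x" | "ws = []" | l where "ws = [l]" "l \<in> C" | l where "ws = [l]" "l \<notin> C"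
  proof -
    have "ws = [] \<or> (\<exists>l. ws = [l]) \<or> 2 \<le> length ws" by (cases ws rule: remdups_adj.cases) auto
    then show ?thesis using ws(1) that by auto
  qed
  then show ?thesis
  proof cases
    case 1 then show ?thesis using red_tau[OF geodesic_red[OF ws] assms] px ws(1) by simp
  next
    case 2 then show ?thesis using t0 px ws(1) by simp
  next
    case 3
    then have "snd (\<pi> x N) = snd N" using act_C[OF 3(2) assms] pi_lt[OF C_car[OF 3(2)], of True] px by simp
    then show ?thesis using t0 3 ws(1) by simp
  next
    case 4
    then have "red ws" using ws(2) by (simp add: red_def)
    then show ?thesis using red_tau[OF _ assms, of ws] px ws(1) by simp
  qed
qed

text \<open>The constant 4 comes from the four distances in the inequality, each within 1 of a tree
  distance.\<close>

lemma hyp0: "hyp \<nu>0 4"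
proof (intro hyp.intro gnorm0 hyp_axioms.intro)
  fix x y z t :: "'a fg"
  define f where "f x = snd (\<pi> (inverse x) base)" for x :: "'a fg"
  have df: "\<bar>real_of_int (tau (f y) (f x)) - g.d x y\<bar> \<le> 1" for x y
  proof -
    have "\<bar>tau (f y) (f x) - int (\<nu>0 (inverse x * y))\<bar> \<le> 1"
      using nu0_tau[OF pi_NF[OF NF_base], of "inverse y" "inverse x * y"] by (simp add: f_def)
    then show ?thesis unfolding g.d_def by linarith
  qed
  have "tau (f z) (f x) + tau (f t) (f y) \<le> tau (f y) (f x) + tau (f t) (f z) \<or>
        tau (f z) (f x) + tau (f t) (f y) \<le> tau (f t) (f x) + tau (f z) (f y)"
  proof -
    have s: "tau a b = tau b a" for a b :: "'a list" unfolding tau_def using lcp_sym[of "rev a" "rev b"] by simp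
    show ?thesis using tau_four[of "f x" "f z" "f y" "f t"] s by metis
  qed
  then show "g.d x z + g.d y t \<le> g.d x y + g.d z t + 4 \<or> g.d x z + g.d y t \<le> g.d x t + g.d y z + 4"
    using df[of z x] df[of t y] df[of y x] df[of t z] df[of t x] df[of z y] by linarith
qed simp

text \<open>The group element spelled by a normal form; its equivariance \<open>val_pi\<close>
  yields faithfulness.\<close>

definition val :: "'a \<times> 'a list \<Rightarrow> 'a fg" where "val N = lt (fst N) * wd (snd N)"

lemma val_join: assumes "SP i N" shows "eq (val (join i N)) (val N)"
proof (cases "fst N \<in> C")
  case False
  have f: "fst N \<in> car i" using assms by (simp add: SP_def)
  have "eq (lt (mu i (\<kappa> i (fst N)) (\<rho> i (fst N)))) (lt (\<kappa> i (fst N)) * lt (\<rho> i (fst N)))"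
    by (rule eq_lt_mult) (use kappa_C[OF f] C_car rho_car[OF f] in auto)
  then have "eq (lt (fst N) * wd (snd N)) (lt (\<kappa> i (fst N)) * lt (\<rho> i (fst N)) * wd (snd N))"
    using kappa_rho[OF f] by (intro eq_mult eq_refl) simp
  then show ?thesis using False eq_sym by (simp add: val_def join_def mult.assoc)
qed (simp add: join_def)

lemma val_act: assumes "NF N" "l \<in> car i" shows "eq (lt l * val N) (val (act i l N))"
proof -
  define M where "M = split i N"
  have M: "SP i M" unfolding M_def by (rule SP_split[OF assms(1)])
  have "eq (val N) (val M)" using val_join[OF M] join_split[OF assms(1), of i] by (simp add: M_def)
  then have "eq (lt l * val N) (lt l * (lt (fst M) * wd (snd M)))" by (intro eq_mult eq_refl) (simp add: val_def)
  moreover have "eq (lt (mu i l (fst M)) * wd (snd M)) (lt l * lt (fst M) * wd (snd M))"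
    using M assms(2) by (intro eq_mult eq_refl eq_lt_mult) (auto simp: SP_def)
  ultimately have "eq (lt l * val N) (val (mu i l (fst M), snd M))"
    unfolding eq_def val_def by (simp add: mult.assoc)
  moreover have "eq (val (act i l N)) (val (mu i l (fst M), snd M))"
    using val_join[OF act_SP[OF M assms(2)]] assms by (simp add: act_def M_def)
  ultimately show ?thesis using eq_sym eq_trans by blast
qed

lemma val_pi: assumes "NF N" shows "eq (x * val N) (val (\<pi> x N))"
proof -
  have w: "set ws \<subseteq> L \<Longrightarrow> eq (wd ws * val N) (val (\<pi> (wd ws) N))" for ws
  proof (induction ws)
    case (Cons l ws)
    then obtain i where i: "l \<in> car i" using L_car(1)[of l] by auto
    have "eq (lt l * (wd ws * val N)) (lt l * val (\<pi> (wd ws) N))" using Cons by (intro eq_mult eq_refl) simp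
    moreover have "eq (lt l * val (\<pi> (wd ws) N)) (val (act i l (\<pi> (wd ws) N)))"
      by (rule val_act[OF pi_NF[OF assms] i])
    ultimately show ?case using eq_trans pi_wd_Cons[OF i, of ws N] by (simp add: mult.assoc)
  qed simp
  obtain ws where ws: "set ws \<subseteq> L" "eq x (wd ws)" using wd_surj by blast
  have "eq (x * val N) (wd ws * val N)" by (intro eq_mult ws eq_refl)
  then show ?thesis using w[OF ws(1)] eq_trans ws(2) by (metis eq_def)
qed

lemma pi_faithful: assumes "NF N" "\<pi> x N = \<pi> y N" shows "eq x y"
proof -
  have "eq (x * val N) (y * val N)" using val_pi[OF assms(1), of x] val_pi[OF assms(1), of y] assms(2) eq_sym eq_trans by metis
  from eq_mult[OF this eq_refl, of "inverse (val N)"] show ?thesis by (simp add: mult.assoc)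
qed

lemma lt_power: "l \<in> car i \<Longrightarrow> eq (lt l ^ n) (lt (l [^]\<^bsub>GG i\<^esub> n))"
proof (induction n)
  case 0 show ?case using eq_lt_e eq_sym by (simp add: e_one)
next
  case (Suc n)
  have p: "l [^]\<^bsub>GG i\<^esub> n \<in> car i" using monoid.nat_pow_closed[OF group.is_monoid[OF grp] Suc.prems] .
  have "eq (lt l ^ n * lt l) (lt (l [^]\<^bsub>GG i\<^esub> n) * lt l)" using Suc by (intro eq_mult eq_refl) auto
  then have "eq (lt l ^ n * lt l) (lt (mu i (l [^]\<^bsub>GG i\<^esub> n) l))"
    using eq_lt_mult[OF p Suc.prems] eq_sym eq_trans by blast
  then show ?case by (simp add: power_Suc2 del: power_Suc)
qed

text \<open>This is where periodicity of the factors enters: length at most one means being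
  represented in a factor.\<close>

lemma short_torsion: assumes "\<nu>0 z \<le> 1" shows "g.torsion z"
proof -
  obtain ws where ws: "length ws = \<nu>0 z" "set ws \<subseteq> L" "eq z (wd ws)" using nu0_ex by blast
  show ?thesis
  proof (cases ws)
    case Nil
    then show ?thesis using ws unfolding g.torsion_def g.K_def by (intro exI[of _ 1]) (simp add: nu0_zero)
  next
    case (Cons l vs)
    then have w: "ws = [l]" using ws(1) assms by (cases vs) auto
    then obtain i where i: "l \<in> car i" using ws(2) L_car(1)[of l] by auto
    have "periodic_group (GG i)" using perA perB by (simp add: GG_def)
    then obtain n :: nat where n: "0 < n" "l [^]\<^bsub>GG i\<^esub> n = e" using i unfolding periodic_group_def e_one by blast
    have "g.eqK (z ^ n) (lt l ^ n)" by (rule g.eqK_power) (use ws(3) w in \<open>simp add: eqK0\<close>)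
    then have "eq (z ^ n) 1" unfolding eqK0 using lt_power[OF i, of n] n(2) eq_lt_e eq_trans by metis
    then show ?thesis using n(1) unfolding g.torsion_def g.K_def by (auto simp: nu0_zero)
  qed
qed

lemma red_append: "red u \<Longrightarrow> red v \<Longrightarrow> (u \<noteq> [] \<Longrightarrow> v \<noteq> [] \<Longrightarrow> \<not> same (last u) (hd v)) \<Longrightarrow> red (u @ v)"
  by (auto simp: red_def successively_append_iff)

text \<open>If the last and first letters lay in one factor, conjugation by the last letter would
  merge them and shorten the word.\<close>

lemma cyc_red:
  assumes min: "\<And>x. \<nu>0 z \<le> \<nu>0 (inverse x * z * x)"
    and ws: "length ws = \<nu>0 z" "set ws \<subseteq> L" "eq z (wd ws)" "2 \<le> \<nu>0 z"
  shows "\<not> same (last ws) (hd ws)"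
proof
  assume sm: "same (last ws) (hd ws)"
  obtain l vs where 1: "ws = l # vs" "vs \<noteq> []" using ws(1,4) by (cases ws; cases "tl ws") auto
  define us b where "us = butlast vs" and "b = last vs"
  have w: "ws = l # us @ [b]" using 1 by (simp add: us_def b_def)
  obtain i where i: "b \<in> car i" "l \<in> car i" using sm by (auto simp: w same_def)
  have "eq (lt b * z * inverse (lt b)) (lt b * (lt l * (wd us * lt b)) * inverse (lt b))"
    using ws(3) by (intro eq_mult eq_refl) (simp add: w)
  then have "eq (lt b * z * inverse (lt b)) (lt b * lt l * wd us)" by (simp add: mgs)
  then have "eq (lt b * z * inverse (lt b)) (wd (mu i b l # us))"
    using eq_mult[OF eq_lt_mult[OF i] eq_refl, of "wd us"] unfolding eq_def by simp
  then have "\<nu>0 (lt b * z * inverse (lt b)) \<le> length (mu i b l # us)"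
    using ws(2) L_car(2)[OF mu_closed[OF i]] by (intro nu0_le) (auto simp: w)
  then show False using min[of "inverse (lt b)"] ws(1) by (simp add: w)
qed

text \<open>For weak proper discontinuity, compare the path of the reduced word \<open>w = z ^ M\<close> with its image
  under \<open>f\<close>: they share a vertex of the tree, whence \<open>f = P y S\<close> up to a fixed factor, where \<open>P\<close> is
  a prefix of \<open>w\<close> and \<open>y\<close> lies in the finite group \<open>C\<close>.\<close>

lemma minimal_lox_wpd:
  assumes min: "\<And>x. \<nu>0 z \<le> \<nu>0 (inverse x * z * x)" and z2: "2 \<le> \<nu>0 z"
  shows "g.lox z \<and> g.wpd z"
proof -
  obtain ws where ws: "length ws = \<nu>0 z" "set ws \<subseteq> L" "eq z (wd ws)" using nu0_ex by blast
  have red: "red ws" by (rule geodesic_red[OF ws z2])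
  have cyc: "\<not> same (last ws) (hd ws)" by (rule cyc_red[OF min ws z2])
  define wp where "wp m = concat (replicate m ws)" for m
  have wp: "wp (Suc m) = ws @ wp m" "wp 0 = []" for m by (simp_all add: wp_def)
  have ws0: "ws \<noteq> []" using ws(1) z2 by auto
  have wh: "wp m \<noteq> [] \<Longrightarrow> hd (wp m) = hd ws" for m using ws0 by (cases m) (auto simp: wp)
  have wred: "red (wp m)" for m
  proof (induction m)
    case 0 then show ?case by (simp add: wp red_def)
  next
    case (Suc m)
    show ?case unfolding wp by (rule red_append[OF red Suc]) (use cyc wh in auto)
  qed
  have wL: "set (wp m) \<subseteq> L" for m using wred[of m] by (auto simp: red_def)
  have wlen: "length (wp m) = m * \<nu>0 z" for m by (induction m) (auto simp: wp ws(1))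
  have zw: "eq (z ^ m) (wd (wp m))" for m
  proof (induction m)
    case (Suc m) then show ?case using eq_mult[OF ws(3) Suc] by (simp add: wp)
  qed (simp add: wp)
  have "g.lox z"
    unfolding g.lox_def
  proof (intro exI[of _ "1::real"] conjI allI)
    fix m
    have "length (snd (\<pi> (z ^ m) base)) = m * \<nu>0 z" using red_list[OF wred[of m]] zw[of m] wlen by (simp add: eq_def)
    then have "m * \<nu>0 z \<le> \<nu>0 (z ^ m)" using pi_length[OF NF_base, of "z ^ m"] by simp
    moreover have "m * 1 \<le> m * \<nu>0 z" using z2 by (intro mult_le_mono2) simp
    ultimately have "m \<le> \<nu>0 (z ^ m)" by linarith
    then show "1 * real m \<le> real (\<nu>0 (z ^ m))" by simp
  qed simp
  moreover have "g.wpd z"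
    unfolding g.wpd_def
  proof (intro allI)
    fix R M0 :: nat
    \<comment> \<open>Then \<open>w\<close> has more than \<open>2 * R\<close> letters, so the part
      \<open>v\<close> of its stack below depth \<open>R\<close> is too long to occur in the stack
      of \<open>f'\<close>, which has at most \<open>R\<close> syllables.\<close>
    define M where "M = M0 + 2 * R + 1"
    define w where "w = wp M"
    define S where "S = wd (drop R w)"
    define F where "F = (\<lambda>(k, y). wd (take k w) * (lt y * S) * inverse (z ^ M)) ` ({..length w} \<times> C)"
    have len: "2 * R < length w"
    proof -
      have "M * 1 \<le> M * \<nu>0 z" using z2 by (intro mult_le_mono2) simp
      then have "M \<le> length w" by (simp only: w_def wlen mult_1_right)
      then show ?thesis by (simp add: M_def)
    qed
    have pz: "\<pi> (z ^ M) = \<pi> (wd w)" using zw[of M] by (simp add: eq_def w_def)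
    have main: "\<exists>e\<in>F. g.eqK e f" if f: "\<nu>0 f \<le> R" "\<nu>0 (inverse (z ^ M) * f * z ^ M) \<le> R" for f
    proof -
      define f' where "f' = inverse (z ^ M) * f * z ^ M"
      have ff: "f * z ^ M = z ^ M * f'" by (simp add: f'_def mgs)
      define t where "t = snd (\<pi> (wd w) base)"
      define v where "v = drop R t"
      have tl: "length t = length w" unfolding t_def w_def by (rule red_list[OF wred])
      have vS: "snd (\<pi> S base) = v" unfolding S_def v_def t_def w_def by (rule red_drop[OF wred])
      have NS: "NF (\<pi> (wd w) base)" by (rule pi_NF[OF NF_base])
      have "\<exists>u. snd (\<pi> f (\<pi> (wd w) base)) = u @ v" unfolding v_def t_def by (rule pi_suffix[OF NS f(1)])
      moreover have "\<pi> f (\<pi> (wd w) base) = \<pi> (wd w) (\<pi> f' base)"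
        using ff pi_mult[of f "z ^ M" base] pi_mult[of "z ^ M" f' base] pz by simp
      ultimately have ends: "\<exists>u. snd (\<pi> (wd w) (\<pi> f' base)) = u @ v" by simp
      have "length (snd (\<pi> f' base)) \<le> R" using pi_length[OF NF_base, of f'] f(2) by (simp add: f'_def)
      moreover have "R < length v" using len tl by (simp add: v_def)
      ultimately have "\<not> (\<exists>u. snd (\<pi> f' base) = u @ v)" by auto
      then obtain k where k: "k \<le> length w" "snd (\<pi> (wd (drop k w)) (\<pi> f' base)) = v"
        using wd_reach[OF _ pi_NF[OF NF_base] _ ends] wL by (auto simp: w_def)
      define Q where "Q = wd (drop k w) * f'"
      have Qv: "snd (\<pi> Q base) = v" using k(2) by (simp add: Q_def)
      define c1 c2 where "c1 = fst (\<pi> Q base)" and "c2 = fst (\<pi> S base)"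
      have c: "c1 \<in> C" "c2 \<in> C" using pi_NF[OF NF_base, of Q] pi_NF[OF NF_base, of S] by (auto simp: c1_def c2_def NF_def)
      \<comment> \<open>The normal forms of \<open>Q\<close> and \<open>S\<close> have the same
        stack \<open>v\<close>, so they differ by an element of \<open>C\<close>.\<close>
      define y where "y = mu True c1 (iv True c2)"
      have y: "y \<in> C" unfolding y_def using c mu_CC iv_C by blast
      have cc: "c1 \<in> car True" "c2 \<in> car True" using c C_car by auto
      have yc: "mu True y c2 = c1" using cc by (simp add: y_def mu_assoc iv_closed mu_iv mu_e)
      have "\<pi> (lt y * S) base = act True y (\<pi> S base)" using pi_lt[OF C_car[OF y], of True] by simp
      also have "\<dots> = (c1, v)" using act_C[OF y pi_NF[OF NF_base], of True S] vS yc by (simp add: c2_def)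
      also have "\<dots> = \<pi> Q base" using Qv by (simp add: c1_def prod_eq_iff)
      finally have "eq (lt y * S) Q" using pi_faithful[OF NF_base] by blast
      then have "eq (wd (take k w) * (lt y * S) * inverse (z ^ M)) (wd (take k w) * Q * inverse (z ^ M))"
        by (intro eq_mult eq_refl)
      moreover have "wd (take k w) * Q * inverse (z ^ M) = wd w * f' * inverse (z ^ M)"
        using wd_simps(3)[of "take k w" "drop k w"] by (simp add: Q_def mult.assoc)
      moreover have "eq (wd w * f' * inverse (z ^ M)) (z ^ M * f' * inverse (z ^ M))"
        using zw[of M] eq_sym by (intro eq_mult eq_refl) (simp add: w_def)
      moreover have "z ^ M * f' * inverse (z ^ M) = f" by (simp add: f'_def mgs)
      ultimately have "eq (wd (take k w) * (lt y * S) * inverse (z ^ M)) f" using eq_trans by metis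
      then show ?thesis unfolding F_def eqK0 using k(1) y by force
    qed
    have "finite F" unfolding F_def using finC by simp
    then have "g.finK {f. \<nu>0 f \<le> R \<and> \<nu>0 (inverse (z ^ M) * f * z ^ M) \<le> R}" unfolding g.finK_def using main by blast
    then show "\<exists>M\<ge>M0. g.finK {f. \<nu>0 f \<le> R \<and> \<nu>0 (inverse (z ^ M) * f * z ^ M) \<le> R}"
      by (intro exI[of _ M]) (simp add: M_def)
  qed
  ultimately show ?thesis by blast
qed

theorem admissible0: "admissible \<nu>0"
  unfolding admissible_def
proof (intro conjI allI)
  show "\<exists>\<delta>. hyp \<nu>0 \<delta>" using hyp0 by blast
  fix h
  obtain x0 where x0: "\<And>x. \<nu>0 (inverse x0 * h * x0) \<le> \<nu>0 (inverse x * h * x)"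
    using ex_has_least_nat[of "\<lambda>_. True" 1 "\<lambda>x. \<nu>0 (inverse x * h * x)"] by auto
  define z where "z = inverse x0 * h * x0"
  have min: "\<nu>0 z \<le> \<nu>0 (inverse x * z * x)" for x using x0[of "x0 * x"] by (simp add: z_def mgs)
  have eqz: "g.eqK z (inverse x0 * h * x0)" by (simp add: z_def)
  show "g.torsion h \<or> g.lox h \<and> g.wpd h"
  proof (cases "\<nu>0 z \<le> 1")
    case True
    then show ?thesis using g.torsion_conj[OF short_torsion eqz] by blast
  next
    case False
    then have "g.lox z \<and> g.wpd z" using minimal_lox_wpd[OF min] by simp
    then show ?thesis using g.lox_conj[OF _ eqz] g.wpd_conj[OF _ eqz] by blast
  qed
qed

end

section \<open>The periodic quotient\<close>

context amalg
begin

lemma lt_base: "l \<in> car i \<Longrightarrow> \<pi> (lt l) base = join i (l, [])"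
  using NF_base by (simp add: pi_lt[of l i] act_def split_def rest_def mu_e)

lemma lt_inj:
  assumes l: "l \<in> car i" "l' \<in> car j" and eq: "eq (lt l) (lt l')" shows "l = l'"
proof -
  have j: "join i (l, []) = join j (l', [])" using eq lt_base[OF l(1)] lt_base[OF l(2)] by (simp add: eq_def)
  show ?thesis
  proof (cases "l \<in> C \<or> l' \<in> C")
    case True
    then show ?thesis using j by (auto simp: join_def split: if_splits)
  next
    case False
    then have kr: "\<kappa> i l = \<kappa> j l'" "\<rho> i l = \<rho> j l'" using j by (auto simp: join_def)
    have "\<rho> i l \<notin> C" using rho_C[OF l(1)] False by blast
    then have ij: "i = j" using C_int[of "\<rho> i l" i j] rho_car[OF l(1)] rho_car[OF l(2)] kr(2) by metis
    have "l = mu i (\<kappa> i l) (\<rho> i l)" by (rule sym) (rule kappa_rho[OF l(1)])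
    also have "\<dots> = mu j (\<kappa> j l') (\<rho> j l')" by (simp only: kr) (simp only: ij)
    also have "\<dots> = l'" by (rule kappa_rho[OF l(2)])
    finally show ?thesis .
  qed
qed

text \<open>The set \<open>K\<close> is the increasing union of the kernels, and \<open>h\<close>
  runs through all words, so every element gets a power in \<open>K\<close>. An element of length at
  most two stays that short at every stage, so the injectivity of each step applies to it.\<close>

lemma limit_norm:
  assumes "countable L"
  obtains K :: "'a fg set" and h :: "nat \<Rightarrow> 'a fg" where
    "subgrp K" "\<And>g k. k \<in> K \<Longrightarrow> g * k * inverse g \<in> K"
    "\<And>x. \<exists>n>0. x ^ n \<in> K" "\<And>x. \<nu>0 x \<le> 2 \<Longrightarrow> x \<in> K \<Longrightarrow> \<nu>0 x = 0" "\<And>x. \<nu>0 x = 0 \<Longrightarrow> x \<in> K"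
    "\<And>x. \<exists>n. inverse (h n) * x \<in> K"
proof -
  define WW where "WW = (\<lambda>ws. wd ws) ` lists L"
  have "countable WW" unfolding WW_def using countable_lists[OF assms] by simp
  moreover have "WW \<noteq> {}" unfolding WW_def by blast
  ultimately have h: "range (from_nat_into WW) = WW" by (intro range_from_nat_into)
  define h where "h = from_nat_into WW"
  note h = h[folded h_def]
  define P where "P \<nu> f \<nu>' \<longleftrightarrow> admissible \<nu>' \<and> (\<forall>x. \<nu>' x \<le> \<nu> x) \<and> (\<exists>n>0. \<nu>' (f ^ n) = 0) \<and>
     (\<forall>x. \<nu> x \<le> 2 \<longrightarrow> \<nu>' x = 0 \<longrightarrow> \<nu> x = 0)" for \<nu> :: "'a fg \<Rightarrow> nat" and f \<nu>'
  obtain st where st: "\<And>\<nu> f. admissible \<nu> \<Longrightarrow> P \<nu> f (st \<nu> f)"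
    using admissible_step unfolding P_def by metis
  define N where "N = rec_nat \<nu>0 (\<lambda>n \<nu>. st \<nu> (h n))"
  have N0: "N 0 = \<nu>0" and NS: "N (Suc n) = st (N n) (h n)" for n by (simp_all add: N_def)
  have adm: "admissible (N n)" for n
  proof (induction n)
    case 0 then show ?case by (simp add: N0 admissible0)
  next
    case (Suc n) then show ?case using st[OF Suc] by (simp add: NS P_def)
  qed
  have step: "P (N n) (h n) (N (Suc n))" for n unfolding NS by (rule st[OF adm])
  have gn: "gnorm (N n)" for n using adm[of n] hyp.axioms(1) unfolding admissible_def by blast
  have mono: "m \<le> n \<Longrightarrow> N n x \<le> N m x" for m n x
    by (rule lift_Suc_antimono_le[of "\<lambda>n. N n x"]) (use step in \<open>auto simp: P_def\<close>)
  define K where "K = {x. \<exists>n. N n x = 0}"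
  have up: "m \<le> n \<Longrightarrow> N m x = 0 \<Longrightarrow> N n x = 0" for m n x using mono[of m n x] by simp
  have K0: "\<nu>0 x = 0 \<Longrightarrow> x \<in> K" for x unfolding K_def using N0 by (auto intro: exI[of _ 0])
  have sub: "subgrp K"
    unfolding subgrp_def
  proof (intro conjI ballI)
    show "1 \<in> K" by (rule K0) (simp add: nu0_zero)
    show "x * y \<in> K" if xy: "x \<in> K" "y \<in> K" for x y
    proof -
      obtain m n where "N m x = 0" "N n y = 0" using xy unfolding K_def by blast
      then have "N (max m n) x = 0" "N (max m n) y = 0" using up[of m "max m n" x] up[of n "max m n" y] by auto
      then have "N (max m n) (x * y) = 0" using gnorm.nu_mult[OF gn, of "max m n" x y] by simp
      then show ?thesis unfolding K_def by blast
    qed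
    show "inverse x \<in> K" if "x \<in> K" for x using that gnorm.nu_inv[OF gn] unfolding K_def by simp
  qed
  have conj: "g * k * inverse g \<in> K" if "k \<in> K" for g k using that gnorm.nu_normal[OF gn] unfolding K_def by blast
  have rep: "\<exists>n. inverse (h n) * x \<in> K" for x
  proof -
    obtain ws where ws: "set ws \<subseteq> L" "eq x (wd ws)" using wd_surj by blast
    then obtain n where n: "wd ws = h n" using h unfolding WW_def by (metis (no_types, lifting) imageE imageI in_lists_conv_set subsetD)
    have "eq (inverse (h n) * x) (inverse (h n) * h n)" by (rule eq_mult) (use ws(2) n in auto)
    then have "\<nu>0 (inverse (h n) * x) = 0" by (simp add: nu0_zero)
    then show ?thesis using K0 by blast
  qed
  have tors: "\<exists>n>0. x ^ n \<in> K" for x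
  proof -
    obtain ws where ws: "set ws \<subseteq> L" "eq x (wd ws)" using wd_surj by blast
    then obtain n where n: "wd ws = h n" using h unfolding WW_def by (metis (no_types, lifting) imageE imageI in_lists_conv_set subsetD)
    obtain k where k: "0 < k" "N (Suc n) (h n ^ k) = 0" using step[of n] by (auto simp: P_def)
    then have hk: "h n ^ k \<in> K" unfolding K_def by blast
    have "eq (x ^ k) (h n ^ k)" for k
    proof (induction k)
      case (Suc k) then show ?case using eq_mult[OF ws(2) Suc] n by simp
    qed simp
    then have "eq (x ^ k * inverse (h n ^ k)) (h n ^ k * inverse (h n ^ k))" by (rule eq_mult) simp
    then have "x ^ k * inverse (h n ^ k) \<in> K" by (intro K0) (simp add: nu0_zero)
    from subgrp_mult[OF sub this hk] show ?thesis using k(1) by (auto simp: mgs)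
  qed
  have inj: "\<nu>0 x = 0" if x: "\<nu>0 x \<le> 2" "x \<in> K" for x
  proof -
    obtain n where "N n x = 0" using x(2) by (auto simp: K_def)
    then show ?thesis
    proof (induction n)
      case 0 then show ?case by (simp add: N0)
    next
      case (Suc n)
      have "N n x \<le> 2" using mono[of 0 n x] x(1) by (simp add: N0)
      then show ?case using Suc step[of n] by (auto simp: P_def)
    qed
  qed
  show ?thesis using that[of K h] sub conj tors inj K0 rep by blast
qed

theorem embedding:
  assumes "countable (carrier A)" "countable (carrier B)"
  shows "\<exists>G :: ('a + nat) monoid. periodic_group G \<and> contains_amalgam G A B C"
proof -
  have "countable L" using assms by (simp add: L_def GG_def)
  then obtain K and h :: "nat \<Rightarrow> 'a fg" where
    sub: "subgrp K" and conj: "\<And>g k. k \<in> K \<Longrightarrow> g * k * inverse g \<in> K"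
    and tors: "\<And>x. \<exists>n>0. x ^ n \<in> K" and inj: "\<And>x. \<nu>0 x \<le> 2 \<Longrightarrow> x \<in> K \<Longrightarrow> \<nu>0 x = 0"
    and K0: "\<And>x. \<nu>0 x = 0 \<Longrightarrow> x \<in> K" and rep: "\<And>x. \<exists>n. inverse (h n) * x \<in> K"
    by (rule limit_norm) blast
  define q where "q x = (LEAST n. inverse (h n) * x \<in> K)" for x
  have hq: "inverse (h (q x)) * x \<in> K" for x unfolding q_def using rep by (rule LeastI_ex)
  have q_eq: "q x = q y" if "inverse x * y \<in> K" for x y
  proof -
    have "inverse (h n) * x \<in> K \<longleftrightarrow> inverse (h n) * y \<in> K" for n
      using subgrp_mult[OF sub, of "inverse (h n) * x" "inverse x * y"]
        subgrp_mult[OF sub, of "inverse (h n) * y" "inverse (inverse x * y)"] subgrp_inv[OF sub that] that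
      by (auto simp: mgs)
    then show ?thesis by (simp add: q_def)
  qed
  have q_iff: "q x = q y \<longleftrightarrow> inverse x * y \<in> K" for x y
  proof
    assume "q x = q y"
    then have "inverse (inverse (h (q x)) * x) * (inverse (h (q x)) * y) \<in> K"
      using subgrp_mult[OF sub subgrp_inv[OF sub hq[of x]] hq[of y]] by simp
    then show "inverse x * y \<in> K" by (simp add: mgs)
  qed (rule q_eq)
  define \<Phi> :: "'a fg \<Rightarrow> 'a + nat" where "\<Phi> x = Inr (q x)" for x
  define G where "G = \<lparr>carrier = range \<Phi>, monoid.mult = (\<lambda>u v. \<Phi> (h (projr u) * h (projr v))), one = \<Phi> 1\<rparr>"
  have Phi_iff: "\<Phi> x = \<Phi> y \<longleftrightarrow> inverse x * y \<in> K" for x y by (simp add: \<Phi>_def q_iff)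
  have Phi_mult: "\<Phi> x \<otimes>\<^bsub>G\<^esub> \<Phi> y = \<Phi> (x * y)" for x y
  proof -
    have "inverse y * (inverse (h (q x)) * x) * inverse (inverse y) \<in> K" by (rule conj[OF hq])
    from subgrp_mult[OF sub hq[of y] this]
    have "inverse (h (q y)) * (inverse (h (q x)) * x) * y \<in> K" by (simp add: mgs)
    then have "inverse (h (q x) * h (q y)) * (x * y) \<in> K" by (simp add: mgs)
    then have "\<Phi> (h (q x) * h (q y)) = \<Phi> (x * y)" by (simp only: Phi_iff)
    then show ?thesis by (simp add: G_def \<Phi>_def)
  qed
  have car: "carrier G = range \<Phi>" and one: "\<one>\<^bsub>G\<^esub> = \<Phi> 1" by (simp_all add: G_def)
  have grpG: "group G"
  proof (rule groupI)
    fix x y z assume "x \<in> carrier G" "y \<in> carrier G" "z \<in> carrier G"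
    then show "(x \<otimes>\<^bsub>G\<^esub> y) \<otimes>\<^bsub>G\<^esub> z = x \<otimes>\<^bsub>G\<^esub> (y \<otimes>\<^bsub>G\<^esub> z)" by (auto simp: car Phi_mult mult.assoc)
  next
    fix x assume "x \<in> carrier G"
    then obtain t where t: "x = \<Phi> t" by (auto simp: car)
    show "\<exists>y\<in>carrier G. y \<otimes>\<^bsub>G\<^esub> x = \<one>\<^bsub>G\<^esub>" by (rule bexI[of _ "\<Phi> (inverse t)"]) (simp_all add: t car one Phi_mult)
  qed (auto simp: car one Phi_mult)
  have pow: "\<Phi> x [^]\<^bsub>G\<^esub> (n::nat) = \<Phi> (x ^ n)" for x n
    by (induction n) (simp_all add: one Phi_mult power_Suc2 del: power_Suc)
  have per: "periodic_group G"
    unfolding periodic_group_def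
  proof (intro conjI ballI grpG)
    fix x assume "x \<in> carrier G"
    then obtain t where t: "x = \<Phi> t" by (auto simp: car)
    obtain n where n: "0 < n" "t ^ n \<in> K" using tors by blast
    have "\<Phi> 1 = \<Phi> (t ^ n)" using n(2) by (simp add: Phi_iff)
    then have "x [^]\<^bsub>G\<^esub> n = \<one>\<^bsub>G\<^esub>" by (simp add: t pow one)
    then show "\<exists>n::nat. 0 < n \<and> x [^]\<^bsub>G\<^esub> n = \<one>\<^bsub>G\<^esub>" using n(1) by blast
  qed
  define f where "f = (\<lambda>l. \<Phi> (lt l))"
  have eqPhi: "\<Phi> x = \<Phi> y" if "eq x y" for x y
  proof -
    have "eq (inverse x * x) (inverse x * y)" by (rule eq_mult) (use that in auto)
    then show ?thesis unfolding Phi_iff by (intro K0) (simp add: nu0_zero eq_sym)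
  qed
  \<comment> \<open>The quotient of two letters has length at most two even if they come from
    different factors; this yields both the embeddings and the intersection.\<close>
  have f_inj: "l = l'" if l: "l \<in> car i" "l' \<in> car j" "f l = f l'" for l l' i j
  proof -
    have k: "inverse (lt l) * lt l' \<in> K" using l(3) by (simp add: f_def Phi_iff)
    have "eq (inverse (lt l) * lt l') (wd [iv i l, l'])" using eq_mult[OF eq_sym[OF eq_lt_inv[OF l(1)]] eq_refl, of "lt l'"] by simp
    then have "\<nu>0 (inverse (lt l) * lt l') \<le> 2" using nu0_le[of "[iv i l, l']"] L_car(2)[OF iv_closed[OF l(1)]] L_car(2)[OF l(2)] by (simp add: numeral_2_eq_2)
    then have "eq (inverse (lt l) * lt l') 1" using inj[OF _ k] by (simp add: nu0_zero)
    from eq_mult[OF eq_refl this, of "lt l"] have "eq (lt l) (lt l')" by (simp add: eq_sym)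
    then show ?thesis by (rule lt_inj[OF l(1,2)])
  qed
  have "f \<in> mon (GG i) G" for i
    unfolding mon_def
  proof (intro CollectI conjI homI)
    show "inj_on f (car i)" using f_inj by (blast intro: inj_onI)
  next
    fix x y assume "x \<in> car i" "y \<in> car i"
    then show "f (mu i x y) = f x \<otimes>\<^bsub>G\<^esub> f y" using eqPhi[OF eq_lt_mult] by (simp add: f_def Phi_mult)
  qed (simp add: f_def car)
  from this[of True] this[of False] have fm: "f \<in> mon A G" "f \<in> mon B G" by (simp_all add: GG_def)
  have CA: "C = carrier A \<inter> carrier B" using amal by (simp add: amalgam_def)
  have "f ` carrier A \<inter> f ` carrier B = f ` C"
    using f_inj[of _ True _ False] CA by (auto simp: GG_def)
  then have "contains_amalgam G A B C" unfolding contains_amalgam_def using fm by blast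
  then show ?thesis using per by blast
qed

end

theorem theorem1p3:
  fixes A B :: "'a monoid" and C :: "'a set"
  assumes "amalgam A B C"
    and "countable (carrier A)" and "countable (carrier B)"
    and "periodic_group A" and "periodic_group B"
    and "finite C"
  shows "\<exists>G :: ('a + nat) monoid. periodic_group G \<and> contains_amalgam G A B C"
proof -
  interpret amalg A B C by unfold_locales (use assms in auto)
  show ?thesis by (rule embedding) (use assms in auto)
qed

end
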